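(* Assume that $h\in L^{2}(\Omega)$ (independent of $t$), that $f\in C^1(\mathbb{R})$ satisfies $f'(s)\le\eta$ for all $s\in\mathbb{R}$ (for some constant $\eta$) and $$-\kappa-\alpha_{2}|s|^{p}\le f(s)s\le\kappa-\alpha_{1}|s|^{p}\quad\forall s\in\mathbb{R},$$ with constants $\alpha_1,\alpha_2>0$, $\kappa\ge0$, $p\ge2$, and that $a\in C(\mathbb{R}^{+},\mathbb{R}^{+})$ satisfies $m\le a(s)\le M_{1}+M_{2}s$ for all $s\ge 0$ with constants $m>0$, $M_1,M_2\ge 0$, and $s\mapsto a(s^2)s$ is nondecreasing. Then the global attractor $\mathcal{A}_{r}$ of the semigroup $T_r$ is bounded in $L^{\infty}(\Omega)$, provided that $h\in L^{\infty}(\Omega)$.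
   Context: $\Omega\subset\mathbb{R}^{n}$ ($n\ge1$) is a bounded open set with smooth boundary, $\mathbb{R}^{+}=[0,\infty)$, and $\|u\|_{H_0^1}=\|\nabla u\|_{L^2}$. Problem (P) is $$u_{t}-a(\|u\|_{H_{0}^{1}}^{2})\Delta u=f(u)+h\ \text{in }\Omega\times(0,\infty),\qquad u=0\ \text{on }\partial\Omega\times(0,\infty),\qquad u(0,x)=u_{0}(x)\ \text{in }\Omega.$$ $(\cdot,\cdot)$ denotes the $L^2(\Omega)$ inner product and also the duality between $L^p(\Omega)$ and $L^q(\Omega)$, $1/p+1/q=1$. A weak solution is a function $u\in L^{\infty}(0,T;L^{2}(\Omega))\cap L^{2}(0,T;H_{0}^{1}(\Omega))\cap L^{p}(0,T;L^{p}(\Omega))$ for any $T>0$ such that, for every $v\in H_0^1(\Omega)\cap L^p(\Omega)$, in the sense of scalar distributions on $(0,\infty)$, $$\frac{d}{dt}(u,v)+a(\|u(t)\|_{H_{0}^{1}}^{2})(\nabla u(t),\nabla v)=(f(u(t)),v)+(h,v).$$ A regular solution is a weak solution such that also $u\in L^{\infty}(\varepsilon,T;H_{0}^{1}(\Omega))\cap L^{2}(\varepsilon,T;D(A))$ for any $0<\varepsilon<T$, where $A=-\Delta$ and $D(A)=H^{2}(\Omega)\cap H_{0}^{1}(\Omega)$; under the hypotheses it belongs to $C([0,T];L^2(\Omega))$ for all $T>0$. Under the hypotheses, for each $u_0\in L^2(\Omega)$ there is a unique regular solution $u$ with $u(0)=u_0$, and $T_r:\mathbb{R}^+\times L^2(\Omega)\to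 L^2(\Omega)$, $T_r(t,u_0)=u(t)$, is a continuous semigroup, which has a global attractor $\mathcal{A}_r$: a compact set $\mathcal{A}_r\subset L^2(\Omega)$ with $T_r(t,\mathcal{A}_r)=\mathcal{A}_r$ for all $t\ge0$ and $\sup_{b\in B}\inf_{y\in\mathcal{A}_r}\|T_r(t,b)-y\|_{L^2}\to0$ as $t\to+\infty$ for every bounded $B\subset L^2(\Omega)$. *)

theory Defs
  imports "HOL-Analysis.Analysis"
begin

section \<open>The Hilbert space of square-integrable functions\<close>

definition square_integrable :: "('a::euclidean_space \<Rightarrow> real) \<Rightarrow> bool" where
  "square_integrable f \<longleftrightarrow>
     f \<in> borel_measurable lebesgue \<and> integrable lebesgue (\<lambda>x. (f x)\<^sup>2)"

definition ae_equal :: "('a::euclidean_space \<Rightarrow> real) \<Rightarrow> ('a \<Rightarrow> real) \<Rightarrow> bool" where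
  "ae_equal f g \<longleftrightarrow>
     square_integrable f \<and> square_integrable g \<and> (AE x in lebesgue. f x = g x)"

lemma square_integrable_0: "square_integrable (\<lambda>x. 0)"
  by (simp add: square_integrable_def)

lemma square_integrable_measurable:
  "square_integrable f \<Longrightarrow> f \<in> borel_measurable lebesgue"
  by (simp add: square_integrable_def)

lemma square_integrable_mult:
  assumes "square_integrable f" "square_integrable g"
  shows "integrable lebesgue (\<lambda>x. f x * g x)"
proof (rule Bochner_Integration.integrable_bound)
  show "integrable lebesgue (\<lambda>x. (f x)\<^sup>2 + (g x)\<^sup>2)"
    using assms by (auto simp: square_integrable_def)
  show "(\<lambda>x. f x * g x) \<in> borel_measurable lebesgue"
    using assms by (auto simp: square_integrable_def)
  have "\<bar>a * b\<bar> \<le> a\<^sup>2 + b\<^sup>2" for a b :: real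
  proof -
    have "2 * (\<bar>a\<bar> * \<bar>b\<bar>) \<le> a\<^sup>2 + b\<^sup>2"
      using sum_squares_bound[of "\<bar>a\<bar>" "\<bar>b\<bar>"] by simp
    moreover have "0 \<le> \<bar>a\<bar> * \<bar>b\<bar>" by simp
    ultimately show ?thesis unfolding abs_mult by linarith
  qed
  then show "AE x in lebesgue. norm (f x * g x) \<le> norm ((f x)\<^sup>2 + (g x)\<^sup>2)"
    by simp
qed

lemma square_integrable_add:
  assumes "square_integrable f" "square_integrable g"
  shows "square_integrable (\<lambda>x. f x + g x)"
  using assms square_integrable_mult[OF assms]
  by (auto simp: square_integrable_def power2_sum mult.assoc)

lemma square_integrable_scale:
  assumes "square_integrable f"
  shows "square_integrable (\<lambda>x. c * f x)"
  using assms by (auto simp: square_integrable_def power_mult_distrib)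

quotient_type (overloaded) 'a L2 = "'a::euclidean_space \<Rightarrow> real" / partial: ae_equal
  morphisms L2_rep L2_class
proof (rule part_equivpI)
  show "\<exists>f::'a \<Rightarrow> real. ae_equal f f"
    using square_integrable_0 by (auto simp: ae_equal_def)
  show "symp (ae_equal :: ('a \<Rightarrow> real) \<Rightarrow> _)"
    by (rule sympI) (auto simp: ae_equal_def)
  show "transp (ae_equal :: ('a \<Rightarrow> real) \<Rightarrow> _)"
    by (rule transpI) (auto simp: ae_equal_def)
qed

lemma L2_rep_ae_equal: "ae_equal (L2_rep u) (L2_rep u)"
  by (rule Quotient3_rep_reflp[OF Quotient3_L2])

lemma square_integrable_L2_rep: "square_integrable (L2_rep u)"
  using L2_rep_ae_equal by (auto simp: ae_equal_def)

lemma L2_rep_class: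
  assumes "square_integrable f"
  shows "AE x in lebesgue. L2_rep (L2_class f) x = f x"
  using Quotient3_rep_abs[OF Quotient3_L2, of f] assms by (auto simp: ae_equal_def)

instantiation L2 :: (euclidean_space) real_inner
begin

lift_definition zero_L2 :: "'a L2" is "\<lambda>x. 0"
  by (simp add: ae_equal_def square_integrable_0)

lift_definition plus_L2 :: "'a L2 \<Rightarrow> 'a L2 \<Rightarrow> 'a L2" is "\<lambda>f g x. f x + g x"
  by (auto simp: ae_equal_def square_integrable_add)

lift_definition scaleR_L2 :: "real \<Rightarrow> 'a L2 \<Rightarrow> 'a L2" is "\<lambda>c f x. c * f x"
  by (auto simp: ae_equal_def square_integrable_scale)

lift_definition inner_L2 :: "'a L2 \<Rightarrow> 'a L2 \<Rightarrow> real" is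
  "\<lambda>f g. LINT x|lebesgue. f x * g x"
  by (rule integral_cong_AE)
    (auto simp: ae_equal_def dest!: square_integrable_measurable)

definition uminus_L2 :: "'a L2 \<Rightarrow> 'a L2" where "- u = (-1) *\<^sub>R (u::'a L2)"
definition minus_L2 :: "'a L2 \<Rightarrow> 'a L2 \<Rightarrow> 'a L2" where "u - v = u + - (v::'a L2)"
definition norm_L2 :: "'a L2 \<Rightarrow> real" where "norm u = sqrt (inner u (u::'a L2))"
definition sgn_L2 :: "'a L2 \<Rightarrow> 'a L2" where "sgn u = inverse (norm u) *\<^sub>R (u::'a L2)"
definition dist_L2 :: "'a L2 \<Rightarrow> 'a L2 \<Rightarrow> real" where "dist u v = norm (u - (v::'a L2))"
definition uniformity_L2 :: "('a L2 \<times> 'a L2) filter" where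
  "uniformity = (INF e\<in>{0<..}. principal {(x, y::'a L2). dist x y < e})"
definition open_L2 :: "'a L2 set \<Rightarrow> bool" where
  "open (U::'a L2 set) = (\<forall>x\<in>U. eventually (\<lambda>(x', y). x' = x \<longrightarrow> y \<in> U) uniformity)"

instance
proof
  fix u v w :: "'a L2" and c d :: real
  show "u + v + w = u + (v + w)"
    by transfer (auto simp: ae_equal_def square_integrable_add add.assoc)
  show "u + v = v + u"
    by transfer (auto simp: ae_equal_def square_integrable_add add.commute)
  show "0 + u = u"
    by transfer (auto simp: ae_equal_def)
  show "- u + u = 0"
    unfolding uminus_L2_def
    by transfer (auto simp: ae_equal_def square_integrable_0
        intro: square_integrable_add square_integrable_scale[where c = "-1", simplified])
  show "u - v = u + - v"
    by (rule minus_L2_def)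
  show "c *\<^sub>R (u + v) = c *\<^sub>R u + c *\<^sub>R v"
    by transfer (auto simp: ae_equal_def square_integrable_add square_integrable_scale algebra_simps
        intro!: square_integrable_add square_integrable_scale)
  show "(c + d) *\<^sub>R u = c *\<^sub>R u + d *\<^sub>R u"
    by transfer (auto simp: ae_equal_def square_integrable_add square_integrable_scale algebra_simps
        intro!: square_integrable_add square_integrable_scale)
  show "c *\<^sub>R d *\<^sub>R u = (c * d) *\<^sub>R u"
    by transfer (auto simp: ae_equal_def square_integrable_scale mult.assoc)
  show "1 *\<^sub>R u = u"
    by transfer (auto simp: ae_equal_def)
  show "dist u v = norm (u - v)"
    by (rule dist_L2_def)
  show "sgn u = inverse (norm u) *\<^sub>R u"
    by (rule sgn_L2_def)
  show "(uniformity :: ('a L2 \<times> 'a L2) filter) =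
      (INF e\<in>{0<..}. principal {(x, y). dist x y < e})"
    by (rule uniformity_L2_def)
  show "open U = (\<forall>x\<in>U. eventually (\<lambda>(x', y). x' = x \<longrightarrow> y \<in> U) uniformity)"
    for U :: "'a L2 set"
    by (rule open_L2_def)
  show "norm u = sqrt (inner u u)"
    by (rule norm_L2_def)
  show "inner u v = inner v u"
    by transfer (simp add: mult.commute)
  show "inner (u + v) w = inner u w + inner v w"
    by transfer (simp add: ae_equal_def distrib_right square_integrable_mult)
  show "inner (c *\<^sub>R u) v = c * inner u v"
    by transfer (simp add: mult.assoc)
  show "0 \<le> inner u u"
    by transfer simp
  show "inner u u = 0 \<longleftrightarrow> u = 0"
  proof transfer
    fix f :: "'a \<Rightarrow> real"
    assume "ae_equal f f"
    then have f: "square_integrable f" by (simp add: ae_equal_def)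
    have "(LINT x|lebesgue. f x * f x) = 0 \<longleftrightarrow> (AE x in lebesgue. f x * f x = 0)"
      by (rule integral_nonneg_eq_0_iff_AE) (auto intro: square_integrable_mult f)
    then show "(LINT x|lebesgue. f x * f x) = 0 \<longleftrightarrow> ae_equal f (\<lambda>x. 0)"
      using f by (simp add: ae_equal_def square_integrable_0)
  qed
qed

end

text \<open>
  \<open>L\<^sup>2(\<Omega>)\<close> is the subspace of the functions in \<open>L\<^sup>2\<close> of the whole space that vanish outside
  \<open>\<Omega>\<close>, i.e. functions on \<open>\<Omega>\<close> are identified with their extension by zero. Hence \<^const>\<open>inner\<close>
  and \<^const>\<open>norm\<close> restricted to it are the inner product and the norm of \<open>L\<^sup>2(\<Omega>)\<close>.
\<close>

definition L2_on :: "'a::euclidean_space set \<Rightarrow> 'a L2 set" where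
  "L2_on \<Omega> = {u. AE x in lebesgue. x \<notin> \<Omega> \<longrightarrow> L2_rep u x = 0}"


section \<open>Lebesgue spaces on a bounded domain\<close>

text \<open>For \<open>p \<ge> 2\<close> and bounded \<open>\<Omega>\<close> one has \<open>L\<^sup>\<infinity>(\<Omega>) \<subseteq> L\<^sup>p(\<Omega>) \<subseteq> L\<^sup>2(\<Omega>)\<close>, so that nothing is lost by
  carving these spaces out of \<^const>\<open>L2_on\<close>.\<close>

definition Lp_on :: "real \<Rightarrow> 'a::euclidean_space set \<Rightarrow> 'a L2 set" where
  "Lp_on p \<Omega> = {u \<in> L2_on \<Omega>. integrable (lebesgue_on \<Omega>) (\<lambda>x. \<bar>L2_rep u x\<bar> powr p)}"

definition Lp_norm :: "real \<Rightarrow> 'a::euclidean_space set \<Rightarrow> 'a L2 \<Rightarrow> real" where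
  "Lp_norm p \<Omega> u = (LINT x|lebesgue_on \<Omega>. \<bar>L2_rep u x\<bar> powr p) powr (1 / p)"

definition Linf_on :: "'a::euclidean_space set \<Rightarrow> 'a L2 set" where
  "Linf_on \<Omega> = {u \<in> L2_on \<Omega>. \<exists>C. AE x in lebesgue_on \<Omega>. \<bar>L2_rep u x\<bar> \<le> C}"

definition Linf_norm :: "'a::euclidean_space set \<Rightarrow> 'a L2 \<Rightarrow> real" where
  "Linf_norm \<Omega> u = Inf {C. 0 \<le> C \<and> (AE x in lebesgue_on \<Omega>. \<bar>L2_rep u x\<bar> \<le> C)}"


section \<open>Smooth functions and smooth boundaries\<close>

text \<open>The following is meant for open \<open>S\<close> only.\<close>

primrec Ck_on :: "nat \<Rightarrow> 'a::euclidean_space set \<Rightarrow> ('a \<Rightarrow> real) \<Rightarrow> bool" where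
  "Ck_on 0 S f \<longleftrightarrow> continuous_on S f"
| "Ck_on (Suc k) S f \<longleftrightarrow>
     (\<forall>x\<in>S. f differentiable (at x)) \<and>
     (\<forall>b\<in>Basis. Ck_on k S (\<lambda>x. frechet_derivative f (at x) b))"

definition smooth_on :: "'a::euclidean_space set \<Rightarrow> ('a \<Rightarrow> real) \<Rightarrow> bool" where
  "smooth_on S f \<longleftrightarrow> (\<forall>k. Ck_on k S f)"

definition test_functions :: "'a::euclidean_space set \<Rightarrow> ('a \<Rightarrow> real) set" where
  "test_functions S =
     {\<phi>. smooth_on UNIV \<phi> \<and> compact (closure {x. \<phi> x \<noteq> 0}) \<and> closure {x. \<phi> x \<noteq> 0} \<subseteq> S}"

text \<open>A smooth boundary: near each boundary point, \<open>\<Omega>\<close> is a strict sublevel set of a smooth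
  function without critical points, so that \<open>\<Omega>\<close> lies on one side of a smooth hypersurface.\<close>

definition smooth_boundary :: "'a::euclidean_space set \<Rightarrow> bool" where
  "smooth_boundary \<Omega> \<longleftrightarrow>
     (\<forall>x\<in>frontier \<Omega>. \<exists>U \<phi>. open U \<and> x \<in> U \<and> smooth_on U \<phi> \<and>
        (\<forall>y\<in>U. frechet_derivative \<phi> (at y) \<noteq> (\<lambda>_. 0)) \<and>
        \<Omega> \<inter> U = {y \<in> U. \<phi> y < 0})"


section \<open>Sobolev spaces\<close>

definition has_weak_deriv ::
    "'a::euclidean_space set \<Rightarrow> 'a \<Rightarrow> 'a L2 \<Rightarrow> 'a L2 \<Rightarrow> bool" where
  "has_weak_deriv \<Omega> b u g \<longleftrightarrow>
     g \<in> L2_on \<Omega> \<and>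
     (\<forall>\<phi>\<in>test_functions \<Omega>.
        (LINT x|lebesgue_on \<Omega>. L2_rep u x * frechet_derivative \<phi> (at x) b)
        = - (LINT x|lebesgue_on \<Omega>. L2_rep g x * \<phi> x))"

definition weak_deriv :: "'a::euclidean_space set \<Rightarrow> 'a \<Rightarrow> 'a L2 \<Rightarrow> 'a L2" where
  "weak_deriv \<Omega> b u = (THE g. has_weak_deriv \<Omega> b u g)"

definition H1 :: "'a::euclidean_space set \<Rightarrow> 'a L2 set" where
  "H1 \<Omega> = {u \<in> L2_on \<Omega>. \<forall>b\<in>Basis. \<exists>g. has_weak_deriv \<Omega> b u g}"

definition grad_inner :: "'a::euclidean_space set \<Rightarrow> 'a L2 \<Rightarrow> 'a L2 \<Rightarrow> real" where
  "grad_inner \<Omega> u v = (\<Sum>b\<in>Basis. inner (weak_deriv \<Omega> b u) (weak_deriv \<Omega> b v))"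

definition H1_norm :: "'a::euclidean_space set \<Rightarrow> 'a L2 \<Rightarrow> real" where
  "H1_norm \<Omega> u = sqrt ((norm u)\<^sup>2 + grad_inner \<Omega> u u)"

text \<open>\<open>H\<^sub>0\<^sup>1(\<Omega>)\<close> is the closure of the test functions in \<open>H\<^sup>1(\<Omega>)\<close>.\<close>

definition H10 :: "'a::euclidean_space set \<Rightarrow> 'a L2 set" where
  "H10 \<Omega> = {u \<in> H1 \<Omega>. \<forall>\<epsilon>>0. \<exists>\<phi>\<in>test_functions \<Omega>. H1_norm \<Omega> (u - L2_class \<phi>) < \<epsilon>}"

definition H10_norm :: "'a::euclidean_space set \<Rightarrow> 'a L2 \<Rightarrow> real" where
  "H10_norm \<Omega> u = sqrt (grad_inner \<Omega> u u)"

definition H2 :: "'a::euclidean_space set \<Rightarrow> 'a L2 set" where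
  "H2 \<Omega> = {u \<in> H1 \<Omega>. \<forall>b\<in>Basis. weak_deriv \<Omega> b u \<in> H1 \<Omega>}"

definition laplacian :: "'a::euclidean_space set \<Rightarrow> 'a L2 \<Rightarrow> 'a L2" where
  "laplacian \<Omega> u = (\<Sum>b\<in>Basis. weak_deriv \<Omega> b (weak_deriv \<Omega> b u))"

definition dom_A :: "'a::euclidean_space set \<Rightarrow> 'a L2 set" where
  "dom_A \<Omega> = H2 \<Omega> \<inter> H10 \<Omega>"

text \<open>The graph norm of \<open>A = - \<Delta>\<close>.\<close>

definition dom_A_norm :: "'a::euclidean_space set \<Rightarrow> 'a L2 \<Rightarrow> real" where
  "dom_A_norm \<Omega> u = sqrt ((norm u)\<^sup>2 + (norm (laplacian \<Omega> u))\<^sup>2)"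


section \<open>Bochner spaces\<close>

text \<open>A normed space embedded in \<open>L\<^sup>2\<close> is given by its carrier \<open>X\<close> and its norm \<open>N\<close>.\<close>

definition strongly_measurable_on ::
    "real set \<Rightarrow> 'a::euclidean_space L2 set \<Rightarrow> ('a L2 \<Rightarrow> real) \<Rightarrow> (real \<Rightarrow> 'a L2) \<Rightarrow> bool" where
  "strongly_measurable_on I X N u \<longleftrightarrow>
     (AE t in lebesgue_on I. u t \<in> X) \<and>
     (\<exists>s::nat \<Rightarrow> real \<Rightarrow> 'a L2.
        (\<forall>k. simple_function (lebesgue_on I) (s k) \<and> s k ` I \<subseteq> X) \<and>
        (AE t in lebesgue_on I. (\<lambda>k. N (u t - s k t)) \<longlonglongrightarrow> 0))"

definition Bochner_Lp ::
    "real \<Rightarrow> real set \<Rightarrow> 'a::euclidean_space L2 set \<Rightarrow> ('a L2 \<Rightarrow> real) \<Rightarrow> (real \<Rightarrow> 'a L2) set" where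
  "Bochner_Lp r I X N =
     {u. strongly_measurable_on I X N u \<and>
         integrable (lebesgue_on I) (\<lambda>t. N (u t) powr r)}"

definition Bochner_Linf ::
    "real set \<Rightarrow> 'a::euclidean_space L2 set \<Rightarrow> ('a L2 \<Rightarrow> real) \<Rightarrow> (real \<Rightarrow> 'a L2) set" where
  "Bochner_Linf I X N =
     {u. strongly_measurable_on I X N u \<and> (\<exists>C. AE t in lebesgue_on I. N (u t) \<le> C)}"


section \<open>Weak and regular solutions\<close>

definition locally_integrable :: "real set \<Rightarrow> (real \<Rightarrow> real) \<Rightarrow> bool" where
  "locally_integrable I w \<longleftrightarrow>
     (\<forall>K. compact K \<and> K \<subseteq> I \<longrightarrow> integrable (lebesgue_on K) w)"

text \<open>The identity \<open>w' + g = k\<close> in the sense of scalar distributions on \<open>I\<close>; the three functions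
  have to be locally integrable in order to define distributions.\<close>

definition distributional_ode ::
    "real set \<Rightarrow> (real \<Rightarrow> real) \<Rightarrow> (real \<Rightarrow> real) \<Rightarrow> (real \<Rightarrow> real) \<Rightarrow> bool" where
  "distributional_ode I w g k \<longleftrightarrow>
     locally_integrable I w \<and> locally_integrable I g \<and> locally_integrable I k \<and>
     (\<forall>\<psi>\<in>test_functions I.
        - (LINT t|lebesgue_on I. w t * deriv \<psi> t) + (LINT t|lebesgue_on I. g t * \<psi> t)
        = (LINT t|lebesgue_on I. k t * \<psi> t))"

definition weak_solution ::
    "'a::euclidean_space set \<Rightarrow> (real \<Rightarrow> real) \<Rightarrow> (real \<Rightarrow> real) \<Rightarrow> 'a L2 \<Rightarrow> real
      \<Rightarrow> (real \<Rightarrow> 'a L2) \<Rightarrow> bool" where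
  "weak_solution \<Omega> a f h p u \<longleftrightarrow>
     (\<forall>T>0. u \<in> Bochner_Linf {0<..<T} (L2_on \<Omega>) norm \<and>
            u \<in> Bochner_Lp 2 {0<..<T} (H10 \<Omega>) (H10_norm \<Omega>) \<and>
            u \<in> Bochner_Lp p {0<..<T} (Lp_on p \<Omega>) (Lp_norm p \<Omega>)) \<and>
     (\<forall>v \<in> H10 \<Omega> \<inter> Lp_on p \<Omega>.
        distributional_ode {0<..}
          (\<lambda>t. inner (u t) v)
          (\<lambda>t. a ((H10_norm \<Omega> (u t))\<^sup>2) * grad_inner \<Omega> (u t) v)
          (\<lambda>t. (LINT x|lebesgue_on \<Omega>. f (L2_rep (u t) x) * L2_rep v x) + inner h v))"

definition regular_solution ::
    "'a::euclidean_space set \<Rightarrow> (real \<Rightarrow> real) \<Rightarrow> (real \<Rightarrow> real) \<Rightarrow> 'a L2 \<Rightarrow> real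
      \<Rightarrow> (real \<Rightarrow> 'a L2) \<Rightarrow> bool" where
  "regular_solution \<Omega> a f h p u \<longleftrightarrow>
     weak_solution \<Omega> a f h p u \<and>
     (\<forall>\<epsilon> T. 0 < \<epsilon> \<and> \<epsilon> < T \<longrightarrow>
        u \<in> Bochner_Linf {\<epsilon><..<T} (H10 \<Omega>) (H10_norm \<Omega>) \<and>
        u \<in> Bochner_Lp 2 {\<epsilon><..<T} (dom_A \<Omega>) (dom_A_norm \<Omega>))"

text \<open>\<open>T\<close> is the map \<open>T\<^sub>r\<close>: \<open>T t u\<^sub>0\<close> is the value at time \<open>t\<close> of the regular solution starting at
  \<open>u\<^sub>0\<close>. Solutions are determined only up to null sets of times; the values for every \<open>t \<ge> 0\<close>,
  and in particular the initial value, are those of the representative in \<open>C([0,\<infinity>); L\<^sup>2(\<Omega>))\<close>.\<close>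

definition regular_solution_map ::
    "'a::euclidean_space set \<Rightarrow> (real \<Rightarrow> real) \<Rightarrow> (real \<Rightarrow> real) \<Rightarrow> 'a L2 \<Rightarrow> real
      \<Rightarrow> (real \<Rightarrow> 'a L2 \<Rightarrow> 'a L2) \<Rightarrow> bool" where
  "regular_solution_map \<Omega> a f h p T \<longleftrightarrow>
     (\<forall>u\<^sub>0 \<in> L2_on \<Omega>.
        regular_solution \<Omega> a f h p (\<lambda>t. T t u\<^sub>0) \<and>
        continuous_on {0..} (\<lambda>t. T t u\<^sub>0) \<and>
        T 0 u\<^sub>0 = u\<^sub>0)"


section \<open>Global attractors\<close>

text \<open>Nonemptiness is part of the attraction property under the convention \<open>inf \<emptyset> = \<infinity>\<close>; it has to be
  required because \<^const>\<open>infdist\<close> to the empty set is \<open>0\<close>.\<close>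

definition global_attractor ::
    "'b::metric_space set \<Rightarrow> (real \<Rightarrow> 'b \<Rightarrow> 'b) \<Rightarrow> 'b set \<Rightarrow> bool" where
  "global_attractor X T \<A> \<longleftrightarrow>
     compact \<A> \<and> \<A> \<noteq> {} \<and> \<A> \<subseteq> X \<and>
     (\<forall>t\<ge>0. T t ` \<A> = \<A>) \<and>
     (\<forall>B. bounded B \<and> B \<subseteq> X \<longrightarrow>
        ((\<lambda>t. SUP b\<in>B. ennreal (infdist (T t b) \<A>)) \<longlongrightarrow> 0) at_top)"

end

theory Submission
  imports Defs "HOL-Computational_Algebra.Polynomial"
begin

text \<open>On the attractor the solution is bounded by the level \<open>M = max 1 ((\<kappa> + H) / \<alpha>\<^sub>1)\<close>, where
\<open>H\<close> bounds \<open>h\<close>: above \<open>M\<close> the reaction pushes downwards, since \<open>f(s) + H \<le> - \<alpha>\<^sub>1 (s - M)\<close> for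
\<open>s \<ge> M\<close>. Take a smooth convex \<open>\<Phi>\<close> that vanishes exactly on \<open>(-\<infinity>, M]\<close> and test the equation with
\<open>\<beta>(u)\<close>, \<open>\<beta> = \<Phi>'\<close>. The diffusion term has a sign because \<open>\<beta>' \<ge> 0\<close> and \<open>a \<ge> 0\<close>, so that the energy
\<open>E(u) = \<integral> \<Phi>(u)\<close> satisfies, at least formally, \<open>d/dt E(u) \<le> - \<alpha>\<^sub>1 E(u)\<close>. By compactness \<open>E\<close> attains a
maximum over the attractor, by invariance at some \<open>T 1 w\<close>, and along the trajectory of \<open>w\<close> it can never
exceed its value at time \<open>1\<close>. If that value were positive, the decay just before time \<open>1\<close> would contradict
this. Hence \<open>E = 0\<close> on the attractor, that is \<open>u \<le> M\<close> almost everywhere. The reflected truncation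
\<open>s \<mapsto> \<Phi>(-s)\<close> gives \<open>u \<ge> - M\<close> in the same way.

The decay of \<open>E\<close> has to be extracted from an equation that holds only weakly and in the sense of
distributions in time. The test function is frozen: \<open>v = \<beta>(\<phi>)\<close> with a smooth \<open>\<phi>\<close> that is close in
\<open>L\<^sup>2\<close> to \<open>u(t)\<close>. For fixed \<open>v\<close> the equation can be integrated over \<open>[s, t]\<close>
(\<open>distributional_ode_increment\<close>), and convexity gives \<open>E(u(t)) - E(u(s)) \<le> (u(t) - u(s), \<beta>(u(t)))\<close>.
The price is that \<open>u(\<tau>)\<close>, \<open>\<tau> \<in> [s, t]\<close>, meets a test function built from \<open>\<phi>\<close>, and both resulting
errors are small as soon as \<open>u(\<tau>) - \<phi>\<close> is small in \<open>L\<^sup>2\<close>: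

\<^item> In the diffusion term the gradient is moved back onto \<open>u(\<tau>)\<close>, which is in the domain of the Laplacian
  for almost every \<open>\<tau>\<close>. Since \<open>(\<Delta>w, \<beta>(w)) \<le> 0\<close> (\<open>laplacian_nemytskii_nonpos\<close>), the error is at most
  a multiple of \<open>\<parallel>\<Delta>u(\<tau>)\<parallel> \<parallel>u(\<tau>) - \<phi>\<parallel>\<close>, and \<open>\<parallel>\<Delta>u(\<tau>)\<parallel>\<close> is integrable in time.

\<^item> For the reaction term there is a pointwise inequality
  \<open>(f(r) + h) \<beta>(s) \<le> - \<alpha>\<^sub>1 \<Phi>(s) + \<epsilon> (1 + \<bar>r\<bar>\<^sup>p) + C\<^sub>\<epsilon> (r - s)\<^sup>2\<close> (\<open>reaction_dissipation\<close>), and the \<open>p\<close>-th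
  power of the \<open>L\<^sup>p\<close> norm of \<open>u(\<tau>)\<close> is integrable in time.

Letting \<open>\<phi>\<close> tend to \<open>u(t)\<close> gives the decay of \<open>E\<close> up to an error \<open>e \<integral>\<^sub>s\<^sup>t G\<close> whenever \<open>t - s\<close> is small
(\<open>energy_increment_le\<close>). These increments add up over a fine partition (\<open>nonincreasing_if_locally\<close>), and
then \<open>e\<close> tends to \<open>0\<close>.\<close>

section \<open>Flat functions and closure properties of smooth functions\<close>

text \<open>The functions \<open>q(1/x) e\<^sup>-\<^sup>1\<^sup>/\<^sup>x\<close>, extended by \<open>0\<close> to the left half-line. Letting the polynomial \<open>q\<close> vary makes
the class closed under differentiation, so that smoothness is a plain induction. All cut-off functions below
are built from it.\<close>

definition flat :: "real poly \<Rightarrow> real \<Rightarrow> real" where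
  "flat q x = (if x \<le> 0 then 0 else poly q (inverse x) * exp (- inverse x))"

lemma poly_div_exp_tendsto_0: "((\<lambda>y::real. poly q y * exp (- y)) \<longlongrightarrow> 0) at_top"
proof -
  have "((\<lambda>y::real. \<Sum>i\<le>degree q. coeff q i * (y ^ i / exp y)) \<longlongrightarrow> (\<Sum>i\<le>degree q. coeff q i * 0)) at_top"
    by (intro tendsto_sum tendsto_mult tendsto_const tendsto_power_div_exp_0)
  then show ?thesis
    by (simp add: poly_altdef sum_distrib_right exp_minus divide_inverse mult.assoc)
qed

lemma DERIV_flat:
  "(flat q has_field_derivative flat (monom 1 2 * (q - pderiv q)) x) (at x)"
proof -
  \<comment> \<open>At \<open>0\<close> the difference quotient is \<open>y q(y) e\<^sup>-\<^sup>y\<close> with \<open>y = 1/x\<close>, which tends to \<open>0\<close>.\<close>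
  consider "x < 0" | "x = 0" | "x > 0" by linarith
  then show ?thesis
  proof cases
    case 1
    have "((\<lambda>x. 0) has_field_derivative 0) (at x)" by simp
    moreover have "\<forall>\<^sub>F y in nhds x. flat q y = 0"
      using eventually_nhds_in_open[of "{..<0}" x] 1 by (auto simp: flat_def elim!: eventually_mono)
    ultimately show ?thesis
      using 1 by (subst DERIV_cong_ev[OF refl _ refl, of _ "\<lambda>x. 0"]) (auto simp: flat_def)
  next
    case 2
    have "((\<lambda>h::real. flat q h / h) \<longlongrightarrow> 0) (at_left 0)"
      by (rule tendsto_eventually) (auto simp: flat_def eventually_at_left[of "-1"] intro!: exI[of _ "-1"])
    moreover have "((\<lambda>h::real. flat q h / h) \<longlongrightarrow> 0) (at_right 0)"
    proof -
      have "((\<lambda>h::real. poly (pCons 0 q) (inverse h) * exp (- inverse h)) \<longlongrightarrow> 0) (at_right 0)"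
        by (rule filterlim_compose[OF poly_div_exp_tendsto_0 filterlim_inverse_at_top_right])
      moreover have "\<forall>\<^sub>F h in at_right 0. poly (pCons 0 q) (inverse h) * exp (- inverse h) = flat q h / h"
        using eventually_at_right_less[of "0::real"]
        by (rule eventually_mono) (auto simp: flat_def field_simps)
      ultimately show ?thesis by (rule Lim_transform_eventually)
    qed
    ultimately have "((\<lambda>h::real. flat q h / h) \<longlongrightarrow> 0) (at 0)"
      by (simp add: filterlim_split_at_real)
    then show ?thesis using 2 by (simp add: DERIV_def flat_def)
  next
    case 3
    have "((\<lambda>x. poly q (inverse x) * exp (- inverse x)) has_field_derivative
        flat (monom 1 2 * (q - pderiv q)) x) (at x)"
      using 3 by (auto intro!: derivative_eq_intros DERIV_chain2[OF poly_DERIV]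
          simp: flat_def poly_monom algebra_simps power2_eq_square)
    moreover have "\<forall>\<^sub>F y in nhds x. flat q y = poly q (inverse y) * exp (- inverse y)"
      using eventually_nhds_in_open[of "{0<..}" x] 3 by (auto simp: flat_def elim!: eventually_mono)
    ultimately show ?thesis
      using 3 by (subst DERIV_cong_ev[OF refl _ refl, of _ "\<lambda>y. poly q (inverse y) * exp (- inverse y)"]) auto
  qed
qed

lemma Ck_on_SucI:
  assumes "\<And>x. (f has_derivative D x) (at x)" "\<And>b. b \<in> Basis \<Longrightarrow> Ck_on k UNIV (\<lambda>x. D x b)"
  shows "Ck_on (Suc k) UNIV f"
proof -
  have "frechet_derivative f (at x) = D x" for x
    using frechet_derivative_at[OF assms(1)] by simp
  moreover have "f differentiable (at x)" for x
    using assms(1) unfolding differentiable_def by blast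
  ultimately show ?thesis using assms(2) by simp
qed

lemma Ck_on_SucD:
  assumes "Ck_on (Suc k) UNIV f"
  shows "(f has_derivative frechet_derivative f (at x)) (at x)"
    and "b \<in> Basis \<Longrightarrow> Ck_on k UNIV (\<lambda>x. frechet_derivative f (at x) b)"
  using assms frechet_derivative_works by fastforce+

lemma Ck_on_Suc_imp: "Ck_on (Suc k) UNIV f \<Longrightarrow> Ck_on k UNIV f"
proof (induction k arbitrary: f)
  case 0
  then have "f differentiable (at x)" for x by simp
  then show ?case
    by (simp add: continuous_at_imp_continuous_on differentiable_imp_continuous_within)
next
  case (Suc k)
  have "Ck_on k UNIV (\<lambda>x. frechet_derivative f (at x) b)" if "b \<in> Basis" for b
    using that Suc.prems by (intro Suc.IH) simp
  moreover have "\<forall>x. f differentiable (at x)" using Suc.prems by simp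
  ultimately show ?case by simp
qed

lemma Ck_on_const: "Ck_on k UNIV (\<lambda>x. c)"
proof (induction k arbitrary: c)
  case (Suc k)
  show ?case by (rule Ck_on_SucI[where D = "\<lambda>_ _. 0"]) (auto intro: Suc)
qed auto

lemma Ck_on_inner: "Ck_on k UNIV (\<lambda>x. inner x v)"
proof (cases k)
  case (Suc k')
  show ?thesis unfolding Suc
    by (rule Ck_on_SucI[where D = "\<lambda>_ y. inner y v"])
      (intro Ck_on_const bounded_linear_imp_has_derivative bounded_linear_inner_left)+
qed (auto intro: continuous_intros)

lemma Ck_on_add: "Ck_on k UNIV f \<Longrightarrow> Ck_on k UNIV g \<Longrightarrow> Ck_on k UNIV (\<lambda>x. f x + g x)"
proof (induction k arbitrary: f g)
  case (Suc k)
  show ?case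
    by (rule Ck_on_SucI, rule has_derivative_add[OF Ck_on_SucD(1)[OF Suc.prems(1)] Ck_on_SucD(1)[OF Suc.prems(2)]])
      (intro Suc.IH Ck_on_SucD(2) Suc.prems)
qed (auto intro: continuous_intros)

lemma Ck_on_mult: "Ck_on k UNIV f \<Longrightarrow> Ck_on k UNIV g \<Longrightarrow> Ck_on k UNIV (\<lambda>x. f x * g x)"
proof (induction k arbitrary: f g)
  case (Suc k)
  show ?case
    by (rule Ck_on_SucI, rule has_derivative_mult[OF Ck_on_SucD(1)[OF Suc.prems(1)] Ck_on_SucD(1)[OF Suc.prems(2)]])
      (intro Ck_on_add Suc.IH Ck_on_SucD(2)[OF Suc.prems(1)] Ck_on_SucD(2)[OF Suc.prems(2)]
        Suc.prems[THEN Ck_on_Suc_imp])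
qed (auto intro: continuous_intros)

lemma Ck_on_prod: "(\<And>i. i \<in> I \<Longrightarrow> Ck_on k UNIV (f i)) \<Longrightarrow> Ck_on k UNIV (\<lambda>x. \<Prod>i\<in>I. f i x)"
  by (induction I rule: infinite_finite_induct) (auto intro: Ck_on_const Ck_on_mult)

lemma smooth_on_real_deriv:
  assumes "smooth_on UNIV (G :: real \<Rightarrow> real)"
  shows "(G has_field_derivative deriv G x) (at x)" "smooth_on UNIV (deriv G)"
proof -
  have d: "(G has_derivative frechet_derivative G (at x)) (at x)" for x
    using assms Ck_on_SucD(1) unfolding smooth_on_def by blast
  have 1: "(G has_field_derivative frechet_derivative G (at x) 1) (at x)" for x
  proof (rule has_derivative_imp_has_field_derivative[OF d])
    show "y * frechet_derivative G (at x) 1 = frechet_derivative G (at x) y" for y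
      using linear_scale[OF bounded_linear.linear[OF has_derivative_bounded_linear[OF d]], of x y 1]
      by simp
  qed
  have 2: "deriv G x = frechet_derivative G (at x) 1" for x
    using 1 by (rule DERIV_imp_deriv)
  show "(G has_field_derivative deriv G x) (at x)" using 1 2 by simp
  have "Ck_on k UNIV (\<lambda>x. frechet_derivative G (at x) 1)" for k
    using assms by (intro Ck_on_SucD(2)) (auto simp: smooth_on_def)
  moreover have "deriv G = (\<lambda>x. frechet_derivative G (at x) 1)" using 2 by auto
  ultimately show "smooth_on UNIV (deriv G)" unfolding smooth_on_def by simp
qed

text \<open>The outer function is only allowed to be a smooth function of one real variable. Its derivative is again of
this kind, so the induction closes by the chain and product rules alone.\<close>

lemma Ck_on_compose_real:
  assumes "smooth_on UNIV (G :: real \<Rightarrow> real)" "Ck_on k UNIV f"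
  shows "Ck_on k UNIV (\<lambda>x. G (f x))"
  using assms
proof (induction k arbitrary: G f)
  case 0
  then have "continuous_on UNIV G" using Ck_on.simps(1) unfolding smooth_on_def by blast
  with 0 show ?case by (auto intro: continuous_on_compose2)
next
  case (Suc k)
  show ?case
  proof (rule Ck_on_SucI)
    show "((\<lambda>x. G (f x)) has_derivative (\<lambda>b. deriv G (f x) * frechet_derivative f (at x) b)) (at x)" for x
      using has_derivative_compose[OF Ck_on_SucD(1)[OF Suc.prems(2)]
          smooth_on_real_deriv(1)[OF Suc.prems(1), unfolded has_field_derivative_def]] by simp
    show "Ck_on k UNIV (\<lambda>x. deriv G (f x) * frechet_derivative f (at x) b)" if "b \<in> Basis" for b
      by (rule Ck_on_mult[OF Suc.IH[OF smooth_on_real_deriv(2)[OF Suc.prems(1)] Ck_on_Suc_imp[OF Suc.prems(2)]]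
            Ck_on_SucD(2)[OF Suc.prems(2) that]])
  qed
qed

lemma smooth_on_flat: "smooth_on UNIV (flat q)"
  unfolding smooth_on_def
proof
  show "Ck_on k UNIV (flat q)" for k
  proof (induction k arbitrary: q)
    case 0
    then show ?case
      using DERIV_isCont[OF DERIV_flat] by (auto simp: continuous_on_eq_continuous_at)
  next
    case (Suc k)
    show ?case
    proof (rule Ck_on_SucI)
      show "(flat q has_derivative (\<lambda>b. flat (monom 1 2 * (q - pderiv q)) x * b)) (at x)" for x
        using DERIV_flat by (simp add: has_field_derivative_def)
      show "Ck_on k UNIV (\<lambda>x. flat (monom 1 2 * (q - pderiv q)) x * b)" for b
        by (rule Ck_on_mult[OF Suc Ck_on_const])
    qed
  qed
qed

section \<open>Test functions\<close>

lemma test_functionsI: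
  assumes "smooth_on UNIV \<phi>" "compact K" "K \<subseteq> S" "\<And>x. x \<notin> K \<Longrightarrow> \<phi> x = 0"
  shows "\<phi> \<in> test_functions S"
proof -
  have "closure {x. \<phi> x \<noteq> 0} \<subseteq> K"
    using assms by (intro closure_minimal compact_imp_closed) auto
  moreover have "compact (closure {x. \<phi> x \<noteq> 0})"
    using calculation assms(2) closed_closure compact_Int_closed[of K "closure {x. \<phi> x \<noteq> 0}"]
    by (simp add: Int_absorb1)
  ultimately show ?thesis using assms by (auto simp: test_functions_def)
qed

lemma test_functions_smooth: "\<phi> \<in> test_functions S \<Longrightarrow> smooth_on UNIV \<phi>"
  by (simp add: test_functions_def)

lemma test_functions_zero:
  assumes "\<phi> \<in> test_functions S" "x \<notin> S" shows "\<phi> x = 0"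
  using assms closure_subset[of "{x. \<phi> x \<noteq> 0}"] by (auto simp: test_functions_def)

lemma test_functions_has_derivative:
  "\<phi> \<in> test_functions S \<Longrightarrow> (\<phi> has_derivative frechet_derivative \<phi> (at x)) (at x)"
  using Ck_on_SucD(1) unfolding test_functions_def smooth_on_def by blast

lemma test_functions_continuous: "\<phi> \<in> test_functions S \<Longrightarrow> continuous_on UNIV \<phi>"
  using Ck_on.simps(1) unfolding test_functions_def smooth_on_def by blast

lemma test_functions_deriv_smooth:
  assumes "\<phi> \<in> test_functions S" "b \<in> Basis"
  shows "smooth_on UNIV (\<lambda>x. frechet_derivative \<phi> (at x) b)"
  using assms Ck_on_SucD(2) unfolding test_functions_def smooth_on_def by blast

lemma test_functions_deriv:
  assumes "\<phi> \<in> test_functions S" "b \<in> Basis"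
  shows "(\<lambda>x. frechet_derivative \<phi> (at x) b) \<in> test_functions S"
proof (rule test_functionsI[OF test_functions_deriv_smooth[OF assms]])
  let ?K = "closure {x. \<phi> x \<noteq> 0}"
  show "compact ?K" "?K \<subseteq> S" using assms by (auto simp: test_functions_def)
  fix x assume x: "x \<notin> ?K"
  have "(\<phi> has_derivative (\<lambda>_. 0)) (at x)"
  proof (rule has_derivative_transform_within_open[where f = "\<lambda>_. 0" and s = "- ?K"])
    fix y assume "y \<in> - ?K" then show "0 = \<phi> y" using closure_subset[of "{x. \<phi> x \<noteq> 0}"] by auto
  qed (use x in auto)
  then show "frechet_derivative \<phi> (at x) b = 0"
    using frechet_derivative_at by metis
qed

text \<open>Truncating a test function smoothly yields a test function. This is what makes it possible to truncate in the
weak formulation without a chain rule for Sobolev functions.\<close>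

lemma test_functions_compose:
  assumes "\<phi> \<in> test_functions S" "smooth_on UNIV (G::real\<Rightarrow>real)" "G 0 = 0"
  shows "(\<lambda>x. G (\<phi> x)) \<in> test_functions S"
proof (rule test_functionsI)
  let ?K = "closure {x. \<phi> x \<noteq> 0}"
  show "compact ?K" "?K \<subseteq> S" using assms by (auto simp: test_functions_def)
  show "smooth_on UNIV (\<lambda>x. G (\<phi> x))"
    using assms Ck_on_compose_real unfolding test_functions_def smooth_on_def by blast
  fix x assume "x \<notin> ?K"
  then have "\<phi> x = 0" using closure_subset[of "{x. \<phi> x \<noteq> 0}"] by blast
  then show "G (\<phi> x) = 0" using assms(3) by simp
qed

lemma frechet_derivative_compose_real:
  assumes "\<phi> \<in> test_functions S" "(G has_field_derivative D) (at (\<phi> x))"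
  shows "frechet_derivative (\<lambda>x. G (\<phi> x)) (at x) b = D * frechet_derivative \<phi> (at x) b"
  using frechet_derivative_at[OF has_derivative_compose[OF test_functions_has_derivative[OF assms(1)]
        assms(2)[unfolded has_field_derivative_def]]] by metis

lemma test_functions_bounded_support:
  assumes "\<phi> \<in> test_functions S"
  obtains K C where "compact K" "\<And>x. x \<notin> K \<Longrightarrow> \<phi> x = 0" "\<And>x. \<bar>\<phi> x\<bar> \<le> C" "K \<subseteq> S" "C \<ge> 0"
proof -
  let ?K = "closure {x. \<phi> x \<noteq> 0}"
  have K: "compact ?K" "?K \<subseteq> S" using assms by (auto simp: test_functions_def)
  have z: "\<phi> x = 0" if "x \<notin> ?K" for x using that closure_subset[of "{x. \<phi> x \<noteq> 0}"] by auto
  have "compact (\<phi> ` ?K)"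
    using K test_functions_continuous[OF assms] by (intro compact_continuous_image) (auto intro: continuous_on_subset)
  then obtain C where C: "\<And>x. x \<in> ?K \<Longrightarrow> \<bar>\<phi> x\<bar> \<le> C"
    using compact_imp_bounded bounded_real by (metis image_eqI)
  show ?thesis
  proof (rule that[OF K(1) z])
    show "\<bar>\<phi> x\<bar> \<le> max C 0" for x using C[of x] z[of x] by (cases "x \<in> ?K") (simp_all add: le_max_iff_disj)
  qed (use K in auto)
qed

lemma lebesgue_measurable_continuous:
  "continuous_on UNIV (f :: 'a::euclidean_space \<Rightarrow> real) \<Longrightarrow> f \<in> borel_measurable lebesgue"
  by (intro measurable_completion) (simp add: borel_measurable_continuous_onI)

lemma integrable_continuous_compact_support:
  fixes f :: "'a::euclidean_space \<Rightarrow> real"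
  assumes "continuous_on UNIV f" "compact K" "\<And>x. x \<notin> K \<Longrightarrow> f x = 0"
  shows "integrable lebesgue f"
proof -
  have "continuous_on K f" using assms(1) by (rule continuous_on_subset) simp
  with assms(2) have "integrable lborel (\<lambda>x. indicator K x *\<^sub>R f x)"
    by (rule borel_integrable_compact)
  also have "(\<lambda>x. indicator K x *\<^sub>R f x) = f"
    using assms(3) by (fastforce simp: indicator_def)
  finally show ?thesis
    using assms(1) by (simp add: integrable_completion borel_measurable_continuous_onI)
qed

lemma square_integrable_test:
  fixes \<phi> :: "'a::euclidean_space \<Rightarrow> real"
  assumes "\<phi> \<in> test_functions S" shows "square_integrable \<phi>"
proof -
  obtain K C where K: "compact K" "\<And>x. x \<notin> K \<Longrightarrow> \<phi> x = 0"
    using test_functions_bounded_support[OF assms] by metis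
  note c = test_functions_continuous[OF assms]
  show ?thesis unfolding square_integrable_def
    using K c by (auto intro!: lebesgue_measurable_continuous integrable_continuous_compact_support[of _ K] continuous_intros)
qed

section \<open>The fundamental lemma of the calculus of variations\<close>

lemma flat_1_bounds: "0 \<le> flat 1 x" "flat 1 x \<le> 1"
  by (auto simp: flat_def)

lemma flat_1_scaled_tendsto:
  "(\<lambda>n. flat 1 (real (Suc n) * y)) \<longlonglongrightarrow> (if y > 0 then 1 else 0)"
proof (cases "y > 0")
  case True
  have "(\<lambda>n. exp (- (inverse (real (Suc n)) * inverse y))) \<longlonglongrightarrow> exp (- (0 * inverse y))"
    by (intro tendsto_intros LIMSEQ_inverse_real_of_nat)
  then show ?thesis using True by (simp add: flat_def not_le mult_le_0_iff)
next
  case False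
  then have "flat 1 (real (Suc n) * y) = 0" for n
    by (simp add: flat_def mult_nonneg_nonpos)
  then show ?thesis using False by simp
qed

text \<open>A product of one-dimensional flat functions, rescaled so that it converges to the indicator of the open box.\<close>

definition box_bump :: "'a::euclidean_space \<Rightarrow> 'a \<Rightarrow> nat \<Rightarrow> 'a \<Rightarrow> real" where
  "box_bump c d n x = (\<Prod>b\<in>Basis. flat 1 (real (Suc n) * (x \<bullet> b - c \<bullet> b)) * flat 1 (real (Suc n) * (d \<bullet> b - x \<bullet> b)))"

lemma box_bump_zero: "x \<notin> cbox c d \<Longrightarrow> box_bump c d n x = 0"
proof -
  assume "x \<notin> cbox c d"
  then obtain b where "b \<in> Basis" "x \<bullet> b < c \<bullet> b \<or> d \<bullet> b < x \<bullet> b"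
    by (auto simp: mem_box not_le)
  then show ?thesis
    unfolding box_bump_def
    by (intro prod_zero bexI[of _ b]) (auto simp: flat_def mult_le_0_iff)
qed

lemma box_bump_bounds: "0 \<le> box_bump c d n x" "box_bump c d n x \<le> 1"
  unfolding box_bump_def
  by (auto intro!: prod_nonneg prod_le_1 mult_nonneg_nonneg mult_le_one flat_1_bounds)

lemma box_bump_tendsto: "(\<lambda>n. box_bump c d n x) \<longlonglongrightarrow> indicator (box c d) x"
proof -
  have "(\<lambda>n. box_bump c d n x) \<longlonglongrightarrow> (\<Prod>b\<in>Basis. (if x \<bullet> b - c \<bullet> b > 0 then 1 else 0) * (if d \<bullet> b - x \<bullet> b > 0 then 1 else 0))"
    unfolding box_bump_def by (intro tendsto_prod tendsto_mult flat_1_scaled_tendsto)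
  also have "(\<Prod>b\<in>Basis. (if x \<bullet> b - c \<bullet> b > 0 then 1 else 0) * (if d \<bullet> b - x \<bullet> b > 0 then 1 else 0)) = (indicator (box c d) x :: real)"
  proof (cases "x \<in> box c d")
    case True
    then show ?thesis by (auto simp: mem_box intro!: prod.neutral)
  next
    case False
    then show ?thesis by (auto simp: mem_box intro!: prod_zero)
  qed
  finally show ?thesis .
qed

lemma box_bump_test:
  assumes "cbox c d \<subseteq> S" shows "box_bump c d n \<in> test_functions S"
proof (rule test_functionsI)
  have 1: "Ck_on k UNIV (\<lambda>x. real (Suc n) * (x \<bullet> b - c \<bullet> b))" for k and b :: 'a
    using Ck_on_add[OF Ck_on_inner Ck_on_const, of k "real (Suc n) *\<^sub>R b" "- real (Suc n) * (c \<bullet> b)"]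
    by (simp add: algebra_simps)
  have 2: "Ck_on k UNIV (\<lambda>x. real (Suc n) * (d \<bullet> b - x \<bullet> b))" for k and b :: 'a
    using Ck_on_add[OF Ck_on_inner Ck_on_const, of k "- real (Suc n) *\<^sub>R b" "real (Suc n) * (d \<bullet> b)"]
    by (simp add: algebra_simps)
  show "smooth_on UNIV (box_bump c d n)"
    unfolding smooth_on_def box_bump_def
    by (intro allI Ck_on_prod Ck_on_mult Ck_on_compose_real[OF smooth_on_flat 1] Ck_on_compose_real[OF smooth_on_flat 2])
qed (use assms box_bump_zero in auto)

lemma square_integrable_indicator:
  "A \<in> lmeasurable \<Longrightarrow> square_integrable (indicator A)"
  by (auto simp: square_integrable_def power2_eq_square lmeasurable_iff_integrable
      simp flip: indicator_inter_arith)

text \<open>The sets on which the integral of \<open>k\<close> vanishes form a Dynkin system, and the open boxes are an intersection-stable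
generator of the Borel sets. The vanishing of the total integral is what complements need.\<close>

lemma AE_lebesgue_zero_if_box_integrals_zero:
  fixes k :: "'a::euclidean_space \<Rightarrow> real"
  assumes k: "integrable lebesgue k" and 0: "\<And>a b. (LINT x|lebesgue. indicator (box a b) x * k x) = 0"
    and U: "(LINT x|lebesgue. k x) = 0"
  shows "AE x in lebesgue. k x = 0"
proof -
  have "k \<in> borel_measurable lebesgue" using k by auto
  then obtain k' where k': "k' \<in> borel_measurable lborel" "AE x in lborel. k x = k' x"
    using completion_ex_borel_measurable_real by blast
  have ae: "AE x in lebesgue. k x = k' x" using k'(2) by (rule AE_completion)
  have mk': "k' \<in> borel_measurable lebesgue" using k'(1) by (rule measurable_completion)
  have int: "integrable lborel k'"
  proof -
    have "integrable lebesgue k'"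
      using k by (rule integrable_cong_AE_imp) (use ae mk' in \<open>auto elim: eventually_mono\<close>)
    then show ?thesis using k'(1) by (simp add: integrable_completion)
  qed
  have eq: "(LINT x|lborel. indicator A x *\<^sub>R k' x) = (LINT x|lebesgue. indicator A x * k x)"
    if "A \<in> sets borel" for A :: "'a set"
  proof -
    have "A \<in> sets lebesgue" using that by (intro sets_completionI_sets) simp
    then have "indicator A \<in> borel_measurable lebesgue" by (rule borel_measurable_indicator)
    then have "(LINT x|lebesgue. indicator A x * k x) = (LINT x|lebesgue. indicator A x * k' x)"
      using k mk' ae
      by (intro integral_cong_AE borel_measurable_times) (auto elim: eventually_mono)
    also have "\<dots> = (LINT x|lborel. indicator A x *\<^sub>R k' x)"
      using that k'(1) by (subst integral_completion) auto
    finally show ?thesis by simp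
  qed
  have si: "integrable lborel (\<lambda>x. indicator A x *\<^sub>R k' x)" if "A \<in> sets borel" for A :: "'a set"
    using that int by (intro integrable_mult_indicator) auto
  have "AE x in lborel. k' x = 0"
  proof (rule sigma_finite_measure.density_zero[OF lborel.sigma_finite_measure_axioms int])
    fix A :: "'a set" assume "A \<in> sets lborel"
    then have A: "A \<in> sigma_sets UNIV (range (\<lambda>(a, b). box a b))"
      by (simp add: borel_eq_box)
    have "Int_stable (range (\<lambda>(a::'a, b). box a b))"
      by (auto simp: Int_stable_def box_Int_box intro!: image_eqI)
    moreover have "range (\<lambda>(a::'a, b). box a b) \<subseteq> Pow UNIV" by auto
    moreover note A
    ultimately show "set_lebesgue_integral lborel A k' = 0"
      unfolding set_lebesgue_integral_def
    proof (induction A rule: sigma_sets_induct_disjoint)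
      case (basic A)
      then show ?case using 0 eq by auto
    next
      case empty
      then show ?case by simp
    next
      case (compl A)
      then have A: "A \<in> sets borel" by (simp add: borel_eq_box)
      have "(LINT x|lborel. indicator (UNIV - A) x *\<^sub>R k' x) = (LINT x|lborel. k' x - indicator A x *\<^sub>R k' x)"
        by (intro Bochner_Integration.integral_cong) (auto simp: indicator_def)
      also have "\<dots> = (LINT x|lborel. k' x) - (LINT x|lborel. indicator A x *\<^sub>R k' x)"
        by (intro Bochner_Integration.integral_diff int si A)
      also have "(LINT x|lborel. k' x) = 0"
        using eq[of UNIV] U by simp
      finally show ?case using compl by simp
    next
      case (union A)
      have A: "A i \<in> sets borel" for i
        using union(2) by (auto simp: borel_eq_box)
      have "set_lebesgue_integral lborel (\<Union>i. A i) k' = (\<Sum>i. set_lebesgue_integral lborel (A i) k')"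
        using union A si[of "\<Union>i. A i"]
        by (intro lebesgue_integral_countable_add) (auto simp: set_integrable_def disjoint_family_on_def)
      then show ?case using union by (simp add: set_lebesgue_integral_def)
    qed
  qed
  then have "AE x in lebesgue. k' x = 0" by (rule AE_completion)
  with ae show ?thesis by eventually_elim simp
qed

text \<open>The bumps approximate the indicator of any open box whose closure lies in \<open>S\<close>, and countably many such boxes
cover \<open>S\<close>.\<close>

lemma fundamental_lemma_L2:
  fixes g :: "'a::euclidean_space \<Rightarrow> real"
  assumes S: "open S" and g: "square_integrable g"
    and 0: "\<And>\<phi>. \<phi> \<in> test_functions S \<Longrightarrow> (LINT x|lebesgue_on S. g x * \<phi> x) = 0"
  shows "AE x in lebesgue. x \<in> S \<longrightarrow> g x = 0"
proof -
  have box0: "(LINT x|lebesgue. g x * indicator (box c d) x) = 0" if "cbox c d \<subseteq> S" for c d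
  proof -
    have "(\<lambda>n. LINT x|lebesgue. g x * box_bump c d n x) \<longlonglongrightarrow> (LINT x|lebesgue. g x * indicator (box c d) x)"
    proof (rule integral_dominated_convergence[where w = "\<lambda>x. \<bar>g x * indicator (cbox c d) x\<bar>"])
      show "AE x in lebesgue. (\<lambda>n. g x * box_bump c d n x) \<longlonglongrightarrow> g x * indicator (box c d) x"
        by (intro AE_I2 tendsto_mult tendsto_const box_bump_tendsto)
      show "AE x in lebesgue. norm (g x * box_bump c d n x) \<le> \<bar>g x * indicator (cbox c d) x\<bar>" for n
        using box_bump_bounds[of c d n] box_bump_zero[of _ c d n]
        by (intro AE_I2) (auto simp: abs_mult indicator_def intro!: mult_left_le)
      show "integrable lebesgue (\<lambda>x. \<bar>g x * indicator (cbox c d) x\<bar>)"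
        by (intro integrable_abs square_integrable_mult g square_integrable_indicator) simp
      show "(\<lambda>x. g x * box_bump c d n x) \<in> borel_measurable lebesgue" for n
        using g lebesgue_measurable_continuous[OF test_functions_continuous[OF box_bump_test[OF that]], of n]
        by (auto simp: square_integrable_def)
      show "(\<lambda>x. g x * indicator (box c d) x) \<in> borel_measurable lebesgue"
        using g borel_measurable_indicator[of "box c d" lebesgue]
        by (intro borel_measurable_times) (auto simp: square_integrable_def fmeasurableD)
    qed
    moreover have "(LINT x|lebesgue. g x * box_bump c d n x) = 0" for n
    proof -
      have "(LINT x|lebesgue_on S. g x * box_bump c d n x) = (LINT x|lebesgue. indicator S x *\<^sub>R (g x * box_bump c d n x))"
        using S by (subst integral_restrict_space) auto
      also have "\<dots> = (LINT x|lebesgue. g x * box_bump c d n x)"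
        using test_functions_zero[OF box_bump_test[OF that]]
        by (intro Bochner_Integration.integral_cong) (auto simp: indicator_def)
      finally show ?thesis using 0[OF box_bump_test[OF that]] by simp
    qed
    ultimately show ?thesis by (simp add: LIMSEQ_const_iff)
  qed
  have box: "AE x in lebesgue. x \<in> cbox c d \<longrightarrow> g x = 0" if cd: "cbox c d \<subseteq> S" for c d
  proof -
    have "AE x in lebesgue. g x * indicator (box c d) x = 0"
    proof (rule AE_lebesgue_zero_if_box_integrals_zero)
      show "integrable lebesgue (\<lambda>x. g x * indicator (box c d) x)"
        by (intro square_integrable_mult g square_integrable_indicator) simp
      show "(LINT x|lebesgue. g x * indicator (box c d) x) = 0" using box0 that .
      fix a b :: 'a
      obtain a' b' where ab: "box a b \<inter> box c d = box a' b'" using box_Int_box[of a b c d] by blast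
      have "(LINT x|lebesgue. indicator (box a b) x * (g x * indicator (box c d) x))
          = (LINT x|lebesgue. g x * indicator (box a' b') x)"
        unfolding ab[symmetric] by (intro Bochner_Integration.integral_cong) (auto simp: indicator_def)
      also have "\<dots> = 0"
      proof (cases "box a' b' = {}")
        case False
        \<comment> \<open>A nonempty open box is dense in the closed one, so the latter lies in \<open>S\<close> as well.\<close>
        then have "cbox a' b' = closure (box a' b')" by simp
        also have "\<dots> \<subseteq> cbox c d"
          using ab box_subset_cbox by (intro closure_minimal) (auto simp: closed_cbox)
        finally show ?thesis using cd by (intro box0) auto
      qed simp
      finally show "(LINT x|lebesgue. indicator (box a b) x * (g x * indicator (box c d) x)) = 0" .
    qed
    moreover have "AE x in lebesgue. x \<notin> cbox c d - box c d"
      using negligible_frontier_interval[of c d] unfolding negligible_iff_null_sets by (rule AE_not_in)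
    ultimately show ?thesis by eventually_elim auto
  qed
  obtain D where D: "countable D" "D \<subseteq> Pow S" "\<And>X. X \<in> D \<Longrightarrow> \<exists>a b. X = cbox a b" "\<Union>D = S"
    using open_countable_Union_open_cbox[OF S] by metis
  have "AE x in lebesgue. \<forall>X\<in>D. x \<in> X \<longrightarrow> g x = 0"
  proof (subst AE_ball_countable[OF D(1)], rule ballI)
    fix X assume X: "X \<in> D"
    then obtain a b where ab: "X = cbox a b" using D(3) by blast
    have "X \<subseteq> S" using X D(2) by blast
    then show "AE x in lebesgue. x \<in> X \<longrightarrow> g x = 0" unfolding ab by (rule box)
  qed
  then show ?thesis using D(4) by (auto elim!: eventually_mono)
qed

section \<open>Representatives of square-integrable classes\<close>

lemma L2_eq_iff: "u = v \<longleftrightarrow> (AE x in lebesgue. L2_rep u x = L2_rep v x)"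
  using Quotient3_rel_rep[OF Quotient3_L2, of u v] square_integrable_L2_rep
  by (auto simp: ae_equal_def)

lemma L2_rep_measurable: "L2_rep u \<in> borel_measurable lebesgue"
  using square_integrable_L2_rep square_integrable_measurable by blast

lemma L2_class_rep: "L2_class (L2_rep u) = u"
  by (rule Quotient3_abs_rep[OF Quotient3_L2])

lemma L2_class_eq:
  assumes "square_integrable f" "AE x in lebesgue. L2_rep u x = f x"
  shows "L2_class f = u"
  using L2_rep_class[OF assms(1)] assms(2) unfolding L2_eq_iff by eventually_elim simp

lemma L2_rep_add: "AE x in lebesgue. L2_rep (u + v) x = L2_rep u x + L2_rep v x"
proof -
  have "u + v = L2_class (\<lambda>x. L2_rep u x + L2_rep v x)"
    using plus_L2.abs_eq[OF L2_rep_ae_equal L2_rep_ae_equal, of u v] by (simp add: L2_class_rep)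
  then show ?thesis
    using L2_rep_class[OF square_integrable_add[OF square_integrable_L2_rep square_integrable_L2_rep], of u v]
    by simp
qed

lemma L2_rep_scaleR: "AE x in lebesgue. L2_rep (c *\<^sub>R u) x = c * L2_rep u x"
proof -
  have "c *\<^sub>R u = L2_class (\<lambda>x. c * L2_rep u x)"
    using scaleR_L2.abs_eq[OF L2_rep_ae_equal, of c u] by (simp add: L2_class_rep)
  then show ?thesis
    using L2_rep_class[OF square_integrable_scale[OF square_integrable_L2_rep], of c u] by simp
qed

lemma L2_rep_diff: "AE x in lebesgue. L2_rep (u - v) x = L2_rep u x - L2_rep v x"
  using L2_rep_add[of u "(-1) *\<^sub>R v"] L2_rep_scaleR[of "-1" v]
  by eventually_elim simp

lemma L2_rep_zero: "AE x in lebesgue. L2_rep 0 x = 0"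
  using L2_rep_class[OF square_integrable_0] by (simp add: zero_L2_def)

lemma inner_L2_eq: "inner u v = (LINT x|lebesgue. L2_rep u x * L2_rep v x)"
  using inner_L2.abs_eq[OF L2_rep_ae_equal L2_rep_ae_equal, of u v] by (simp add: L2_class_rep)

lemma norm_L2_square: "(norm u)\<^sup>2 = (LINT x|lebesgue. (L2_rep u x)\<^sup>2)" for u :: "'a::euclidean_space L2"
  unfolding power2_norm_eq_inner inner_L2_eq by (simp add: power2_eq_square)

lemma inner_L2_class:
  assumes "square_integrable f"
  shows "inner u (L2_class f) = (LINT x|lebesgue. L2_rep u x * f x)"
  unfolding inner_L2_eq
  using L2_rep_measurable square_integrable_measurable[OF assms] L2_rep_class[OF assms]
  by (intro integral_cong_AE borel_measurable_times) auto

lemma L2_on_diff: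
  assumes "u \<in> L2_on S" "v \<in> L2_on S" shows "u - v \<in> L2_on S"
  using assms L2_rep_diff[of u v] unfolding L2_on_def mem_Collect_eq
  by eventually_elim simp

lemma L2_class_in_L2_on:
  assumes "square_integrable f" "\<And>x. x \<notin> S \<Longrightarrow> f x = 0" shows "L2_class f \<in> L2_on S"
  unfolding L2_on_def mem_Collect_eq
  using L2_rep_class[OF assms(1)] by eventually_elim (simp add: assms(2))

lemma lebesgue_on_integral_supported:
  fixes f :: "'a::euclidean_space \<Rightarrow> real"
  assumes "S \<in> sets lebesgue" "\<And>x. x \<notin> S \<Longrightarrow> f x = 0"
  shows "(LINT x|lebesgue_on S. f x) = (LINT x|lebesgue. f x)"
proof -
  have "(LINT x|lebesgue_on S. f x) = (LINT x|lebesgue. indicator S x *\<^sub>R f x)"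
    using assms by (subst integral_restrict_space) auto
  also have "\<dots> = (LINT x|lebesgue. f x)"
    using assms by (intro Bochner_Integration.integral_cong) (auto simp: indicator_def)
  finally show ?thesis .
qed

lemma inner_test_eq:
  assumes "open S" "\<phi> \<in> test_functions S"
  shows "(LINT x|lebesgue_on S. L2_rep u x * \<phi> x) = inner u (L2_class \<phi>)"
  using assms by (subst lebesgue_on_integral_supported)
    (auto simp: test_functions_zero inner_L2_class square_integrable_test)

section \<open>Weak derivatives\<close>

lemma has_weak_deriv_iff:
  assumes "open S" "b \<in> Basis"
  shows "has_weak_deriv S b u g \<longleftrightarrow> g \<in> L2_on S \<and>
    (\<forall>\<phi>\<in>test_functions S. inner u (L2_class (\<lambda>x. frechet_derivative \<phi> (at x) b)) = - inner g (L2_class \<phi>))"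
  unfolding has_weak_deriv_def
  using assms by (simp add: inner_test_eq inner_test_eq[OF assms(1) test_functions_deriv])

lemma L2_on_orthogonal_test_zero:
  assumes "open S" "g \<in> L2_on S" "\<And>\<phi>. \<phi> \<in> test_functions S \<Longrightarrow> inner g (L2_class \<phi>) = 0"
  shows "g = 0"
proof -
  have "AE x in lebesgue. x \<in> S \<longrightarrow> L2_rep g x = 0"
    using assms(1,3)
    by (intro fundamental_lemma_L2 square_integrable_L2_rep) (auto simp: inner_test_eq)
  moreover have "AE x in lebesgue. x \<notin> S \<longrightarrow> L2_rep g x = 0"
    using assms(2) by (simp add: L2_on_def)
  ultimately show ?thesis
    unfolding L2_eq_iff using L2_rep_zero by eventually_elim auto
qed

lemma has_weak_deriv_diff:
  assumes "open S" "b \<in> Basis" "has_weak_deriv S b u g" "has_weak_deriv S b v k"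
  shows "has_weak_deriv S b (u - v) (g - k)"
  using assms by (auto simp: has_weak_deriv_iff L2_on_diff inner_diff_left)

text \<open>Only uniqueness makes \<^const>\<open>weak_deriv\<close>, a definite description, accessible at all.\<close>

lemma has_weak_deriv_unique:
  assumes "open S" "b \<in> Basis" "has_weak_deriv S b u g" "has_weak_deriv S b u k"
  shows "g = k"
proof -
  have "g - k = 0"
    using assms by (intro L2_on_orthogonal_test_zero[of S])
      (auto simp: has_weak_deriv_iff L2_on_diff inner_diff_left)
  then show ?thesis by simp
qed

lemma weak_deriv_eqI:
  assumes "open S" "b \<in> Basis" "has_weak_deriv S b u g" shows "weak_deriv S b u = g"
  unfolding weak_deriv_def using assms has_weak_deriv_unique by blast

lemma H1_has_weak_deriv:
  assumes "open S" "b \<in> Basis" "u \<in> H1 S" shows "has_weak_deriv S b u (weak_deriv S b u)"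
  using assms weak_deriv_eqI unfolding H1_def by fastforce

lemma integral_translate:
  assumes "continuous_on UNIV (\<zeta> :: 'a::euclidean_space \<Rightarrow> real)"
  shows "(LINT x|lebesgue. \<zeta> (x + v)) = (LINT x|lebesgue. \<zeta> x)"
proof -
  have m: "\<zeta> \<in> borel_measurable borel" using assms by (rule borel_measurable_continuous_onI)
  have "continuous_on UNIV (\<lambda>x. \<zeta> (x + v))"
    by (intro continuous_on_compose2[OF assms] continuous_intros) auto
  then have "(\<lambda>x. \<zeta> (x + v)) \<in> borel_measurable borel" by (rule borel_measurable_continuous_onI)
  then have "(LINT x|lebesgue. \<zeta> (x + v)) = (LINT x|lborel. \<zeta> (v + x))"
    by (simp add: integral_completion add.commute)
  also have "\<dots> = (LINT x|distr lborel borel ((+) v). \<zeta> x)"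
    using m by (subst integral_distr) auto
  also have "\<dots> = (LINT x|lebesgue. \<zeta> x)"
    using m by (simp add: lborel_distr_plus integral_completion)
  finally show ?thesis .
qed

text \<open>The derivative is the limit of difference quotients, whose integrals vanish by translation invariance. Near
the support the mean value theorem provides the majorant.\<close>

lemma integral_deriv_test_zero:
  fixes \<zeta> :: "'a::euclidean_space \<Rightarrow> real"
  assumes \<zeta>: "\<zeta> \<in> test_functions S" and b: "b \<in> Basis"
  shows "(LINT x|lebesgue. frechet_derivative \<zeta> (at x) b) = 0"
proof -
  define D where "D x = frechet_derivative \<zeta> (at x) b" for x
  have Dt: "D \<in> test_functions S" unfolding D_def using test_functions_deriv[OF assms] .
  obtain K where K: "compact K" "\<And>x. x \<notin> K \<Longrightarrow> \<zeta> x = 0"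
    using test_functions_bounded_support[OF \<zeta>] by metis
  obtain C where C: "\<And>x. \<bar>D x\<bar> \<le> C" "C \<ge> 0"
    using test_functions_bounded_support[OF Dt] by metis
  obtain R where R: "\<And>x. x \<in> K \<Longrightarrow> norm x \<le> R"
    using compact_imp_bounded[OF K(1)] bounded_iff by metis
  note cont = test_functions_continuous[OF \<zeta>]
  have der: "((\<lambda>s. \<zeta> (x + s *\<^sub>R b)) has_real_derivative D (x + s *\<^sub>R b)) (at s)" for x s
  proof -
    have "((\<lambda>s. x + s *\<^sub>R b) has_derivative (\<lambda>s. s *\<^sub>R b)) (at s)"
      by (auto intro!: derivative_eq_intros)
    from has_derivative_compose[OF this test_functions_has_derivative[OF \<zeta>]]
    have "((\<lambda>s. \<zeta> (x + s *\<^sub>R b)) has_derivative (\<lambda>t. frechet_derivative \<zeta> (at (x + s *\<^sub>R b)) (t *\<^sub>R b))) (at s)" .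
    moreover have "frechet_derivative \<zeta> (at (x + s *\<^sub>R b)) (t *\<^sub>R b) = D (x + s *\<^sub>R b) * t" for t
      using linear_scale[OF bounded_linear.linear[OF has_derivative_bounded_linear[OF test_functions_has_derivative[OF \<zeta>]]]]
      by (simp add: D_def)
    ultimately show ?thesis by (simp add: has_field_derivative_def)
  qed
  define h where "h n = inverse (real (Suc n))" for n
  have h: "h n > 0" "h n \<le> 1" for n by (auto simp: h_def inverse_le_1_iff)
  define q where "q n x = (\<zeta> (x + h n *\<^sub>R b) - \<zeta> x) / h n" for n x
  have cq: "continuous_on UNIV (q n)" for n
    unfolding q_def using h(1)[of n]
    by (intro continuous_intros continuous_on_compose2[OF cont]) auto
  have int: "integrable lebesgue (\<lambda>x. \<zeta> (x + v))" for v
  proof (rule integrable_continuous_compact_support)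
    show "continuous_on UNIV (\<lambda>x. \<zeta> (x + v))"
      by (intro continuous_intros continuous_on_compose2[OF cont]) auto
    show "compact ((\<lambda>x. - v + x) ` K)" using K(1) by (rule compact_translation)
    show "\<zeta> (x + v) = 0" if "x \<notin> (\<lambda>x. - v + x) ` K" for x
    proof (rule K(2))
      show "x + v \<notin> K" using that image_eqI[of x "\<lambda>x. - v + x" "x + v" K] by auto
    qed
  qed
  have "(\<lambda>n. LINT x|lebesgue. q n x) \<longlonglongrightarrow> (LINT x|lebesgue. D x)"
  proof (rule integral_dominated_convergence[where w = "\<lambda>x. C * indicator (cball 0 (R + 1)) x"])
    show "D \<in> borel_measurable lebesgue"
      by (rule lebesgue_measurable_continuous[OF test_functions_continuous[OF Dt]])
    show "q n \<in> borel_measurable lebesgue" for n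
      by (rule lebesgue_measurable_continuous[OF cq])
    show "integrable lebesgue (\<lambda>x. C * indicator (cball 0 (R + 1)) x)"
      using lmeasurable_iff_integrable lmeasurable_cball by (intro integrable_mult_right) blast
    show "AE x in lebesgue. (\<lambda>n. q n x) \<longlonglongrightarrow> D x"
    proof (rule AE_I2)
      fix x
      have "((\<lambda>t. (\<zeta> (x + t *\<^sub>R b) - \<zeta> x) / t) \<longlongrightarrow> D x) (at 0)"
        using der[of x 0] by (simp add: DERIV_def)
      moreover have "filterlim h (at 0) sequentially"
        unfolding filterlim_at h_def using LIMSEQ_inverse_real_of_nat by auto
      ultimately show "(\<lambda>n. q n x) \<longlonglongrightarrow> D x"
        unfolding q_def by (rule filterlim_compose)
    qed
    show "AE x in lebesgue. norm (q n x) \<le> C * indicator (cball 0 (R + 1)) x" for n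
    proof (rule AE_I2)
      fix x
      show "norm (q n x) \<le> C * indicator (cball 0 (R + 1)) x"
      proof (cases "norm x \<le> R + 1")
        case True
        obtain z where "\<zeta> (x + h n *\<^sub>R b) - \<zeta> (x + 0 *\<^sub>R b) = (h n - 0) * D (x + z *\<^sub>R b)"
          using MVT2[of 0 "h n" "\<lambda>s. \<zeta> (x + s *\<^sub>R b)" "\<lambda>s. D (x + s *\<^sub>R b)"] der h(1)[of n] by blast
        then have "q n x = D (x + z *\<^sub>R b)" using h(1)[of n] by (simp add: q_def)
        then show ?thesis using C True by (simp add: dist_norm)
      next
        case False
        then have 1: "x \<notin> K" using R[of x] by auto
        have "norm x \<le> norm (x + h n *\<^sub>R b) + norm (h n *\<^sub>R b)"
          using norm_triangle_ineq4[of "x + h n *\<^sub>R b" "h n *\<^sub>R b"] by simp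
        then have "norm x \<le> norm (x + h n *\<^sub>R b) + 1" using h[of n] b by simp
        then have "x + h n *\<^sub>R b \<notin> K" using R[of "x + h n *\<^sub>R b"] False by auto
        with 1 show ?thesis using K(2) False by (simp add: q_def dist_norm)
      qed
    qed
  qed
  moreover have "(LINT x|lebesgue. q n x) = 0" for n
    unfolding q_def using int[of "h n *\<^sub>R b"] int[of 0] integral_translate[OF cont, of "h n *\<^sub>R b"]
    by (simp add: Bochner_Integration.integral_diff)
  ultimately show ?thesis by (simp add: LIMSEQ_const_iff D_def)
qed

lemma test_functions_mult:
  assumes "\<phi> \<in> test_functions S" "\<psi> \<in> test_functions S"
  shows "(\<lambda>x. \<phi> x * \<psi> x) \<in> test_functions S"
proof -
  obtain K where "compact K" "\<And>x. x \<notin> K \<Longrightarrow> \<phi> x = 0" "K \<subseteq> S"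
    using test_functions_bounded_support[OF assms(1)] by metis
  then show ?thesis
    using Ck_on_mult[OF assms[THEN test_functions_smooth, unfolded smooth_on_def, rule_format]]
    by (intro test_functionsI[of _ K]) (simp_all add: smooth_on_def)
qed

text \<open>Integration by parts: the derivative of the product of \<open>\<phi>\<close> and a test function \<open>\<psi>\<close> integrates to \<open>0\<close>.\<close>

lemma has_weak_deriv_test:
  assumes "open S" "b \<in> Basis" "\<phi> \<in> test_functions S"
  shows "has_weak_deriv S b (L2_class \<phi>) (L2_class (\<lambda>x. frechet_derivative \<phi> (at x) b))"
  unfolding has_weak_deriv_iff[OF assms(1,2)]
proof (intro conjI ballI)
  note d\<phi> = test_functions_deriv[OF assms(3,2)]
  show "L2_class (\<lambda>x. frechet_derivative \<phi> (at x) b) \<in> L2_on S"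
    using d\<phi> by (intro L2_class_in_L2_on square_integrable_test test_functions_zero)
  fix \<psi> assume \<psi>: "\<psi> \<in> test_functions S"
  note d\<psi> = test_functions_deriv[OF \<psi> assms(2)]
  note sq = square_integrable_test[OF assms(3)] square_integrable_test[OF \<psi>]
    square_integrable_test[OF d\<phi>] square_integrable_test[OF d\<psi>]
  have "frechet_derivative (\<lambda>x. \<phi> x * \<psi> x) (at x) b
      = \<phi> x * frechet_derivative \<psi> (at x) b + frechet_derivative \<phi> (at x) b * \<psi> x" for x
    using frechet_derivative_at[OF has_derivative_mult[OF test_functions_has_derivative[OF assms(3)]
        test_functions_has_derivative[OF \<psi>]]] by metis
  then have "(LINT x|lebesgue. \<phi> x * frechet_derivative \<psi> (at x) b + frechet_derivative \<phi> (at x) b * \<psi> x) = 0"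
    using integral_deriv_test_zero[OF test_functions_mult[OF assms(3) \<psi>] assms(2)] by simp
  then have "(LINT x|lebesgue. \<phi> x * frechet_derivative \<psi> (at x) b)
      = - (LINT x|lebesgue. frechet_derivative \<phi> (at x) b * \<psi> x)"
    by (subst (asm) Bochner_Integration.integral_add) (auto intro: square_integrable_mult sq)
  moreover have "inner (L2_class f) (L2_class g) = (LINT x|lebesgue. f x * g x)"
    if "square_integrable f" "square_integrable g" for f g :: "'a \<Rightarrow> real"
    using that by (intro inner_L2.abs_eq) (simp_all add: ae_equal_def)
  ultimately show "inner (L2_class \<phi>) (L2_class (\<lambda>x. frechet_derivative \<psi> (at x) b))
      = - inner (L2_class (\<lambda>x. frechet_derivative \<phi> (at x) b)) (L2_class \<psi>)"
    using sq by simp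
qed

lemma test_in_H10:
  assumes "open S" "\<phi> \<in> test_functions S"
  shows "L2_class \<phi> \<in> H10 S"
proof -
  have "L2_class \<phi> \<in> L2_on S"
    using assms by (intro L2_class_in_L2_on square_integrable_test test_functions_zero)
  then have "L2_class \<phi> \<in> H1 S"
    unfolding H1_def using has_weak_deriv_test[OF assms(1) _ assms(2)] by blast
  moreover have "weak_deriv S b 0 = 0" if "b \<in> Basis" for b
    using assms(1) that L2_class_in_L2_on[OF square_integrable_0, of S]
    by (intro weak_deriv_eqI) (auto simp: has_weak_deriv_iff zero_L2_def[symmetric])
  then have "H1_norm S (L2_class \<phi> - L2_class \<phi>) = 0"
    by (simp add: H1_norm_def grad_inner_def)
  ultimately show ?thesis using assms(2) unfolding H10_def mem_Collect_eq by metis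
qed

section \<open>Smooth steps and scalar distributional equations\<close>

lemma flat_1_mono: "x \<le> y \<Longrightarrow> flat 1 x \<le> flat 1 y"
  by (auto simp: flat_def le_imp_inverse_le)

text \<open>Since \<open>e flat(1 - x)\<close> is at least \<open>1\<close> for \<open>x \<le> 0\<close> and vanishes for \<open>x \<ge> 1\<close>, a second application of the flat
function gives a smooth transition from \<open>0\<close> to \<open>1\<close> without normalising integrals.\<close>

definition smooth_step :: "real \<Rightarrow> real" where
  "smooth_step x = exp 1 * flat 1 (1 - exp 1 * flat 1 (1 - x))"

lemma smooth_step_0: assumes "x \<le> 0" shows "smooth_step x = 0"
proof -
  have "exp (- 1) \<le> flat 1 (1 - x)" using flat_1_mono[of 1 "1 - x"] assms by (simp add: flat_def)
  then have "exp 1 * exp (- 1) \<le> exp 1 * flat 1 (1 - x)" by (intro mult_left_mono) auto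
  then have "1 - exp 1 * flat 1 (1 - x) \<le> 0" by (simp flip: exp_add)
  then show ?thesis by (simp add: smooth_step_def flat_def)
qed

lemma smooth_step_1: assumes "x \<ge> 1" shows "smooth_step x = 1"
proof -
  have "flat 1 (1 - x) = 0" using assms by (simp add: flat_def)
  then show ?thesis by (simp add: smooth_step_def flat_def flip: exp_add)
qed

lemma smooth_step_mono: "x \<le> y \<Longrightarrow> smooth_step x \<le> smooth_step y"
  unfolding smooth_step_def by (intro mult_left_mono flat_1_mono diff_left_mono) auto

lemma smooth_step_bounds: "0 \<le> smooth_step x" "smooth_step x \<le> 1"
proof -
  show "0 \<le> smooth_step x" by (simp add: smooth_step_def flat_1_bounds)
  show "smooth_step x \<le> 1" using smooth_step_mono[of x "max x 1"] by (simp add: smooth_step_1)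
qed

lemma Ck_on_affine_real: "Ck_on k UNIV (\<lambda>x::real. c * x + d)"
  using Ck_on_add[OF Ck_on_inner Ck_on_const, of k c d] by (simp add: mult.commute)

lemma smooth_on_affine_compose:
  assumes "smooth_on UNIV (G::real\<Rightarrow>real)" shows "smooth_on UNIV (\<lambda>x. G (c * x + d))"
  using Ck_on_compose_real[OF assms Ck_on_affine_real] by (simp add: smooth_on_def)

lemma smooth_on_cmult: "smooth_on UNIV G \<Longrightarrow> smooth_on UNIV (\<lambda>x. c * G x)"
  unfolding smooth_on_def by (intro allI Ck_on_mult[OF Ck_on_const]) simp

lemma smooth_on_add: "smooth_on UNIV F \<Longrightarrow> smooth_on UNIV G \<Longrightarrow> smooth_on UNIV (\<lambda>x. F x + G x)"
  unfolding smooth_on_def by (intro allI Ck_on_add) simp_all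

lemma smooth_on_const: "smooth_on UNIV (\<lambda>x. c)"
  unfolding smooth_on_def by (intro allI Ck_on_const)

lemma smooth_on_smooth_step: "smooth_on UNIV smooth_step"
proof -
  have "smooth_on UNIV (\<lambda>x. flat 1 ((-1) * x + 1))"
    by (rule smooth_on_affine_compose[OF smooth_on_flat])
  then have "smooth_on UNIV (\<lambda>x. (- exp 1) * flat 1 (1 - x))"
    by (intro smooth_on_cmult) simp
  then have "smooth_on UNIV (\<lambda>x. 1 + (- exp 1) * flat 1 (1 - x))"
    by (rule smooth_on_add[OF smooth_on_const])
  then have "smooth_on UNIV (\<lambda>x. flat 1 (1 + (- exp 1) * flat 1 (1 - x)))"
    unfolding smooth_on_def
    by (intro allI Ck_on_compose_real[OF smooth_on_flat]) blast
  then have "smooth_on UNIV (\<lambda>x. exp 1 * flat 1 (1 + (- exp 1) * flat 1 (1 - x)))"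
    by (rule smooth_on_cmult)
  then show ?thesis by (simp add: smooth_step_def[abs_def])
qed

lemma smooth_on_continuous: "smooth_on UNIV f \<Longrightarrow> continuous_on UNIV f"
  unfolding smooth_on_def using Ck_on.simps(1) by blast

lemma deriv_nonneg_of_mono:
  assumes "\<And>x y. x \<le> y \<Longrightarrow> f x \<le> f y" "(f has_real_derivative D) (at x)"
  shows "D \<ge> 0"
proof (rule ccontr)
  assume "\<not> D \<ge> 0"
  then obtain d where "d > 0" "\<forall>h>0. h < d \<longrightarrow> f (x + h) < f x"
    using DERIV_neg_dec_right[OF assms(2)] by auto
  then have "f (x + d / 2) < f x" by simp
  with assms(1)[of x "x + d / 2"] \<open>d > 0\<close> show False by simp
qed

lemma DERIV_zero_of_locally_const:
  assumes "open A" "x \<in> A" "\<And>y. y \<in> A \<Longrightarrow> f y = c" "(f has_real_derivative D) (at x)"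
  shows "D = 0"
proof -
  have "((\<lambda>_. c) has_real_derivative 0) (at x)" by simp
  then have "(f has_real_derivative 0) (at x)"
    by (rule has_field_derivative_transform_within_open[OF _ assms(1,2)]) (simp add: assms(3))
  then show ?thesis using assms(4) DERIV_unique by blast
qed

text \<open>\<open>D\<close> is a probability density concentrated on \<open>[r, r + h]\<close>, so integrating \<open>w\<close> against it reproduces \<open>w(r)\<close> up
to the oscillation of \<open>w\<close> on that interval.\<close>

lemma integral_against_step_derivative:
  assumes D: "\<And>x. (\<sigma> has_real_derivative D x) (at x)" and cont: "continuous_on UNIV D"
    and nonneg: "\<And>x. 0 \<le> D x" and zero: "\<And>x. x \<notin> {r..r+h} \<Longrightarrow> D x = 0"
    and 1: "\<sigma> (r + h) - \<sigma> r = 1" and h: "h > 0" and r: "r > 0"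
    and w: "continuous_on {r..r+h} w" and \<epsilon>: "\<And>x. x \<in> {r..r+h} \<Longrightarrow> \<bar>w x - w r\<bar> \<le> \<epsilon>"
  shows "\<bar>(LINT x|lebesgue_on {0<..}. w x * D x) - w r\<bar> \<le> \<epsilon>"
    and "integrable (lebesgue_on {0<..}) (\<lambda>x. w x * D x)"
proof -
  let ?I = "indicator {r..r+h} :: real \<Rightarrow> real"
  have cD: "continuous_on {r..r+h} D" using cont by (rule continuous_on_subset) simp
  have int: "integrable lborel (\<lambda>x. ?I x *\<^sub>R (v x * D x))" if "continuous_on {r..r+h} v" for v
    by (intro borel_integrable_compact continuous_intros that cD) simp
  have intD: "integrable lborel (\<lambda>x. ?I x *\<^sub>R D x)"
    by (intro borel_integrable_compact cD) simp
  have "(LINT x|lborel. ?I x *\<^sub>R D x) = \<sigma> (r + h) - \<sigma> r"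
  proof (rule integral_FTC_Icc)
    show "(\<sigma> has_vector_derivative D x) (at x within {r..r+h})" for x
      using D by (meson has_real_derivative_iff_has_vector_derivative has_vector_derivative_at_within)
  qed (use h cD in auto)
  then have D1: "(LINT x|lborel. ?I x *\<^sub>R D x) = 1" using 1 by simp
  have wD: "w x * D x = ?I x *\<^sub>R (w x * D x)" for x
    using zero[of x] by (auto simp: indicator_def)
  have le: "integrable lebesgue (\<lambda>x. w x * D x)"
    by (subst wD) (use int[OF w] in \<open>simp add: integrable_completion\<close>)
  have z: "w x * D x = 0" if "x \<notin> {0<..}" for x
    using zero[of x] that r by auto
  have "(LINT x|lebesgue_on {0<..}. w x * D x) = (LINT x|lebesgue. w x * D x)"
    by (intro lebesgue_on_integral_supported z) auto
  also have "\<dots> = (LINT x|lborel. ?I x *\<^sub>R (w x * D x))"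
    by (subst wD) (use int[OF w] in \<open>simp add: integral_completion\<close>)
  finally have eq: "(LINT x|lebesgue_on {0<..}. w x * D x) = (LINT x|lborel. ?I x *\<^sub>R (w x * D x))" .
  have "(LINT x|lborel. ?I x *\<^sub>R (w x * D x)) - w r
      = (LINT x|lborel. ?I x *\<^sub>R (w x * D x)) - (LINT x|lborel. w r * (?I x *\<^sub>R D x))"
    by (simp only: Bochner_Integration.integral_mult_right_zero D1)
  also have "\<dots> = (LINT x|lborel. ?I x *\<^sub>R (w x * D x) - w r * (?I x *\<^sub>R D x))"
    by (rule Bochner_Integration.integral_diff[symmetric, OF int[OF w] integrable_mult_right[OF intD]])
  finally have "\<bar>(LINT x|lborel. ?I x *\<^sub>R (w x * D x)) - w r\<bar>
      = norm (LINT x|lborel. ?I x *\<^sub>R (w x * D x) - w r * (?I x *\<^sub>R D x))" by simp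
  also have "\<dots> \<le> (LINT x|lborel. \<epsilon> * (?I x *\<^sub>R D x))"
  proof (rule Bochner_Integration.integral_norm_bound_integral)
    show "integrable lborel (\<lambda>x. ?I x *\<^sub>R (w x * D x) - w r * (?I x *\<^sub>R D x))"
      by (intro Bochner_Integration.integrable_diff int[OF w] integrable_mult_right[OF intD])
    show "integrable lborel (\<lambda>x. \<epsilon> * (?I x *\<^sub>R D x))" by (rule integrable_mult_right[OF intD])
    fix x
    show "norm (?I x *\<^sub>R (w x * D x) - w r * (?I x *\<^sub>R D x)) \<le> \<epsilon> * (?I x *\<^sub>R D x)"
    proof (cases "x \<in> {r..r+h}")
      case True
      have "\<bar>(w x - w r) * D x\<bar> \<le> \<epsilon> * D x"
        unfolding abs_mult using \<epsilon>[OF True] nonneg[of x] by (simp add: mult_right_mono)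
      then show ?thesis using True by (simp add: algebra_simps)
    qed simp
  qed
  also have "\<dots> = \<epsilon>" by (simp only: Bochner_Integration.integral_mult_right_zero D1)
  finally show "\<bar>(LINT x|lebesgue_on {0<..}. w x * D x) - w r\<bar> \<le> \<epsilon>" using eq by simp
  show "integrable (lebesgue_on {0<..}) (\<lambda>x. w x * D x)"
    using integrable_mult_indicator[OF _ le, of "{0<..}"] by (subst integrable_restrict_space) auto
qed

lemma integral_step_derivative_tendsto:
  assumes w: "continuous_on {0<..} w" and r: "r > 0"
  defines "D \<equiv> \<lambda>n x. real (Suc n) * deriv smooth_step (real (Suc n) * (x - r))"
  shows "(\<lambda>n. LINT x|lebesgue_on {0<..}. w x * D n x) \<longlonglongrightarrow> w r"
    and "integrable (lebesgue_on {0<..}) (\<lambda>x. w x * D n x)"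
    and "((\<lambda>x. smooth_step (real (Suc n) * (x - r))) has_real_derivative D n x) (at x)"
proof -
  define \<sigma> where "\<sigma> n x = smooth_step (real (Suc n) * (x - r))" for n x
  define h where "h n = inverse (real (Suc n))" for n
  have h: "h n > 0" "h n \<le> 1" "real (Suc n) * h n = 1" for n
    by (auto simp: h_def inverse_le_1_iff simp del: of_nat_Suc)
  note st = smooth_on_real_deriv[OF smooth_on_smooth_step]
  have der: "(\<sigma> n has_real_derivative D n x) (at x)" for n x
  proof -
    have "((\<lambda>x. real (Suc n) * (x - r)) has_real_derivative real (Suc n)) (at x)"
      by (auto intro!: derivative_eq_intros simp del: of_nat_Suc)
    from DERIV_chain2[OF st(1) this] show ?thesis
      by (simp add: \<sigma>_def[abs_def] D_def mult.commute del: of_nat_Suc)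
  qed
  then show "((\<lambda>x. smooth_step (real (Suc n) * (x - r))) has_real_derivative D n x) (at x)"
    by (simp add: \<sigma>_def[abs_def] del: of_nat_Suc)
  have cont: "continuous_on UNIV (D n)" for n
    unfolding D_def
    by (intro continuous_intros continuous_on_compose2[OF smooth_on_continuous[OF st(2)]]) auto
  have nonneg: "0 \<le> D n x" for n x
  proof (rule deriv_nonneg_of_mono[OF _ der])
    show "\<sigma> n x \<le> \<sigma> n y" if "x \<le> y" for x y
      unfolding \<sigma>_def using that by (intro smooth_step_mono mult_left_mono) auto
  qed
  have zero: "D n x = 0" if "x \<notin> {r..r + h n}" for n x
  proof (cases "x < r")
    case True
    show ?thesis
      by (rule DERIV_zero_of_locally_const[OF _ _ _ der, of "{..<r}" _ _ 0])
        (use True in \<open>auto simp: \<sigma>_def mult_le_0_iff simp del: of_nat_Suc intro!: smooth_step_0\<close>)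
  next
    case False
    with that have x: "x > r + h n" by auto
    show ?thesis
    proof (rule DERIV_zero_of_locally_const[OF _ _ _ der, of "{r + h n<..}" _ _ 1])
      fix y assume "y \<in> {r + h n<..}"
      then have "real (Suc n) * h n \<le> real (Suc n) * (y - r)" by (intro mult_left_mono) auto
      then show "\<sigma> n y = 1" using h(3)[of n] by (simp add: \<sigma>_def smooth_step_1 del: of_nat_Suc)
    qed (use x in auto)
  qed
  have one: "\<sigma> n (r + h n) - \<sigma> n r = 1" for n
    using h(3)[of n] by (simp add: \<sigma>_def smooth_step_1 smooth_step_0 del: of_nat_Suc)
  have cw: "continuous_on {r..r + h n} w" for n
    using w by (rule continuous_on_subset) (use r in auto)
  show "integrable (lebesgue_on {0<..}) (\<lambda>x. w x * D n x)"
  proof -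
    have "bounded ((\<lambda>x. w x - w r) ` {r..r + h n})"
      by (intro compact_imp_bounded compact_continuous_image continuous_intros cw) simp
    then obtain e where e: "\<forall>x\<in>{r..r + h n}. \<bar>w x - w r\<bar> \<le> e"
      unfolding bounded_real by auto
    show ?thesis
      by (rule integral_against_step_derivative(2)[OF der cont nonneg zero one h(1) r cw e[rule_format]])
  qed
  show "(\<lambda>n. LINT x|lebesgue_on {0<..}. w x * D n x) \<longlonglongrightarrow> w r"
  proof (rule LIMSEQ_I)
    fix e :: real assume e: "e > 0"
    have "isCont w r" using w r by (simp add: continuous_on_eq_continuous_at)
    then obtain d where d: "d > 0" "\<And>x. \<bar>x - r\<bar> < d \<Longrightarrow> \<bar>w x - w r\<bar> < e / 2"
      using e unfolding continuous_at_eps_delta dist_real_def by (meson half_gt_zero)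
    obtain N where N: "h N < d" unfolding h_def using reals_Archimedean[OF d(1)] by blast
    show "\<exists>no. \<forall>n\<ge>no. norm ((LINT x|lebesgue_on {0<..}. w x * D n x) - w r) < e"
    proof (intro exI allI impI)
      fix n assume "n \<ge> N"
      then have "h n \<le> h N" unfolding h_def by (intro le_imp_inverse_le) auto
      then have le: "\<bar>w x - w r\<bar> \<le> e / 2" if "x \<in> {r..r + h n}" for x
        using d(2)[of x] that N by auto
      have "\<bar>(LINT x|lebesgue_on {0<..}. w x * D n x) - w r\<bar> \<le> e / 2"
        by (rule integral_against_step_derivative(1)[OF der cont nonneg zero one h(1) r cw le])
      then show "norm ((LINT x|lebesgue_on {0<..}. w x * D n x) - w r) < e" using e by simp
    qed
  qed
qed

text \<open>Test with the difference of a step at \<open>s\<close> and a step at \<open>t\<close>, both sharpened. The test functions converge to the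
indicator of \<open>(s, t]\<close>, while their derivatives evaluate the continuous function \<open>w\<close> at \<open>s\<close> and at \<open>t\<close>.\<close>

lemma distributional_ode_increment:
  assumes ode: "distributional_ode {0<..} w g k" and w: "continuous_on {0<..} w"
    and st: "0 < s" "s < t"
  shows "w t - w s = (LINT x|lebesgue_on {s..t}. k x - g x)"
    and "integrable (lebesgue_on {s..t}) (\<lambda>x. k x - g x)"
proof -
  define \<psi> where "\<psi> n x = smooth_step (real (Suc n) * (x - s)) - smooth_step (real (Suc n) * (x - t))" for n x
  define Ds where "Ds n x = real (Suc n) * deriv smooth_step (real (Suc n) * (x - s))" for n x
  define Dt where "Dt n x = real (Suc n) * deriv smooth_step (real (Suc n) * (x - t))" for n x
  note A = integral_step_derivative_tendsto[OF w st(1), folded Ds_def]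
  have t: "t > 0" using st by simp
  note B = integral_step_derivative_tendsto[OF w t, folded Dt_def]
  let ?K = "{s..t+1}"
  have \<psi>_zero: "\<psi> n x = 0" if "x \<notin> ?K" for n x
  proof (cases "x < s")
    case True
    then show ?thesis using st
      by (simp add: \<psi>_def smooth_step_0 mult_le_0_iff del: of_nat_Suc)
  next
    case False
    with that st have x: "x - s \<ge> 1" "x - t \<ge> 1" by auto
    have "1 * 1 \<le> real (Suc n) * (x - s)" "1 * 1 \<le> real (Suc n) * (x - t)"
      by (intro mult_mono x; simp add: x)+
    then show ?thesis by (simp add: \<psi>_def smooth_step_1 del: of_nat_Suc)
  qed
  have \<psi>_bd: "\<bar>\<psi> n x\<bar> \<le> 1" for n x
    using smooth_step_bounds[of "real (Suc n) * (x - s)"] smooth_step_bounds[of "real (Suc n) * (x - t)"]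
    unfolding \<psi>_def by linarith
  have \<psi>_lim: "(\<lambda>n. \<psi> n x) \<longlonglongrightarrow> indicator {s<..t} x" for x
  proof -
    have "(\<lambda>n. smooth_step (real (Suc n) * (x - r))) \<longlonglongrightarrow> (if x > r then 1 else 0)" for r
    proof (cases "x > r")
      case True
      obtain N where N: "inverse (real (Suc N)) < x - r" using reals_Archimedean[of "x - r"] True by auto
      have "smooth_step (real (Suc n) * (x - r)) = 1" if "n \<ge> N" for n
      proof (rule smooth_step_1)
        have "1 = real (Suc N) * inverse (real (Suc N))" by (simp del: of_nat_Suc)
        also have "\<dots> \<le> real (Suc n) * (x - r)" using N that True by (intro mult_mono) auto
        finally show "1 \<le> real (Suc n) * (x - r)" .
      qed
      then have "eventually (\<lambda>n. smooth_step (real (Suc n) * (x - r)) = 1) sequentially"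
        by (auto simp: eventually_sequentially)
      then show ?thesis using True by (simp add: tendsto_eventually del: of_nat_Suc)
    next
      case False
      then have "smooth_step (real (Suc n) * (x - r)) = 0" for n
        by (intro smooth_step_0 mult_nonneg_nonpos) auto
      then show ?thesis using False by (simp del: of_nat_Suc)
    qed
    from tendsto_diff[OF this[of s] this[of t]]
    show ?thesis unfolding \<psi>_def using st by (auto simp: indicator_def split: if_splits)
  qed
  have \<psi>_smooth: "smooth_on UNIV (\<psi> n)" for n
  proof -
    have *: "smooth_on UNIV (\<lambda>x. smooth_step (real (Suc n) * (x - r)))" for r
      using smooth_on_affine_compose[OF smooth_on_smooth_step, of "real (Suc n)" "- real (Suc n) * r"]
      by (simp add: right_diff_distrib del: of_nat_Suc)
    from *[of s] smooth_on_cmult[OF *[of t], of "-1"] Ck_on_add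
    show ?thesis unfolding \<psi>_def[abs_def] smooth_on_def by fastforce
  qed
  have test: "\<psi> n \<in> test_functions {0<..}" for n
    by (rule test_functionsI[OF \<psi>_smooth, of ?K]) (use st \<psi>_zero in auto)
  have d\<psi>: "deriv (\<psi> n) x = Ds n x - Dt n x" for n x
    unfolding \<psi>_def[abs_def] by (intro DERIV_imp_deriv DERIV_diff A(3) B(3))
  have "compact ?K" "?K \<subseteq> {0<..}" "compact {s..t}" "{s..t} \<subseteq> {0<..}" using st by auto
  with ode have loc: "integrable (lebesgue_on ?K) g" "integrable (lebesgue_on ?K) k"
    "integrable (lebesgue_on {s..t}) g" "integrable (lebesgue_on {s..t}) k"
    unfolding distributional_ode_def locally_integrable_def by blast+
  show int: "integrable (lebesgue_on {s..t}) (\<lambda>x. k x - g x)" using loc by auto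
  have on: "(LINT x|lebesgue_on {0<..}. v x * \<psi> n x) = (LINT x|lebesgue_on ?K. v x * \<psi> n x)" for v n
  proof -
    have "v x * \<psi> n x = 0" if "x \<notin> {0<..}" for x using \<psi>_zero[of x n] that st by auto
    moreover have "v x * \<psi> n x = 0" if "x \<notin> ?K" for x using \<psi>_zero[of x n] that by auto
    ultimately show ?thesis by (subst (1 2) lebesgue_on_integral_supported) auto
  qed
  have m\<psi>: "\<psi> n \<in> borel_measurable (lebesgue_on ?K)" for n
    by (intro measurable_restrict_space1 lebesgue_measurable_continuous test_functions_continuous[OF test])
  have i\<psi>: "integrable (lebesgue_on ?K) (\<lambda>x. v x * \<psi> n x)" if "integrable (lebesgue_on ?K) v" for v n
  proof (rule Bochner_Integration.integrable_bound[OF that])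
    show "(\<lambda>x. v x * \<psi> n x) \<in> borel_measurable (lebesgue_on ?K)"
      using that m\<psi> by (intro borel_measurable_times) auto
    show "AE x in lebesgue_on ?K. norm (v x * \<psi> n x) \<le> norm (v x)"
      using \<psi>_bd[of n] by (intro AE_I2) (simp add: abs_mult mult_left_le)
  qed
  have eqn: "(LINT x|lebesgue_on {0<..}. w x * Dt n x) - (LINT x|lebesgue_on {0<..}. w x * Ds n x)
      = (LINT x|lebesgue_on ?K. (k x - g x) * \<psi> n x)" for n
  proof -
    have "- (LINT x|lebesgue_on {0<..}. w x * deriv (\<psi> n) x) + (LINT x|lebesgue_on {0<..}. g x * \<psi> n x)
        = (LINT x|lebesgue_on {0<..}. k x * \<psi> n x)"
      using ode test unfolding distributional_ode_def by blast
    moreover have "(LINT x|lebesgue_on {0<..}. w x * deriv (\<psi> n) x)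
        = (LINT x|lebesgue_on {0<..}. w x * Ds n x) - (LINT x|lebesgue_on {0<..}. w x * Dt n x)"
      unfolding d\<psi> right_diff_distrib by (rule Bochner_Integration.integral_diff[OF A(2) B(2)])
    moreover have "(LINT x|lebesgue_on ?K. (k x - g x) * \<psi> n x)
        = (LINT x|lebesgue_on ?K. k x * \<psi> n x) - (LINT x|lebesgue_on ?K. g x * \<psi> n x)"
      unfolding left_diff_distrib by (rule Bochner_Integration.integral_diff[OF i\<psi> i\<psi>]) (use loc in auto)
    ultimately show ?thesis by (simp only: on)
  qed
  have "(\<lambda>n. LINT x|lebesgue_on ?K. (k x - g x) * \<psi> n x)
      \<longlonglongrightarrow> (LINT x|lebesgue_on ?K. (k x - g x) * indicator {s<..t} x)"
  proof (rule integral_dominated_convergence[where w = "\<lambda>x. \<bar>k x - g x\<bar>"])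
    show "integrable (lebesgue_on ?K) (\<lambda>x. \<bar>k x - g x\<bar>)" using loc by auto
    show "(\<lambda>x. (k x - g x) * \<psi> n x) \<in> borel_measurable (lebesgue_on ?K)" for n
      using loc m\<psi> by (intro borel_measurable_times) auto
    have "(indicator {s<..t} :: real \<Rightarrow> real) \<in> borel_measurable (lebesgue_on ?K)"
      by (intro measurable_restrict_space1 borel_measurable_indicator) auto
    then show "(\<lambda>x. (k x - g x) * indicator {s<..t} x) \<in> borel_measurable (lebesgue_on ?K)"
      using loc by (intro borel_measurable_times) auto
    show "AE x in lebesgue_on ?K. (\<lambda>n. (k x - g x) * \<psi> n x) \<longlonglongrightarrow> (k x - g x) * indicator {s<..t} x"
      by (intro AE_I2 tendsto_mult tendsto_const \<psi>_lim)
    show "AE x in lebesgue_on ?K. norm ((k x - g x) * \<psi> n x) \<le> \<bar>k x - g x\<bar>" for n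
      using \<psi>_bd[of n] by (intro AE_I2) (simp add: abs_mult mult_left_le)
  qed
  moreover have "(\<lambda>n. LINT x|lebesgue_on ?K. (k x - g x) * \<psi> n x) \<longlonglongrightarrow> w t - w s"
    unfolding eqn[symmetric] by (intro tendsto_diff A(1) B(1))
  ultimately have "w t - w s = (LINT x|lebesgue_on ?K. (k x - g x) * indicator {s<..t} x)"
    using LIMSEQ_unique by blast
  also have "\<dots> = (LINT x|lebesgue. (k x - g x) * indicator {s<..t} x)"
    by (rule lebesgue_on_integral_supported) (auto simp: indicator_def)
  also have "\<dots> = (LINT x|lebesgue. indicator {s..t} x *\<^sub>R (k x - g x))"
  proof (rule integral_cong_AE)
    have i2: "integrable lebesgue (\<lambda>x. indicator {s..t} x *\<^sub>R (k x - g x))"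
      using int by (subst (asm) integrable_restrict_space) auto
    then show "(\<lambda>x. indicator {s..t} x *\<^sub>R (k x - g x)) \<in> borel_measurable lebesgue" by auto
    have "(\<lambda>x. indicator {s<..t} x * (indicator {s..t} x *\<^sub>R (k x - g x))) \<in> borel_measurable lebesgue"
      using i2 by (intro borel_measurable_times borel_measurable_indicator) auto
    also have "(\<lambda>x. indicator {s<..t} x * (indicator {s..t} x *\<^sub>R (k x - g x)))
        = (\<lambda>x. (k x - g x) * indicator {s<..t} x)" by (auto simp: indicator_def)
    finally show "(\<lambda>x. (k x - g x) * indicator {s<..t} x) \<in> borel_measurable lebesgue" .
    have "AE x in lebesgue. x \<noteq> s" using AE_not_in[of "{s}" lebesgue] by simp
    then show "AE x in lebesgue. (k x - g x) * indicator {s<..t} x = indicator {s..t} x *\<^sub>R (k x - g x)"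
      by eventually_elim (auto simp: indicator_def)
  qed
  also have "\<dots> = (LINT x|lebesgue_on {s..t}. k x - g x)"
    by (subst integral_restrict_space) auto
  finally show "w t - w s = (LINT x|lebesgue_on {s..t}. k x - g x)" .
qed

text \<open>Telescoping over an equidistant partition of mesh smaller than \<open>\<delta>\<close>.\<close>

lemma nonincreasing_if_locally:
  fixes Z :: "real \<Rightarrow> real"
  assumes "\<delta> > 0" "a < b"
    and loc: "\<And>s t. a \<le> s \<Longrightarrow> s < t \<Longrightarrow> t \<le> b \<Longrightarrow> t - s < \<delta> \<Longrightarrow> Z t \<le> Z s"
  shows "Z b \<le> Z a"
proof -
  obtain n where n: "(b - a) / \<delta> < real (Suc n)" using reals_Archimedean2 less_trans of_nat_less_iff
    by (metis lessI)
  define h where "h = (b - a) / real (Suc n)"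
  have h: "h > 0" "h < \<delta>" "real (Suc n) * h = b - a"
    using n assms(1,2) by (auto simp: h_def field_simps simp del: of_nat_Suc)
  have "Z (a + real i * h) \<le> Z a" if "i \<le> Suc n" for i
    using that
  proof (induction i)
    case (Suc i)
    have "real (Suc i) * h \<le> real (Suc n) * h"
      using Suc.prems h by (intro mult_right_mono) auto
    then have "a + real (Suc i) * h \<le> b" using h(3) by linarith
    then have "Z (a + real (Suc i) * h) \<le> Z (a + real i * h)"
      using h by (intro loc) (auto simp: algebra_simps)
    with Suc show ?case by simp
  qed simp
  from this[of "Suc n"] show ?thesis using h(3) by simp
qed

section \<open>Convex truncations and their energies\<close>

text \<open>A convex \<open>\<Phi>\<close> with smooth, bounded, nondecreasing and Lipschitz derivative \<open>\<beta>\<close>. Only these properties enter the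
energy estimate, so that truncation from above and from below are treated at once.\<close>

locale truncation_pair =
  fixes \<Phi> \<beta> :: "real \<Rightarrow> real" and L :: real
  assumes smooth: "smooth_on UNIV \<beta>"
    and deriv_\<Phi>: "\<And>s. (\<Phi> has_real_derivative \<beta> s) (at s)"
    and deriv_\<beta>: "\<And>s. 0 \<le> deriv \<beta> s" "\<And>s. deriv \<beta> s \<le> L"
    and \<beta>_bounded: "\<And>s. \<bar>\<beta> s\<bar> \<le> 1"
    and zero: "\<Phi> 0 = 0" "\<beta> 0 = 0"
begin

lemma L_nonneg: "0 \<le> L"
  using deriv_\<beta>[of 0] by linarith

lemma \<beta>_diff: "r \<le> s \<Longrightarrow> 0 \<le> \<beta> s - \<beta> r" "r \<le> s \<Longrightarrow> \<beta> s - \<beta> r \<le> L * (s - r)"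
proof -
  assume rs: "r \<le> s"
  have "\<exists>z. \<beta> s - \<beta> r = (s - r) * deriv \<beta> z"
  proof (cases "r = s")
    case False
    with rs MVT2[of r s \<beta> "deriv \<beta>"] smooth_on_real_deriv(1)[OF smooth] show ?thesis by (metis less_le)
  qed simp
  then obtain z where z: "\<beta> s - \<beta> r = (s - r) * deriv \<beta> z" by blast
  show "0 \<le> \<beta> s - \<beta> r" unfolding z using rs deriv_\<beta>(1)[of z] by simp
  show "\<beta> s - \<beta> r \<le> L * (s - r)"
    unfolding z using mult_left_mono[OF deriv_\<beta>(2)[of z], of "s - r"] rs by (simp add: mult.commute)
qed

lemma \<beta>_lipschitz: "\<bar>\<beta> s - \<beta> r\<bar> \<le> L * \<bar>s - r\<bar>"
  using \<beta>_diff[of r s] \<beta>_diff[of s r] by (cases "r \<le> s") auto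

lemma \<Phi>_convex: "\<Phi> s - \<Phi> r \<le> \<beta> s * (s - r)"
proof -
  consider "r < s" | "r = s" | "s < r" by linarith
  then show ?thesis
  proof cases
    case 1
    then obtain z where z: "z < s" "\<Phi> s - \<Phi> r = (s - r) * \<beta> z"
      using MVT2[of r s \<Phi> \<beta>] deriv_\<Phi> by blast
    then show ?thesis using 1 \<beta>_diff(1)[of z s] by (simp add: mult.commute mult_left_mono)
  next
    case 3
    then obtain z where z: "s < z" "\<Phi> r - \<Phi> s = (r - s) * \<beta> z"
      using MVT2[of s r \<Phi> \<beta>] deriv_\<Phi> by blast
    have "(r - s) * \<beta> s \<le> (r - s) * \<beta> z"
      using 3 z \<beta>_diff(1)[of s z] by (intro mult_left_mono) auto
    then show ?thesis using z by (simp add: algebra_simps)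
  qed simp
qed

lemma \<Phi>_nonneg: "0 \<le> \<Phi> s"
  using \<Phi>_convex[of 0 s] by (simp add: zero)

lemma \<Phi>_le: "\<Phi> s \<le> L * s\<^sup>2"
proof -
  have "\<Phi> s \<le> \<beta> s * s" using \<Phi>_convex[of s 0] by (simp add: zero)
  also have "\<dots> \<le> \<bar>\<beta> s\<bar> * \<bar>s\<bar>" by (metis abs_ge_self abs_mult)
  also have "\<dots> \<le> L * \<bar>s\<bar> * \<bar>s\<bar>"
    using \<beta>_lipschitz[of s 0] by (intro mult_right_mono) (auto simp: zero)
  finally show ?thesis by (simp add: power2_eq_square mult.assoc)
qed

lemma \<beta>_continuous: "continuous_on UNIV \<beta>"
  by (rule smooth_on_continuous[OF smooth])

lemma square_integrable_\<beta>:
  fixes v :: "'a::euclidean_space \<Rightarrow> real"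
  assumes "square_integrable v" shows "square_integrable (\<lambda>x. \<beta> (v x))"
  unfolding square_integrable_def
proof
  have v: "v \<in> borel_measurable lebesgue" "integrable lebesgue (\<lambda>x. (v x)\<^sup>2)"
    using assms by (auto simp: square_integrable_def)
  show m: "(\<lambda>x. \<beta> (v x)) \<in> borel_measurable lebesgue"
    by (rule borel_measurable_continuous_on[OF \<beta>_continuous v(1)])
  show "integrable lebesgue (\<lambda>x. (\<beta> (v x))\<^sup>2)"
  proof (rule Bochner_Integration.integrable_bound)
    show "integrable lebesgue (\<lambda>x. L\<^sup>2 * (v x)\<^sup>2)" using v(2) by simp
    show "(\<lambda>x. (\<beta> (v x))\<^sup>2) \<in> borel_measurable lebesgue" using m by simp
    have "(\<beta> s)\<^sup>2 \<le> L\<^sup>2 * s\<^sup>2" for s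
      using power_mono[OF \<beta>_lipschitz[of s 0], of 2] by (simp add: zero power_mult_distrib)
    then show "AE x in lebesgue. norm ((\<beta> (v x))\<^sup>2) \<le> norm (L\<^sup>2 * (v x)\<^sup>2)" by simp
  qed
qed

text \<open>The superposition operator of \<open>\<beta>\<close>; it is the gradient of the convex functional \<open>energy\<close>.\<close>

definition nemytskii :: "'a::euclidean_space L2 \<Rightarrow> 'a L2" where
  "nemytskii u = L2_class (\<lambda>x. \<beta> (L2_rep u x))"

definition energy :: "'a::euclidean_space L2 \<Rightarrow> real" where
  "energy u = (LINT x|lebesgue. \<Phi> (L2_rep u x))"

lemma nemytskii_rep: "AE x in lebesgue. L2_rep (nemytskii u) x = \<beta> (L2_rep u x)"
  unfolding nemytskii_def by (rule L2_rep_class[OF square_integrable_\<beta>[OF square_integrable_L2_rep]])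

lemma nemytskii_class:
  assumes "square_integrable v" shows "L2_class (\<lambda>x. \<beta> (v x)) = nemytskii (L2_class v)"
proof (rule L2_class_eq[OF square_integrable_\<beta>[OF assms]])
  show "AE x in lebesgue. L2_rep (nemytskii (L2_class v)) x = \<beta> (v x)"
    using nemytskii_rep[of "L2_class v"] L2_rep_class[OF assms] by eventually_elim simp
qed

lemma nemytskii_lipschitz: "norm (nemytskii u - nemytskii v) \<le> L * norm (u - v)"
proof -
  have "(norm (nemytskii u - nemytskii v))\<^sup>2 \<le> (LINT x|lebesgue. L\<^sup>2 * (L2_rep (u - v) x)\<^sup>2)"
    unfolding norm_L2_square
  proof (rule integral_mono_AE)
    show "integrable lebesgue (\<lambda>x. (L2_rep (nemytskii u - nemytskii v) x)\<^sup>2)"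
      "integrable lebesgue (\<lambda>x. L\<^sup>2 * (L2_rep (u - v) x)\<^sup>2)"
      using square_integrable_L2_rep unfolding square_integrable_def by auto
    have *: "(\<beta> s - \<beta> r)\<^sup>2 \<le> L\<^sup>2 * (s - r)\<^sup>2" for s r
      using power_mono[OF \<beta>_lipschitz[of s r], of 2] by (simp add: power_mult_distrib)
    show "AE x in lebesgue. (L2_rep (nemytskii u - nemytskii v) x)\<^sup>2 \<le> L\<^sup>2 * (L2_rep (u - v) x)\<^sup>2"
      using L2_rep_diff[of u v] L2_rep_diff[of "nemytskii u" "nemytskii v"]
        nemytskii_rep[of u] nemytskii_rep[of v]
      by eventually_elim (simp add: *)
  qed
  also have "\<dots> = (L * norm (u - v))\<^sup>2"
    by (simp add: power_mult_distrib norm_L2_square)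
  finally show ?thesis
    by (rule power2_le_imp_le) (simp add: L_nonneg)
qed

lemma nemytskii_zero: "nemytskii 0 = 0"
  using nemytskii_rep[of 0] L2_rep_zero unfolding L2_eq_iff
  by eventually_elim (simp add: zero)

lemma norm_nemytskii_le: "norm (nemytskii u) \<le> L * norm u"
  using nemytskii_lipschitz[of u 0] by (simp add: nemytskii_zero)

lemma integrable_\<Phi>:
  assumes "square_integrable v" shows "integrable lebesgue (\<lambda>x. \<Phi> (v x))"
proof (rule Bochner_Integration.integrable_bound)
  have v: "v \<in> borel_measurable lebesgue" "integrable lebesgue (\<lambda>x. (v x)\<^sup>2)"
    using assms by (auto simp: square_integrable_def)
  show "integrable lebesgue (\<lambda>x. L * (v x)\<^sup>2)" using v(2) by simp
  have "continuous_on UNIV \<Phi>" using DERIV_isCont[OF deriv_\<Phi>] by (simp add: continuous_on_eq_continuous_at)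
  then show "(\<lambda>x. \<Phi> (v x)) \<in> borel_measurable lebesgue"
    using v(1) by (rule borel_measurable_continuous_on)
  show "AE x in lebesgue. norm (\<Phi> (v x)) \<le> norm (L * (v x)\<^sup>2)"
    using L_nonneg \<Phi>_nonneg \<Phi>_le by simp
qed

lemma energy_convex: "energy u - energy v \<le> inner (nemytskii u) (u - v)"
proof -
  have "energy u - energy v = (LINT x|lebesgue. \<Phi> (L2_rep u x) - \<Phi> (L2_rep v x))"
    unfolding energy_def
    by (intro Bochner_Integration.integral_diff[symmetric] integrable_\<Phi> square_integrable_L2_rep)
  also have "\<dots> \<le> (LINT x|lebesgue. L2_rep (nemytskii u) x * L2_rep (u - v) x)"
  proof (rule integral_mono_AE)
    show "integrable lebesgue (\<lambda>x. \<Phi> (L2_rep u x) - \<Phi> (L2_rep v x))"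
      by (intro Bochner_Integration.integrable_diff integrable_\<Phi> square_integrable_L2_rep)
    show "integrable lebesgue (\<lambda>x. L2_rep (nemytskii u) x * L2_rep (u - v) x)"
      by (intro square_integrable_mult square_integrable_L2_rep)
    show "AE x in lebesgue. \<Phi> (L2_rep u x) - \<Phi> (L2_rep v x) \<le> L2_rep (nemytskii u) x * L2_rep (u - v) x"
      using L2_rep_diff[of u v] nemytskii_rep[of u] by eventually_elim (simp add: \<Phi>_convex)
  qed
  finally show ?thesis by (simp add: inner_L2_eq)
qed

text \<open>Convexity in both directions bounds the difference by \<open>\<beta>(u)\<close> and \<open>\<beta>(v)\<close>, which grow at most linearly.\<close>

lemma energy_diff_le: "\<bar>energy u - energy v\<bar> \<le> L * (norm u + norm v) * norm (u - v)"
proof -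
  have *: "energy u - energy v \<le> L * norm u * norm (u - v)" for u v :: "'a L2"
  proof -
    have "energy u - energy v \<le> norm (nemytskii u) * norm (u - v)"
      using energy_convex[of u v] norm_cauchy_schwarz[of "nemytskii u" "u - v"] by linarith
    also have "\<dots> \<le> L * norm u * norm (u - v)"
      by (intro mult_right_mono norm_nemytskii_le) simp
    finally show ?thesis .
  qed
  have "0 \<le> L * norm u * norm (u - v)" "0 \<le> L * norm v * norm (u - v)"
    using L_nonneg by simp_all
  with *[of u v] *[of v u] show ?thesis
    by (simp add: norm_minus_commute algebra_simps)
qed

lemma continuous_on_energy: "continuous_on A energy"
proof (rule continuous_at_imp_continuous_on, rule ballI)
  fix u :: "'a L2"
  have "((\<lambda>v. L * (norm v + norm u) * norm (v - u)) \<longlongrightarrow> L * (norm u + norm u) * norm (u - u)) (at u)"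
    by (intro tendsto_intros)
  then have "((\<lambda>v. L * (norm v + norm u) * norm (v - u)) \<longlongrightarrow> 0) (at u)" by simp
  then have "((\<lambda>v. energy v - energy u) \<longlongrightarrow> 0) (at u)"
    by (rule Lim_null_comparison[rotated]) (simp add: energy_diff_le)
  then show "isCont energy u" unfolding isCont_def by (simp add: LIM_zero_iff)
qed

lemma energy_nonneg: "0 \<le> energy u"
  unfolding energy_def by (intro integral_nonneg_AE AE_I2 \<Phi>_nonneg)

lemma energy_eq_0D: "energy u = 0 \<Longrightarrow> AE x in lebesgue. \<Phi> (L2_rep u x) = 0"
  unfolding energy_def
  using integral_nonneg_eq_0_iff_AE[OF integrable_\<Phi>[OF square_integrable_L2_rep[of u]]] \<Phi>_nonneg by simp

end

section \<open>Testing the Laplacian with a truncation\<close>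

text \<open>Second weak derivatives of \<open>w\<close> are weak derivatives of \<open>\<partial>\<^sub>b w\<close>, so this is their defining identity summed over
the coordinate directions.\<close>

lemma grad_inner_test:
  assumes S: "open S" and w: "w \<in> dom_A S" and \<phi>: "\<phi> \<in> test_functions S"
  shows "grad_inner S w (L2_class \<phi>) = - inner (laplacian S w) (L2_class \<phi>)"
proof -
  have "inner (weak_deriv S b w) (weak_deriv S b (L2_class \<phi>))
      = - inner (weak_deriv S b (weak_deriv S b w)) (L2_class \<phi>)" if b: "b \<in> Basis" for b
  proof -
    have "weak_deriv S b w \<in> H1 S" using w b by (simp add: dom_A_def H2_def)
    then have "has_weak_deriv S b (weak_deriv S b w) (weak_deriv S b (weak_deriv S b w))"
      by (rule H1_has_weak_deriv[OF S b])
    then show ?thesis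
      using \<phi> weak_deriv_eqI[OF S b has_weak_deriv_test[OF S b \<phi>]]
      by (simp add: has_weak_deriv_iff[OF S b])
  qed
  then show ?thesis
    by (simp add: grad_inner_def laplacian_def inner_sum_left sum_negf)
qed

lemma H10_approx:
  assumes S: "open S" and w: "w \<in> H10 S" and "\<delta> > 0"
  obtains \<phi> where "\<phi> \<in> test_functions S" "norm (w - L2_class \<phi>) < \<delta>"
    "\<And>b. b \<in> Basis \<Longrightarrow> norm (weak_deriv S b w - L2_class (\<lambda>x. frechet_derivative \<phi> (at x) b)) < \<delta>"
proof -
  obtain \<phi> where \<phi>: "\<phi> \<in> test_functions S" "H1_norm S (w - L2_class \<phi>) < \<delta>"
    using w assms(3) unfolding H10_def by blast
  have wd: "weak_deriv S b (w - L2_class \<phi>) = weak_deriv S b w - L2_class (\<lambda>x. frechet_derivative \<phi> (at x) b)"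
    if b: "b \<in> Basis" for b
    using w by (intro weak_deriv_eqI[OF S b] has_weak_deriv_diff[OF S b] has_weak_deriv_test[OF S b \<phi>(1)]
        H1_has_weak_deriv[OF S b]) (simp add: H10_def)
  let ?g = "grad_inner S (w - L2_class \<phi>) (w - L2_class \<phi>)"
  have g0: "0 \<le> ?g" unfolding grad_inner_def by (intro sum_nonneg) simp
  show ?thesis
  proof (rule that[OF \<phi>(1)])
    have "norm (w - L2_class \<phi>) \<le> H1_norm S (w - L2_class \<phi>)"
      unfolding H1_norm_def using g0 by (intro real_le_rsqrt) simp
    then show "norm (w - L2_class \<phi>) < \<delta>" using \<phi>(2) by simp
    fix b :: 'a assume b: "b \<in> Basis"
    have "(norm (weak_deriv S b (w - L2_class \<phi>)))\<^sup>2 \<le> ?g"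
      unfolding grad_inner_def power2_norm_eq_inner using b by (intro member_le_sum) auto
    then have "norm (weak_deriv S b (w - L2_class \<phi>)) \<le> H1_norm S (w - L2_class \<phi>)"
      unfolding H1_norm_def by (intro real_le_rsqrt) (simp add: add_increasing)
    then show "norm (weak_deriv S b w - L2_class (\<lambda>x. frechet_derivative \<phi> (at x) b)) < \<delta>"
      using \<phi>(2) wd[OF b] by simp
  qed
qed

context truncation_pair
begin

text \<open>If \<open>g\<close> were equal to \<open>\<partial>\<^sub>b \<phi>\<close>, the inner product would be \<open>\<integral> \<beta>'(\<phi>) (\<partial>\<^sub>b \<phi>)\<^sup>2 \<ge> 0\<close>. In general the distance of the
two is paid for by the Cauchy-Schwarz inequality and \<open>\<beta>' \<le> L\<close>.\<close>

lemma inner_test_composition_ge: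
  assumes S: "open S" and b: "b \<in> Basis" and \<phi>: "\<phi> \<in> test_functions S"
    and \<delta>: "norm (g - L2_class (\<lambda>x. frechet_derivative \<phi> (at x) b)) \<le> \<delta>"
  shows "- (\<delta> * (L * (norm g + \<delta>))) \<le> inner g (L2_class (\<lambda>x. frechet_derivative (\<lambda>y. \<beta> (\<phi> y)) (at x) b))"
proof -
  define d where "d x = frechet_derivative \<phi> (at x) b" for x
  define e where "e x = frechet_derivative (\<lambda>y. \<beta> (\<phi> y)) (at x) b" for x
  have e: "e x = deriv \<beta> (\<phi> x) * d x" for x
    unfolding e_def d_def
    by (rule frechet_derivative_compose_real[OF \<phi> smooth_on_real_deriv(1)[OF smooth]])
  have sd: "square_integrable d"
    unfolding d_def by (rule square_integrable_test[OF test_functions_deriv[OF \<phi> b]])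
  have se: "square_integrable e"
    unfolding e_def
    by (rule square_integrable_test[OF test_functions_deriv[OF test_functions_compose[OF \<phi> smooth zero(2)] b]])
  have "d x * e x = deriv \<beta> (\<phi> x) * (d x)\<^sup>2" for x
    by (simp add: e power2_eq_square)
  then have "0 \<le> (LINT x|lebesgue. d x * e x)"
    using deriv_\<beta>(1) by (intro integral_nonneg_AE AE_I2) simp
  then have pos: "0 \<le> inner (L2_class d) (L2_class e)"
    using sd se by (subst inner_L2.abs_eq) (simp_all add: ae_equal_def)
  have "(norm (L2_class e))\<^sup>2 \<le> (L * norm (L2_class d))\<^sup>2"
  proof -
    have "(norm (L2_class e))\<^sup>2 = (LINT x|lebesgue. e x * e x)"
      unfolding power2_norm_eq_inner using se by (subst inner_L2.abs_eq) (simp_all add: ae_equal_def)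
    also have "\<dots> \<le> (LINT x|lebesgue. L\<^sup>2 * (d x * d x))"
    proof (rule integral_mono)
      show "integrable lebesgue (\<lambda>x. e x * e x)" "integrable lebesgue (\<lambda>x. L\<^sup>2 * (d x * d x))"
        using square_integrable_mult[OF se se] square_integrable_mult[OF sd sd] by auto
      fix x
      have "(deriv \<beta> (\<phi> x))\<^sup>2 \<le> L\<^sup>2" using deriv_\<beta> by (intro power_mono)
      then have "(deriv \<beta> (\<phi> x))\<^sup>2 * (d x)\<^sup>2 \<le> L\<^sup>2 * (d x)\<^sup>2" by (intro mult_right_mono) simp_all
      then show "e x * e x \<le> L\<^sup>2 * (d x * d x)" by (simp add: e power2_eq_square mult.assoc mult.left_commute)
    qed
    also have "\<dots> = L\<^sup>2 * inner (L2_class d) (L2_class d)"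
      using sd by (subst inner_L2.abs_eq) (simp_all add: ae_equal_def)
    also have "\<dots> = (L * norm (L2_class d))\<^sup>2" by (simp add: power_mult_distrib power2_norm_eq_inner)
    finally show ?thesis .
  qed
  then have "norm (L2_class e) \<le> L * norm (L2_class d)"
    by (rule power2_le_imp_le) (simp add: L_nonneg)
  moreover have \<delta>': "norm (g - L2_class d) \<le> \<delta>" using \<delta> by (simp add: d_def[abs_def])
  then have "norm (L2_class d) \<le> norm g + \<delta>"
    using norm_triangle_ineq2[of "L2_class d" g] by (simp add: norm_minus_commute)
  ultimately have ne: "norm (L2_class e) \<le> L * (norm g + \<delta>)"
    using mult_left_mono[of "norm (L2_class d)" "norm g + \<delta>" L] L_nonneg by linarith
  have "inner g (L2_class e) = inner (g - L2_class d) (L2_class e) + inner (L2_class d) (L2_class e)"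
    by (simp add: inner_diff_left)
  moreover have "\<bar>inner (g - L2_class d) (L2_class e)\<bar> \<le> norm (g - L2_class d) * norm (L2_class e)"
    by (rule Cauchy_Schwarz_ineq2)
  moreover have "norm (g - L2_class d) * norm (L2_class e) \<le> \<delta> * (L * (norm g + \<delta>))"
    using order_trans[OF norm_ge_zero \<delta>'] by (intro mult_mono \<delta>' ne) simp_all
  ultimately have "- (\<delta> * (L * (norm g + \<delta>))) \<le> inner g (L2_class e)" using pos by linarith
  then show ?thesis by (simp add: e_def[abs_def])
qed

text \<open>Formally \<open>(\<Delta>w, \<beta>(w)) = - \<integral> \<beta>'(w) \<bar>\<nabla>w\<bar>\<^sup>2\<close>. A chain rule for \<open>\<beta>(w)\<close> is avoided by approximating \<open>w\<close> in \<open>H\<^sup>1\<close> by test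
functions \<open>\<phi>\<close> and integrating by parts against the test function \<open>\<beta>(\<phi>)\<close>; since the superposition operator is
Lipschitz continuous in \<open>L\<^sup>2\<close>, both this approximation and the gradient terms cost at most a multiple of the
\<open>H\<^sup>1\<close>-distance.\<close>

lemma laplacian_nemytskii_nonpos:
  assumes S: "open S" and w: "w \<in> dom_A S"
  shows "inner (laplacian S w) (nemytskii w) \<le> 0"
proof -
  \<comment> \<open>Error per unit of \<open>H\<^sup>1\<close>-distance between \<open>w\<close> and the approximating test function, for distances at most \<open>1\<close>.\<close>
  define K where "K = (\<Sum>b\<in>Basis. L * (norm (weak_deriv S b w) + 1)) + norm (laplacian S w) * L"
  have K: "K \<ge> 0" unfolding K_def using L_nonneg by (intro add_nonneg_nonneg sum_nonneg mult_nonneg_nonneg) auto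
  have main: "inner (laplacian S w) (nemytskii w) \<le> \<delta> * K" if \<delta>: "0 < \<delta>" "\<delta> \<le> 1" for \<delta>
  proof -
    obtain \<phi> where \<phi>: "\<phi> \<in> test_functions S" "norm (w - L2_class \<phi>) < \<delta>"
      "\<And>b. b \<in> Basis \<Longrightarrow> norm (weak_deriv S b w - L2_class (\<lambda>x. frechet_derivative \<phi> (at x) b)) < \<delta>"
      using H10_approx[OF S _ \<delta>(1), of w] w unfolding dom_A_def by blast
    define \<psi> where "\<psi> x = \<beta> (\<phi> x)" for x
    have \<psi>: "\<psi> \<in> test_functions S" unfolding \<psi>_def by (rule test_functions_compose[OF \<phi>(1) smooth zero(2)])
    have "inner (laplacian S w) (L2_class \<psi>) = - grad_inner S w (L2_class \<psi>)"
      using grad_inner_test[OF S w \<psi>] by simp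
    also have "\<dots> = (\<Sum>b\<in>Basis. - inner (weak_deriv S b w) (L2_class (\<lambda>x. frechet_derivative \<psi> (at x) b)))"
      unfolding grad_inner_def using weak_deriv_eqI[OF S _ has_weak_deriv_test[OF S _ \<psi>]]
      by (simp add: sum_negf)
    also have "\<dots> \<le> (\<Sum>b\<in>Basis. \<delta> * (L * (norm (weak_deriv S b w) + 1)))"
    proof (rule sum_mono)
      fix b :: 'a assume b: "b \<in> Basis"
      have "- (\<delta> * (L * (norm (weak_deriv S b w) + \<delta>))) \<le> inner (weak_deriv S b w) (L2_class (\<lambda>x. frechet_derivative \<psi> (at x) b))"
        unfolding \<psi>_def[abs_def] by (rule inner_test_composition_ge[OF S b \<phi>(1)]) (use \<phi>(3)[OF b] in simp)
      moreover have "\<delta> * (L * (norm (weak_deriv S b w) + \<delta>)) \<le> \<delta> * (L * (norm (weak_deriv S b w) + 1))"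
        using \<delta> L_nonneg by (intro mult_left_mono) auto
      ultimately show "- inner (weak_deriv S b w) (L2_class (\<lambda>x. frechet_derivative \<psi> (at x) b)) \<le> \<delta> * (L * (norm (weak_deriv S b w) + 1))"
        by linarith
    qed
    finally have 1: "inner (laplacian S w) (L2_class \<psi>) \<le> \<delta> * (\<Sum>b\<in>Basis. L * (norm (weak_deriv S b w) + 1))"
      by (simp add: sum_distrib_left)
    have "L2_class \<psi> = nemytskii (L2_class \<phi>)"
      unfolding \<psi>_def by (rule nemytskii_class[OF square_integrable_test[OF \<phi>(1)]])
    then have "norm (nemytskii w - L2_class \<psi>) \<le> L * norm (w - L2_class \<phi>)"
      by (simp add: nemytskii_lipschitz)
    also have "\<dots> \<le> L * \<delta>" using \<phi>(2) L_nonneg by (intro mult_left_mono) auto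
    finally have "norm (laplacian S w) * norm (nemytskii w - L2_class \<psi>) \<le> norm (laplacian S w) * (L * \<delta>)"
      by (intro mult_left_mono) simp_all
    then have "inner (laplacian S w) (nemytskii w - L2_class \<psi>) \<le> norm (laplacian S w) * (L * \<delta>)"
      using norm_cauchy_schwarz[of "laplacian S w" "nemytskii w - L2_class \<psi>"] by linarith
    with 1 show ?thesis by (simp add: K_def inner_diff_right algebra_simps)
  qed
  show ?thesis
  proof (rule ccontr)
    assume "\<not> ?thesis"
    then have pos: "inner (laplacian S w) (nemytskii w) > 0" (is "?X > 0") by simp
    define \<delta> where "\<delta> = min 1 (?X / (2 * (K + 1)))"
    have "0 < \<delta>" "\<delta> \<le> 1" using pos K by (auto simp: \<delta>_def)
    then have "?X \<le> \<delta> * K" by (rule main)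
    also have "\<dots> \<le> \<delta> * (K + 1)" using \<open>0 < \<delta>\<close> by simp
    also have "\<dots> \<le> ?X / (2 * (K + 1)) * (K + 1)" using K by (intro mult_right_mono) (auto simp: \<delta>_def)
    also have "\<dots> = ?X / 2" using K by (simp add: field_simps)
    finally show False using pos by simp
  qed
qed

lemma truncation_pair_reflect: "truncation_pair (\<lambda>s. \<Phi> (- s)) (\<lambda>s. - \<beta> (- s)) L"
proof -
  have neg: "(uminus has_real_derivative - 1) (at s)" for s :: real
    by (auto intro!: derivative_eq_intros)
  have d: "((\<lambda>s. - \<beta> (- s)) has_real_derivative deriv \<beta> (- s)) (at s)" for s
    using DERIV_minus[OF DERIV_chain2[where f = \<beta> and g = uminus,
          OF smooth_on_real_deriv(1)[OF smooth] neg]] by simp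
  then have d': "deriv (\<lambda>s. - \<beta> (- s)) s = deriv \<beta> (- s)" for s by (rule DERIV_imp_deriv)
  show ?thesis
  proof
    show "smooth_on UNIV (\<lambda>s. - \<beta> (- s))"
      using smooth_on_cmult[OF smooth_on_affine_compose[OF smooth, of "-1" 0], of "-1"] by simp
    show "((\<lambda>s. \<Phi> (- s)) has_real_derivative - \<beta> (- s)) (at s)" for s
      using DERIV_chain2[where f = \<Phi> and g = uminus, OF deriv_\<Phi> neg] by simp
  qed (auto simp: d' deriv_\<beta> \<beta>_bounded zero)
qed

end

section \<open>The truncation at a level and the reaction term\<close>

text \<open>For \<open>x = s - M > 0\<close> this is \<open>x e\<^sup>-\<^sup>1\<^sup>/\<^sup>x\<close>, with derivative \<open>(1 + 1/x) e\<^sup>-\<^sup>1\<^sup>/\<^sup>x\<close> and second derivative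
\<open>x\<^sup>-\<^sup>3 e\<^sup>-\<^sup>1\<^sup>/\<^sup>x\<close>: a smooth substitute for the positive part of \<open>s - M\<close> whose convexity can be read off.\<close>

definition trunc :: "real \<Rightarrow> real \<Rightarrow> real" where
  "trunc M s = (s - M) * flat 1 (s - M)"

definition trunc' :: "real \<Rightarrow> real \<Rightarrow> real" where
  "trunc' M s = flat [:1, 1:] (s - M)"

lemma truncation_pair_trunc:
  assumes "M \<ge> 0" shows "truncation_pair (trunc M) (trunc' M) 27"
proof -
  have shift: "((\<lambda>s. G (s - M)) has_real_derivative D) (at s)" if "(G has_real_derivative D) (at (s - M))" for G D s
  proof -
    have "((\<lambda>s. s - M) has_real_derivative 1) (at s)" by (auto intro!: derivative_eq_intros)
    from DERIV_chain2[where f = G and g = "\<lambda>s. s - M", OF that this] show ?thesis by simp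
  qed
  have d: "(trunc' M has_real_derivative flat (monom 1 2 * ([:1, 1:] - pderiv [:1, 1:])) (s - M)) (at s)" for s
    unfolding trunc'_def[abs_def] by (rule shift[OF DERIV_flat])
  have d': "deriv (trunc' M) s = flat (monom 1 2 * ([:1, 1:] - pderiv [:1, 1:])) (s - M)" for s
    by (rule DERIV_imp_deriv[OF d])
  have d3: "flat (monom 1 2 * ([:1, 1:] - pderiv [:1, 1:])) x = (if x \<le> 0 then 0 else inverse x ^ 3 * exp (- inverse x))" for x
    by (simp add: flat_def poly_monom pderiv_pCons power3_eq_cube power2_eq_square)
  \<comment> \<open>From \<open>e\<^sup>y\<^sup>/\<^sup>3 \<ge> y / 3\<close>.\<close>
  have cube: "y ^ 3 * exp (- y) \<le> 27" if "y > 0" for y :: real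
  proof -
    have "(y / 3) ^ 3 \<le> exp (y / 3) ^ 3"
      using that exp_ge_add_one_self[of "y / 3"] by (intro power_mono) linarith+
    also have "\<dots> = exp y" by (simp flip: exp_of_nat_mult)
    finally show ?thesis by (simp add: exp_minus field_simps power3_eq_cube)
  qed
  show ?thesis
  proof
    show "smooth_on UNIV (trunc' M)"
      using smooth_on_affine_compose[OF smooth_on_flat, of "[:1,1:]" 1 "- M"] by (simp add: trunc'_def[abs_def])
    show "(trunc M has_real_derivative trunc' M s) (at s)" for s
    proof -
      have "((\<lambda>x. x * flat 1 x) has_real_derivative (s - M) * flat (monom 1 2 * (1 - pderiv 1)) (s - M) + 1 * flat 1 (s - M)) (at (s - M))"
        by (rule DERIV_mult'[OF DERIV_ident DERIV_flat])
      moreover have "x * flat (monom 1 2 * (1 - pderiv 1)) x + 1 * flat 1 x = flat [:1, 1:] x" for x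
        by (simp add: flat_def poly_monom power2_eq_square field_simps)
      ultimately have "((\<lambda>x. x * flat 1 x) has_real_derivative flat [:1, 1:] (s - M)) (at (s - M))"
        by simp
      from shift[where G = "\<lambda>x. x * flat 1 x", OF this] show ?thesis
        unfolding trunc_def[abs_def] trunc'_def .
    qed
    show "0 \<le> deriv (trunc' M) s" for s by (simp add: d' d3)
    show "deriv (trunc' M) s \<le> 27" for s using cube[of "inverse (s - M)"] by (simp add: d' d3)
    show "\<bar>trunc' M s\<bar> \<le> 1" for s
    proof (cases "s \<le> M")
      case False
      have "(1 + y) * exp (- y) \<le> 1" "0 \<le> (1 + y) * exp (- y)" if "y > 0" for y :: real
        using exp_ge_add_one_self[of y] that by (auto simp: exp_minus field_simps)
      from this[of "inverse (s - M)"] show ?thesis using False by (simp add: trunc'_def flat_def)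
    qed (simp add: trunc'_def flat_def)
  qed (use assms in \<open>auto simp: trunc_def trunc'_def flat_def\<close>)
qed

lemma trunc_eq_0_iff: "trunc M s = 0 \<longleftrightarrow> s \<le> M"
  by (auto simp: trunc_def flat_def)

text \<open>For \<open>r = s\<close> this is the dissipativity of the reaction above the level \<open>M\<close>; the lemma says what is left of it when
the argument \<open>r\<close> of \<open>f\<close> and the argument \<open>s\<close> of the truncation differ. The dangerous case is \<open>r < M < s\<close>, where
\<open>f(r)\<close> may be large and positive. If \<open>\<bar>r\<bar> > N\<close>, then \<open>\<bar>f(r)\<bar>\<close> is small compared with \<open>1 + \<bar>r\<bar>\<^sup>p\<close>; if \<open>\<bar>r\<bar> \<le> N\<close>,
then \<open>f(r)\<close> is bounded, and \<open>\<beta>(s) \<le> 27 (s - M) \<le> 27 (s - r)\<close> is absorbed by the quadratic term.\<close>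

lemma reaction_dissipation:
  fixes f :: "real \<Rightarrow> real"
  assumes cont: "continuous_on UNIV f"
    and growth: "\<And>s. - \<kappa> - \<alpha>\<^sub>2 * \<bar>s\<bar> powr p \<le> f s * s" "\<And>s. f s * s \<le> \<kappa> - \<alpha>\<^sub>1 * \<bar>s\<bar> powr p"
    and pos: "\<alpha>\<^sub>1 > 0" "\<alpha>\<^sub>2 > 0" "\<kappa> \<ge> 0" "p \<ge> 2" "H \<ge> 0" "\<epsilon> > 0"
    and M: "M \<ge> 1" "\<alpha>\<^sub>1 * M \<ge> \<kappa> + H"
  shows "\<exists>C\<ge>0. \<forall>r s h. \<bar>h\<bar> \<le> H \<longrightarrow>
    (f r + h) * trunc' M s \<le> - \<alpha>\<^sub>1 * trunc M s + \<epsilon> * (1 + \<bar>r\<bar> powr p) + C * (r - s)\<^sup>2"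
proof -
  interpret truncation_pair "trunc M" "trunc' M" 27 using truncation_pair_trunc M by simp
  define A where "A = \<kappa> + \<alpha>\<^sub>2"
  have A: "A > 0" using pos by (simp add: A_def)
  have fr: "\<bar>f r\<bar> * \<bar>r\<bar> \<le> A * (1 + \<bar>r\<bar> powr p)" for r
  proof -
    have "0 \<le> \<alpha>\<^sub>1 * \<bar>r\<bar> powr p" "0 \<le> \<alpha>\<^sub>2 * \<bar>r\<bar> powr p" "0 \<le> \<kappa> * \<bar>r\<bar> powr p" using pos by simp_all
    then have "\<bar>f r * r\<bar> \<le> \<kappa> + \<alpha>\<^sub>2 * \<bar>r\<bar> powr p" using growth[of r] by linarith
    also have "\<dots> \<le> A * (1 + \<bar>r\<bar> powr p)"
      using pos \<open>0 \<le> \<kappa> * \<bar>r\<bar> powr p\<close> by (simp add: A_def algebra_simps)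
    finally show ?thesis by (simp add: abs_mult)
  qed
  define N where "N = max 1 (2 * A / \<epsilon>)"
  have N: "N > 0" "2 * A \<le> \<epsilon> * N"
  proof -
    show "N > 0" by (simp add: N_def)
    have "2 * A / \<epsilon> \<le> N" by (simp add: N_def)
    then show "2 * A \<le> \<epsilon> * N" using pos by (simp add: field_simps)
  qed
  have large: "\<bar>f r\<bar> \<le> \<epsilon> / 2 * (1 + \<bar>r\<bar> powr p)" if "\<bar>r\<bar> > N" for r
  proof -
    have "\<bar>f r\<bar> * N \<le> \<bar>f r\<bar> * \<bar>r\<bar>" using that by (intro mult_left_mono) auto
    also have "\<dots> \<le> A * (1 + \<bar>r\<bar> powr p)" by (rule fr)
    also have "\<dots> \<le> (\<epsilon> * N / 2) * (1 + \<bar>r\<bar> powr p)" using N by (intro mult_right_mono) auto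
    finally have "\<bar>f r\<bar> * N \<le> (\<epsilon> / 2 * (1 + \<bar>r\<bar> powr p)) * N" by (simp add: mult.commute mult.left_commute)
    then show ?thesis using N(1) by (simp only: mult_le_cancel_right_pos)
  qed
  have "bounded (f ` {-N..N})"
    by (intro compact_imp_bounded compact_continuous_image continuous_on_subset[OF cont]) auto
  then obtain B0 where B0: "\<forall>r\<in>{-N..N}. \<bar>f r\<bar> \<le> B0" unfolding bounded_real by auto
  define B where "B = max B0 0"
  have B: "\<bar>f r\<bar> \<le> B" if "\<bar>r\<bar> \<le> N" for r
  proof -
    have "r \<in> {-N..N}" using that by auto
    then show ?thesis using B0 by (auto simp: B_def le_max_iff_disj)
  qed
  have B_pos: "B \<ge> 0" by (simp add: B_def)
  \<comment> \<open>All terms that are linear in \<open>\<bar>s - r\<bar>\<close> together have at most the slope \<open>K\<close>.\<close>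
  define K where "K = 27 * (B + H) + \<alpha>\<^sub>1"
  have K: "K > 0" using B_pos pos by (simp add: K_def)
  define C where "C = K\<^sup>2 / (2 * \<epsilon>)"
  have C: "C \<ge> 0" using pos by (simp add: C_def)
  have young: "K * d \<le> \<epsilon> / 2 + C * d\<^sup>2" for d
  proof -
    have "0 \<le> (\<epsilon> - K * d)\<^sup>2" by simp
    then have "2 * \<epsilon> * (K * d) \<le> \<epsilon>\<^sup>2 + K\<^sup>2 * d\<^sup>2" by (simp add: power2_diff power_mult_distrib algebra_simps)
    then have "(2 * \<epsilon> * (K * d)) / (2 * \<epsilon>) \<le> (\<epsilon>\<^sup>2 + K\<^sup>2 * d\<^sup>2) / (2 * \<epsilon>)"
      using pos by (intro divide_right_mono) auto
    then show ?thesis using pos by (simp add: C_def add_divide_distrib power2_eq_square)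
  qed
  show ?thesis
  proof (intro exI[of _ C] conjI allI impI)
    fix r s h :: real assume h: "\<bar>h\<bar> \<le> H"
    let ?\<beta> = "trunc' M s" and ?P = "1 + \<bar>r\<bar> powr p"
    have P: "?P \<ge> 1" by simp
    have eP: "\<epsilon> / 2 \<le> \<epsilon> / 2 * ?P" using P pos by simp
    have eP0: "0 \<le> \<epsilon> / 2 * ?P" using P pos by simp
    show "(f r + h) * ?\<beta> \<le> - \<alpha>\<^sub>1 * trunc M s + \<epsilon> * ?P + C * (r - s)\<^sup>2"
    proof (cases "s \<le> M")
      case True
      then have "?\<beta> = 0" "trunc M s = 0" by (simp_all add: trunc'_def trunc_def flat_def)
      then show ?thesis using pos P C by simp
    next
      case False
      have \<beta>: "0 \<le> ?\<beta>" "?\<beta> \<le> 1" "?\<beta> \<le> 27 * (s - M)"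
      proof -
        show "0 \<le> ?\<beta>" using False by (simp add: trunc'_def flat_def)
        show "?\<beta> \<le> 1" using \<beta>_bounded[of s] by simp
        have "trunc' M M = 0" by (simp add: trunc'_def flat_def)
        then show "?\<beta> \<le> 27 * (s - M)" using \<beta>_diff(2)[of M s] False by simp
      qed
      have \<Phi>: "trunc M s \<le> (s - M) * ?\<beta>"
        using False by (auto simp: trunc_def trunc'_def flat_def intro!: mult_left_mono)
      then have "\<alpha>\<^sub>1 * trunc M s \<le> \<alpha>\<^sub>1 * ((s - M) * ?\<beta>)" using pos by (intro mult_left_mono) auto
      note \<Phi> = this
      show ?thesis
      proof (cases "r \<ge> M")
        case True
        \<comment> \<open>Here \<open>r \<ge> 1\<close> and \<open>p \<ge> 2\<close> give \<open>f(r) \<le> \<kappa> - \<alpha>\<^sub>1 r\<close>.\<close>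
        have "r\<^sup>2 = r powr 2" using True M by simp
        also have "\<dots> \<le> \<bar>r\<bar> powr p" using True M pos by (intro order_trans[OF powr_mono[of 2 p r]]) auto
        finally have "\<alpha>\<^sub>1 * r\<^sup>2 \<le> \<alpha>\<^sub>1 * \<bar>r\<bar> powr p" using pos by (intro mult_left_mono) auto
        then have "f r * r \<le> \<kappa> - \<alpha>\<^sub>1 * r\<^sup>2" using growth(2)[of r] by linarith
        also have "\<dots> \<le> (\<kappa> - \<alpha>\<^sub>1 * r) * r"
          using True M pos mult_left_mono[of 1 r \<kappa>] by (simp add: algebra_simps power2_eq_square)
        finally have "f r \<le> \<kappa> - \<alpha>\<^sub>1 * r" using True M by (simp only: mult_le_cancel_right_pos)
        then have "f r + h \<le> - \<alpha>\<^sub>1 * (r - M)" using h M(2) by (simp add: algebra_simps)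
        then have "(f r + h) * ?\<beta> \<le> - \<alpha>\<^sub>1 * (r - M) * ?\<beta>" using \<beta> by (intro mult_right_mono)
        also have "\<dots> = - (\<alpha>\<^sub>1 * ((s - M) * ?\<beta>)) + \<alpha>\<^sub>1 * (s - r) * ?\<beta>" by (simp add: algebra_simps)
        also have "\<alpha>\<^sub>1 * (s - r) * ?\<beta> \<le> \<alpha>\<^sub>1 * \<bar>s - r\<bar>"
        proof -
          have "(s - r) * ?\<beta> \<le> \<bar>s - r\<bar> * 1"
            by (rule order_trans[OF mult_right_mono[OF abs_ge_self] mult_left_mono]) (use \<beta> in simp_all)
          then have "\<alpha>\<^sub>1 * ((s - r) * ?\<beta>) \<le> \<alpha>\<^sub>1 * (\<bar>s - r\<bar> * 1)" using pos by (intro mult_left_mono) auto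
          then show ?thesis by (simp add: mult.assoc)
        qed
        also have "\<alpha>\<^sub>1 * \<bar>s - r\<bar> \<le> K * \<bar>s - r\<bar>"
          using B_pos pos by (auto simp: K_def intro!: mult_right_mono)
        also have "\<dots> \<le> \<epsilon> / 2 + C * (r - s)\<^sup>2"
          using young[of "\<bar>s - r\<bar>"] by (simp add: power2_commute)
        finally show ?thesis using \<Phi> eP eP0 by simp
      next
        case False2: False
        let ?d = "s - r"
        have d: "0 < ?d" "s - M < ?d" using False False2 by auto
        have \<Phi>d: "\<alpha>\<^sub>1 * trunc M s \<le> \<alpha>\<^sub>1 * ?d"
        proof -
          have "(s - M) * ?\<beta> \<le> ?d * 1" using d \<beta> False by (intro mult_mono) auto
          then have "\<alpha>\<^sub>1 * ((s - M) * ?\<beta>) \<le> \<alpha>\<^sub>1 * ?d" using pos by (intro mult_left_mono) auto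
          with \<Phi> show ?thesis by linarith
        qed
        have "27 * (s - M) \<le> 27 * ?d" using d by simp
        with \<beta>(3) have \<beta>d: "?\<beta> \<le> 27 * ?d" by (rule order_trans)
        have "h * ?\<beta> \<le> H * (27 * ?d)"
          using h \<beta> \<beta>d pos(5) by (intro mult_mono) auto
        moreover have "f r * ?\<beta> \<le> \<epsilon> / 2 * ?P + B * (27 * ?d)"
        proof (cases "\<bar>r\<bar> \<le> N")
          case True
          have "f r * ?\<beta> \<le> B * (27 * ?d)"
            using B[OF True] \<beta> \<beta>d B_pos by (intro mult_mono) auto
          then show ?thesis using eP0 by linarith
        next
          case False
          have "f r * ?\<beta> \<le> \<epsilon> / 2 * ?P * 1"
            using large[of r] False \<beta> eP0 by (intro mult_mono) auto
          moreover have "0 \<le> B * (27 * ?d)" using B_pos d by simp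
          ultimately show ?thesis by linarith
        qed
        moreover have "H * (27 * ?d) + B * (27 * ?d) + \<alpha>\<^sub>1 * ?d = K * ?d"
          by (simp add: K_def algebra_simps)
        moreover have "K * ?d \<le> \<epsilon> / 2 + C * (r - s)\<^sup>2" using young[of ?d] by (simp add: power2_commute)
        moreover have "(f r + h) * ?\<beta> = f r * ?\<beta> + h * ?\<beta>" by (simp add: distrib_right)
        ultimately have "(f r + h) * ?\<beta> \<le> - (\<alpha>\<^sub>1 * trunc M s) + (\<epsilon> / 2 * ?P + \<epsilon> / 2) + C * (r - s)\<^sup>2"
          using \<Phi>d by linarith
        then show ?thesis using eP by (simp add: algebra_simps)
      qed
    qed
  qed (rule C)
qed

section \<open>The reaction and diffusion terms at a fixed time\<close>

lemma integrable_lebesgue_on_subset: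
  fixes g :: "'a::euclidean_space \<Rightarrow> real"
  assumes "integrable (lebesgue_on A) g" "B \<subseteq> A" "A \<in> sets lebesgue" "B \<in> sets lebesgue"
  shows "integrable (lebesgue_on B) g"
proof -
  have "integrable lebesgue (\<lambda>x. indicator A x *\<^sub>R g x)"
    using assms by (subst (asm) integrable_restrict_space) auto
  then have "integrable lebesgue (\<lambda>x. indicator B x *\<^sub>R (indicator A x *\<^sub>R g x))"
    using assms(4) by (rule integrable_mult_indicator[rotated])
  also have "(\<lambda>x. indicator B x *\<^sub>R (indicator A x *\<^sub>R g x)) = (\<lambda>x. indicator B x *\<^sub>R g x)"
    by (rule ext) (use assms(2) in \<open>auto simp: indicator_def\<close>)
  finally show ?thesis using assms by (subst integrable_restrict_space) auto
qed

lemma AE_lebesgue_on_subset: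
  assumes "AE x in lebesgue_on A. P x" "B \<subseteq> A" "A \<in> sets lebesgue" "B \<in> sets lebesgue"
  shows "AE x in lebesgue_on B. P x"
proof -
  have "AE x in lebesgue. x \<in> A \<longrightarrow> P x"
    using assms(1,3) by (subst (asm) AE_restrict_space_iff) auto
  then have "AE x in lebesgue. x \<in> B \<longrightarrow> P x"
    by eventually_elim (use assms(2) in auto)
  then show ?thesis using assms(4) by (subst AE_restrict_space_iff) auto
qed

lemma integrable_lebesgue_onI:
  fixes g :: "'a::euclidean_space \<Rightarrow> real"
  assumes "integrable lebesgue g" "S \<in> sets lebesgue"
  shows "integrable (lebesgue_on S) g"
  using integrable_lebesgue_on_subset[of UNIV g S] assms by (simp add: lebesgue_on_UNIV_eq)

lemma lebesgue_on_integral_le: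
  fixes g :: "'a::euclidean_space \<Rightarrow> real"
  assumes "integrable lebesgue g" "S \<in> sets lebesgue" "\<And>x. 0 \<le> g x"
  shows "(LINT x|lebesgue_on S. g x) \<le> (LINT x|lebesgue. g x)"
proof -
  have "(LINT x|lebesgue_on S. g x) = (LINT x|lebesgue. indicator S x *\<^sub>R g x)"
    using assms by (subst integral_restrict_space) auto
  also have "\<dots> \<le> (LINT x|lebesgue. g x)"
    using assms by (intro integral_mono integrable_mult_indicator) (auto simp: indicator_def)
  finally show ?thesis .
qed

lemma AE_lebesgue_onI:
  assumes "AE x in lebesgue. P x" "S \<in> sets lebesgue" shows "AE x in lebesgue_on S. P x"
  using assms by (subst AE_restrict_space_iff) (auto elim: eventually_mono)

lemma Lp_norm_powr:
  assumes "p > 0"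
  shows "Lp_norm p S w powr p = (LINT x|lebesgue_on S. \<bar>L2_rep w x\<bar> powr p)"
proof -
  have "0 \<le> (LINT x|lebesgue_on S. \<bar>L2_rep w x\<bar> powr p)" by (intro integral_nonneg_AE) simp
  then show ?thesis using assms by (simp add: Lp_norm_def powr_powr)
qed

context truncation_pair
begin

lemma energy_class:
  assumes "square_integrable v" shows "energy (L2_class v) = (LINT x|lebesgue. \<Phi> (v x))"
  unfolding energy_def
proof (rule integral_cong_AE)
  show "AE x in lebesgue. \<Phi> (L2_rep (L2_class v) x) = \<Phi> (v x)"
    using L2_rep_class[OF assms] by eventually_elim simp
qed (auto intro!: borel_measurable_integrable integrable_\<Phi> square_integrable_L2_rep assms)

lemma nemytskii_tendsto:
  assumes "(X \<longlongrightarrow> u) F" shows "((\<lambda>n. nemytskii (X n)) \<longlongrightarrow> nemytskii u) F"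
proof -
  have "((\<lambda>n. L * norm (X n - u)) \<longlongrightarrow> L * norm (u - u)) F"
    by (intro tendsto_intros assms)
  then have "((\<lambda>n. L * norm (X n - u)) \<longlongrightarrow> 0) F" by simp
  then have "((\<lambda>n. nemytskii (X n) - nemytskii u) \<longlongrightarrow> 0) F"
    by (rule Lim_null_comparison[rotated]) (simp add: nemytskii_lipschitz)
  then show ?thesis by (simp add: LIM_zero_iff)
qed

text \<open>Integration of the pointwise inequality. Its left-hand side is integrable because \<open>\<beta>\<close> is bounded and \<open>f(w)\<close> grows
at most like \<open>\<bar>w\<bar>\<^sup>p\<close>.\<close>

lemma reaction_term_le:
  assumes S: "open S" "bounded S" and \<phi>: "\<phi> \<in> test_functions S" and w: "w \<in> Lp_on p S" and "p > 0"
    and f: "continuous_on UNIV f" "\<And>r. \<bar>f r\<bar> \<le> A * (1 + \<bar>r\<bar> powr p)"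
    and H: "AE x in lebesgue_on S. \<bar>L2_rep h x\<bar> \<le> H"
    and C: "\<And>r s k. \<bar>k\<bar> \<le> H \<Longrightarrow>
      (f r + k) * \<beta> s \<le> - c * \<Phi> s + \<epsilon> * (1 + \<bar>r\<bar> powr p) + C * (r - s)\<^sup>2" "C \<ge> 0"
  defines "v \<equiv> nemytskii (L2_class \<phi>)"
  shows "(LINT x|lebesgue_on S. f (L2_rep w x) * L2_rep v x) + inner h v
    \<le> - c * energy (L2_class \<phi>) + \<epsilon> * (measure lebesgue S + Lp_norm p S w powr p) + C * (norm (w - L2_class \<phi>))\<^sup>2"
proof -
  have mS: "S \<in> sets lebesgue" "S \<in> lmeasurable"
    using S by (auto intro: lmeasurable_open fmeasurableD)
  define \<psi> where "\<psi> x = \<beta> (\<phi> x)" for x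
  have \<psi>: "\<psi> \<in> test_functions S" unfolding \<psi>_def by (rule test_functions_compose[OF \<phi> smooth zero(2)])
  note s\<phi> = square_integrable_test[OF \<phi>] and s\<psi> = square_integrable_test[OF \<psi>]
  have v: "v = L2_class \<psi>" unfolding v_def \<psi>_def by (rule nemytskii_class[OF s\<phi>, symmetric])
  let ?M = "lebesgue_on S" and ?w = "L2_rep w" and ?h = "L2_rep h"
  have mf: "(\<lambda>x. f (?w x)) \<in> borel_measurable lebesgue"
    by (rule borel_measurable_continuous_on[OF f(1) L2_rep_measurable])
  have iw: "integrable ?M (\<lambda>x. \<bar>?w x\<bar> powr p)" using w by (simp add: Lp_on_def)
  have i1: "integrable ?M (\<lambda>x. 1 :: real)"
    by (rule finite_measure.integrable_const[OF finite_measure_lebesgue_on[OF mS(2)]])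
  have ifw: "integrable ?M (\<lambda>x. f (?w x) * \<psi> x)"
  proof (rule Bochner_Integration.integrable_bound)
    show "integrable ?M (\<lambda>x. A * (1 + \<bar>?w x\<bar> powr p))"
      using iw i1 by (intro integrable_mult_right Bochner_Integration.integrable_add)
    show "(\<lambda>x. f (?w x) * \<psi> x) \<in> borel_measurable ?M"
      using mf square_integrable_measurable[OF s\<psi>]
      by (intro measurable_restrict_space1 borel_measurable_times)
    have "norm (f r * \<beta> s) \<le> norm (A * (1 + \<bar>r\<bar> powr p))" for r s
    proof -
      have "\<bar>f r\<bar> * \<bar>\<beta> s\<bar> \<le> \<bar>f r\<bar> * 1" by (intro mult_left_mono \<beta>_bounded) simp
      then have "\<bar>f r * \<beta> s\<bar> \<le> A * (1 + \<bar>r\<bar> powr p)"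
        using f(2)[of r] unfolding abs_mult by linarith
      then show ?thesis by (metis abs_ge_self order_trans real_norm_def)
    qed
    then show "AE x in ?M. norm (f (?w x) * \<psi> x) \<le> norm (A * (1 + \<bar>?w x\<bar> powr p))"
      unfolding \<psi>_def by (intro AE_I2)
  qed
  have ih: "integrable ?M (\<lambda>x. ?h x * \<psi> x)"
    by (intro integrable_lebesgue_onI square_integrable_mult square_integrable_L2_rep s\<psi> mS)
  have i\<Phi>: "integrable ?M (\<lambda>x. \<Phi> (\<phi> x))"
    by (intro integrable_lebesgue_onI integrable_\<Phi> s\<phi> mS)
  have "square_integrable (\<lambda>x. ?w x + (-1) * \<phi> x)"
    by (intro square_integrable_add square_integrable_scale square_integrable_L2_rep s\<phi>)
  then have sd: "integrable lebesgue (\<lambda>x. (?w x - \<phi> x)\<^sup>2)" by (simp add: square_integrable_def)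
  have id: "integrable ?M (\<lambda>x. (?w x - \<phi> x)\<^sup>2)"
    by (intro integrable_lebesgue_onI sd mS)
  have "(LINT x|?M. f (?w x) * L2_rep v x) = (LINT x|?M. f (?w x) * \<psi> x)"
  proof (rule integral_cong_AE)
    show "AE x in ?M. f (?w x) * L2_rep v x = f (?w x) * \<psi> x"
      using AE_lebesgue_onI[OF L2_rep_class[OF s\<psi>] mS(1)] unfolding v by eventually_elim simp
    show "(\<lambda>x. f (?w x) * L2_rep v x) \<in> borel_measurable ?M"
      using mf L2_rep_measurable by (intro measurable_restrict_space1 borel_measurable_times)
  qed (use ifw in auto)
  moreover have "inner h v = (LINT x|?M. ?h x * \<psi> x)"
    unfolding v by (rule inner_test_eq[OF S(1) \<psi>, symmetric])
  ultimately have "(LINT x|?M. f (?w x) * L2_rep v x) + inner h v = (LINT x|?M. f (?w x) * \<psi> x + ?h x * \<psi> x)"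
    using ifw ih by (simp add: Bochner_Integration.integral_add)
  also have "\<dots> \<le> (LINT x|?M. - c * \<Phi> (\<phi> x) + \<epsilon> * (1 + \<bar>?w x\<bar> powr p) + C * (?w x - \<phi> x)\<^sup>2)"
  proof (rule integral_mono_AE)
    show "integrable ?M (\<lambda>x. f (?w x) * \<psi> x + ?h x * \<psi> x)" using ifw ih by (rule Bochner_Integration.integrable_add)
    show "integrable ?M (\<lambda>x. - c * \<Phi> (\<phi> x) + \<epsilon> * (1 + \<bar>?w x\<bar> powr p) + C * (?w x - \<phi> x)\<^sup>2)"
      by (intro Bochner_Integration.integrable_add integrable_mult_right i\<Phi> i1 iw id)
    show "AE x in ?M. f (?w x) * \<psi> x + ?h x * \<psi> x \<le> - c * \<Phi> (\<phi> x) + \<epsilon> * (1 + \<bar>?w x\<bar> powr p) + C * (?w x - \<phi> x)\<^sup>2"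
      using H by eventually_elim (use C(1) in \<open>simp add: \<psi>_def distrib_right[symmetric]\<close>)
  qed
  also have "\<dots> = - c * (LINT x|?M. \<Phi> (\<phi> x)) + \<epsilon> * ((LINT x|?M. 1) + (LINT x|?M. \<bar>?w x\<bar> powr p)) + C * (LINT x|?M. (?w x - \<phi> x)\<^sup>2)"
    using i\<Phi> i1 iw id by (simp add: Bochner_Integration.integral_add)
  also have "(LINT x|?M. \<Phi> (\<phi> x)) = energy (L2_class \<phi>)"
    unfolding energy_class[OF s\<phi>]
    by (rule lebesgue_on_integral_supported[OF mS(1)]) (simp add: test_functions_zero[OF \<phi>] zero)
  also have "(LINT x|?M. 1) = measure lebesgue S"
    using mS by (simp add: measure_restrict_space space_restrict_space)
  also have "(LINT x|?M. \<bar>?w x\<bar> powr p) = Lp_norm p S w powr p"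
    using \<open>p > 0\<close> by (simp add: Lp_norm_powr)
  also have "C * (LINT x|?M. (?w x - \<phi> x)\<^sup>2) \<le> C * (norm (w - L2_class \<phi>))\<^sup>2"
  proof (intro mult_left_mono C(2))
    have "(LINT x|?M. (?w x - \<phi> x)\<^sup>2) \<le> (LINT x|lebesgue. (?w x - \<phi> x)\<^sup>2)"
      by (intro lebesgue_on_integral_le sd mS) simp
    also have "\<dots> = (norm (w - L2_class \<phi>))\<^sup>2"
      unfolding norm_L2_square
    proof (rule integral_cong_AE)
      show "AE x in lebesgue. (?w x - \<phi> x)\<^sup>2 = (L2_rep (w - L2_class \<phi>) x)\<^sup>2"
        using L2_rep_diff[of w "L2_class \<phi>"] L2_rep_class[OF s\<phi>] by eventually_elim simp
      show "(\<lambda>x. (?w x - \<phi> x)\<^sup>2) \<in> borel_measurable lebesgue"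
        by (rule borel_measurable_integrable[OF sd])
      show "(\<lambda>x. (L2_rep (w - L2_class \<phi>) x)\<^sup>2) \<in> borel_measurable lebesgue"
        by (intro borel_measurable_power L2_rep_measurable)
    qed
    finally show "(LINT x|?M. (?w x - \<phi> x)\<^sup>2) \<le> (norm (w - L2_class \<phi>))\<^sup>2" .
  qed
  finally show ?thesis by simp
qed

text \<open>Move the derivatives onto \<open>w\<close>, replace the truncation of \<open>\<phi>\<close> by that of \<open>w\<close>, and use the sign of
\<open>(\<Delta>w, \<beta>(w))\<close>. The factor \<open>\<parallel>\<Delta>w\<parallel>\<close> is replaced by \<open>1 + \<parallel>w\<parallel>\<^sup>2\<close> in the graph norm, whose time integral is controlled.\<close>

lemma diffusion_term_ge:
  assumes S: "open S" and \<phi>: "\<phi> \<in> test_functions S" and w: "w \<in> dom_A S"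
    and a: "0 \<le> \<alpha>" "\<alpha> \<le> A"
  defines "v \<equiv> nemytskii (L2_class \<phi>)"
  shows "- (\<alpha> * grad_inner S w v) \<le> A * L * norm (w - L2_class \<phi>) * (1 + dom_A_norm S w powr 2)"
proof -
  have v: "v = L2_class (\<lambda>x. \<beta> (\<phi> x))"
    unfolding v_def by (rule nemytskii_class[OF square_integrable_test[OF \<phi>], symmetric])
  let ?l = "laplacian S w" and ?d = "norm (w - L2_class \<phi>)"
  have "- grad_inner S w v = inner ?l v"
    unfolding v using grad_inner_test[OF S w test_functions_compose[OF \<phi> smooth zero(2)]] by simp
  also have "\<dots> = inner ?l (nemytskii w) + inner ?l (v - nemytskii w)" by (simp add: inner_diff_right)
  also have "\<dots> \<le> 0 + norm ?l * norm (v - nemytskii w)"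
    by (intro add_mono laplacian_nemytskii_nonpos[OF S w] norm_cauchy_schwarz)
  also have "\<dots> \<le> (1 + dom_A_norm S w powr 2) * (L * ?d)"
  proof -
    have "norm ?l \<le> dom_A_norm S w"
      unfolding dom_A_norm_def by (intro real_le_rsqrt) simp
    also have "\<dots> \<le> 1 + (dom_A_norm S w)\<^sup>2"
    proof -
      have "0 \<le> (dom_A_norm S w - 1 / 2)\<^sup>2" by simp
      then show ?thesis by (simp add: power2_diff field_simps)
    qed
    also have "(dom_A_norm S w)\<^sup>2 = dom_A_norm S w powr 2" by (simp add: dom_A_norm_def)
    finally have "norm ?l \<le> 1 + dom_A_norm S w powr 2" .
    moreover have "norm (v - nemytskii w) \<le> L * ?d"
      unfolding v_def using nemytskii_lipschitz[of "L2_class \<phi>" w] by (simp add: norm_minus_commute)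
    ultimately show ?thesis by (simp add: mult_mono)
  qed
  finally have le: "- grad_inner S w v \<le> (1 + dom_A_norm S w powr 2) * (L * ?d)" .
  have "- (\<alpha> * grad_inner S w v) = \<alpha> * (- grad_inner S w v)" by simp
  also have "\<dots> \<le> \<alpha> * ((1 + dom_A_norm S w powr 2) * (L * ?d))" by (intro mult_left_mono le a)
  also have "\<dots> \<le> A * ((1 + dom_A_norm S w powr 2) * (L * ?d))"
    using L_nonneg a by (intro mult_right_mono mult_nonneg_nonneg) auto
  finally show ?thesis by (simp add: algebra_simps)
qed

end

lemma AE_interval_witness:
  assumes "AE x in lebesgue_on {s<..<t::real}. P x" "s < t"
  shows "\<exists>x\<in>{s<..<t}. P x"
proof (rule ccontr)
  assume no: "\<not> ?thesis"
  have "AE x in lebesgue. x \<in> {s<..<t} \<longrightarrow> P x"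
    using assms(1) by (subst (asm) AE_restrict_space_iff) auto
  then have "AE x in lebesgue. x \<notin> {s<..<t}" by eventually_elim (use no in blast)
  then have "{s<..<t} \<in> null_sets lebesgue" by (subst AE_iff_null_sets) auto
  then have "negligible {s<..<t}" by (simp add: negligible_iff_null_sets)
  then show False using open_not_negligible[of "{s<..<t}"] assms(2) by auto
qed

text \<open>The trajectory lies in \<open>H\<^sub>0\<^sup>1\<close> at almost every time only, but by continuity in \<open>L\<^sup>2\<close> every positive time is a limit
of such times.\<close>

lemma regular_solution_near_test:
  assumes S: "open S" and u: "regular_solution S a f h p u" "continuous_on {0..} u"
    and t: "t > 0" and \<omega>: "\<omega> > 0"
  obtains \<phi> where "\<phi> \<in> test_functions S" "norm (u t - L2_class \<phi>) < \<omega>"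
proof -
  have "isCont u t"
    using u(2) t continuous_on_interior[of "{0..}" u t] by simp
  then obtain d where d: "d > 0" "\<And>s. dist s t < d \<Longrightarrow> dist (u s) (u t) < \<omega> / 2"
    using \<omega> unfolding continuous_at_eps_delta by (meson half_gt_zero)
  have "u \<in> Bochner_Lp 2 {0<..<t + d} (H10 S) (H10_norm S)"
    using u(1) t d(1) unfolding regular_solution_def weak_solution_def by simp
  then have "AE s in lebesgue_on {0<..<t + d}. u s \<in> H10 S"
    by (simp add: Bochner_Lp_def strongly_measurable_on_def)
  then have "AE s in lebesgue_on {t<..<t + d}. u s \<in> H10 S"
    by (rule AE_lebesgue_on_subset) (use t in auto)
  then obtain s where s: "t < s" "s < t + d" "u s \<in> H10 S"
    using AE_interval_witness[where s = t and t = "t + d" and P = "\<lambda>s. u s \<in> H10 S"] d(1) by auto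
  obtain \<phi> where \<phi>: "\<phi> \<in> test_functions S" "norm (u s - L2_class \<phi>) < \<omega> / 2"
    using H10_approx[OF S s(3), of "\<omega> / 2"] \<omega> by auto
  have "dist (u s) (u t) < \<omega> / 2" using d(2)[of s] s by (simp add: dist_real_def)
  then have "norm (u t - L2_class \<phi>) < \<omega>"
    using \<phi>(2) norm_triangle_ineq[of "u t - u s" "u s - L2_class \<phi>"]
    by (simp add: dist_norm norm_minus_commute)
  with \<phi>(1) show ?thesis by (rule that)
qed

section \<open>Decay of the energy along regular solutions\<close>

context truncation_pair
begin

text \<open>\<open>\<beta>(\<phi>)\<close> is admissible in the weak formulation; integrate the resulting scalar equation from \<open>s\<close> to \<open>t\<close> and bound the
integrand for almost every \<open>\<tau>\<close>.\<close>

lemma test_increment_le: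
  assumes S: "open S" "bounded S" and \<phi>: "\<phi> \<in> test_functions S" and p: "p \<ge> 2"
    and f: "continuous_on UNIV f" "\<And>r. \<bar>f r\<bar> \<le> A * (1 + \<bar>r\<bar> powr p)"
    and H: "AE x in lebesgue_on S. \<bar>L2_rep h x\<bar> \<le> H"
    and C: "\<And>r s k. \<bar>k\<bar> \<le> H \<Longrightarrow>
      (f r + k) * \<beta> s \<le> - c * \<Phi> s + \<epsilon> * (1 + \<bar>r\<bar> powr p) + C * (r - s)\<^sup>2" "C \<ge> 0"
    and u: "weak_solution S a f h p u" "continuous_on {0..} u"
    and st: "0 < s" "s < t"
    and good: "AE \<tau> in lebesgue_on {s..t}. u \<tau> \<in> Lp_on p S \<and> u \<tau> \<in> dom_A S \<and>
      0 \<le> a ((H10_norm S (u \<tau>))\<^sup>2) \<and> a ((H10_norm S (u \<tau>))\<^sup>2) \<le> A\<^sub>0"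
    and int: "integrable (lebesgue_on {s..t}) (\<lambda>\<tau>. Lp_norm p S (u \<tau>) powr p)"
      "integrable (lebesgue_on {s..t}) (\<lambda>\<tau>. dom_A_norm S (u \<tau>) powr 2)"
    and near: "\<And>\<tau>. \<tau> \<in> {s..t} \<Longrightarrow> norm (u \<tau> - L2_class \<phi>) \<le> \<omega>"
  shows "inner (u t - u s) (nemytskii (L2_class \<phi>)) \<le>
    (LINT \<tau>|lebesgue_on {s..t}. - c * energy (L2_class \<phi>)
      + \<epsilon> * (measure lebesgue S + Lp_norm p S (u \<tau>) powr p) + C * \<omega>\<^sup>2
      + A\<^sub>0 * L * \<omega> * (1 + dom_A_norm S (u \<tau>) powr 2))"
proof -
  let ?v = "nemytskii (L2_class \<phi>)"
  define \<psi> where "\<psi> x = \<beta> (\<phi> x)" for x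
  have \<psi>: "\<psi> \<in> test_functions S" unfolding \<psi>_def by (rule test_functions_compose[OF \<phi> smooth zero(2)])
  have v: "?v = L2_class \<psi>" unfolding \<psi>_def
    by (rule nemytskii_class[OF square_integrable_test[OF \<phi>], symmetric])
  have mS: "S \<in> sets lebesgue" "S \<in> lmeasurable"
    using S by (auto intro: lmeasurable_open fmeasurableD)
  have "?v \<in> H10 S" unfolding v by (rule test_in_H10[OF S(1) \<psi>])
  moreover have "?v \<in> Lp_on p S"
    unfolding Lp_on_def mem_Collect_eq
  proof
    show "?v \<in> L2_on S" using \<open>?v \<in> H10 S\<close> by (simp add: H10_def H1_def)
    have ae: "AE x in lebesgue_on S. \<bar>L2_rep ?v x\<bar> \<le> 1"
    proof (rule AE_lebesgue_onI[OF _ mS(1)])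
      show "AE x in lebesgue. \<bar>L2_rep ?v x\<bar> \<le> 1"
        using L2_rep_class[OF square_integrable_test[OF \<psi>]] unfolding v
        by eventually_elim (simp add: \<psi>_def \<beta>_bounded)
    qed
    show "integrable (lebesgue_on S) (\<lambda>x. \<bar>L2_rep ?v x\<bar> powr p)"
    proof (rule Bochner_Integration.integrable_bound)
      show "integrable (lebesgue_on S) (\<lambda>x. 1 :: real)"
        by (rule finite_measure.integrable_const[OF finite_measure_lebesgue_on[OF mS(2)]])
      show "(\<lambda>x. \<bar>L2_rep ?v x\<bar> powr p) \<in> borel_measurable (lebesgue_on S)"
        using L2_rep_measurable[of ?v] by (intro measurable_restrict_space1) measurable
      show "AE x in lebesgue_on S. norm (\<bar>L2_rep ?v x\<bar> powr p) \<le> norm (1::real)"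
        using ae by eventually_elim (use p in \<open>simp add: powr_le1\<close>)
    qed
  qed
  ultimately have ode: "distributional_ode {0<..} (\<lambda>t. inner (u t) ?v)
      (\<lambda>t. a ((H10_norm S (u t))\<^sup>2) * grad_inner S (u t) ?v)
      (\<lambda>t. (LINT x|lebesgue_on S. f (L2_rep (u t) x) * L2_rep ?v x) + inner h ?v)"
    using u(1) unfolding weak_solution_def by blast
  have cont: "continuous_on {0<..} (\<lambda>t. inner (u t) ?v)"
    by (intro continuous_intros continuous_on_subset[OF u(2)]) auto
  note inc = distributional_ode_increment[OF ode cont st]
  have i1: "integrable (lebesgue_on {s..t}) (\<lambda>x. r :: real)" for r
    by (rule finite_measure.integrable_const[OF finite_measure_lebesgue_on]) simp
  have "inner (u t - u s) ?v = inner (u t) ?v - inner (u s) ?v" by (simp add: inner_diff_left)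
  also note inc(1)
  also have "(LINT \<tau>|lebesgue_on {s..t}. (LINT x|lebesgue_on S. f (L2_rep (u \<tau>) x) * L2_rep ?v x) + inner h ?v
      - a ((H10_norm S (u \<tau>))\<^sup>2) * grad_inner S (u \<tau>) ?v)
    \<le> (LINT \<tau>|lebesgue_on {s..t}. - c * energy (L2_class \<phi>)
      + \<epsilon> * (measure lebesgue S + Lp_norm p S (u \<tau>) powr p) + C * \<omega>\<^sup>2
      + A\<^sub>0 * L * \<omega> * (1 + dom_A_norm S (u \<tau>) powr 2))"
  proof (rule integral_mono_AE[OF inc(2)])
    show "integrable (lebesgue_on {s..t}) (\<lambda>\<tau>. - c * energy (L2_class \<phi>)
      + \<epsilon> * (measure lebesgue S + Lp_norm p S (u \<tau>) powr p) + C * \<omega>\<^sup>2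
      + A\<^sub>0 * L * \<omega> * (1 + dom_A_norm S (u \<tau>) powr 2))"
      by (intro Bochner_Integration.integrable_add integrable_mult_right i1 int)
    have ae': "AE \<tau> in lebesgue_on {s..t}. \<tau> \<in> {s..t}"
      by (rule AE_I2) (simp add: space_restrict_space)
    show "AE \<tau> in lebesgue_on {s..t}. (LINT x|lebesgue_on S. f (L2_rep (u \<tau>) x) * L2_rep ?v x) + inner h ?v
        - a ((H10_norm S (u \<tau>))\<^sup>2) * grad_inner S (u \<tau>) ?v
      \<le> - c * energy (L2_class \<phi>) + \<epsilon> * (measure lebesgue S + Lp_norm p S (u \<tau>) powr p) + C * \<omega>\<^sup>2
        + A\<^sub>0 * L * \<omega> * (1 + dom_A_norm S (u \<tau>) powr 2)"
      using good ae'
    proof eventually_elim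
      case (elim \<tau>)
      let ?d = "norm (u \<tau> - L2_class \<phi>)" and ?\<alpha> = "a ((H10_norm S (u \<tau>))\<^sup>2)"
      let ?Q = "1 + dom_A_norm S (u \<tau>) powr 2"
      have d: "?d \<le> \<omega>" using near elim by blast
      have 1: "(LINT x|lebesgue_on S. f (L2_rep (u \<tau>) x) * L2_rep ?v x) + inner h ?v
        \<le> - c * energy (L2_class \<phi>) + \<epsilon> * (measure lebesgue S + Lp_norm p S (u \<tau>) powr p) + C * ?d\<^sup>2"
        by (rule reaction_term_le[OF S \<phi> _ _ f H C]) (use elim p in auto)
      have 2: "- (?\<alpha> * grad_inner S (u \<tau>) ?v) \<le> A\<^sub>0 * L * ?d * ?Q"
        by (rule diffusion_term_ge[OF S(1) \<phi>]) (use elim in auto)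
      have "C * ?d\<^sup>2 \<le> C * \<omega>\<^sup>2" using d C(2) by (intro mult_left_mono power_mono) auto
      moreover have "A\<^sub>0 * L * ?d * ?Q \<le> A\<^sub>0 * L * \<omega> * ?Q"
        using d elim L_nonneg by (intro mult_right_mono mult_left_mono mult_nonneg_nonneg) auto
      ultimately show ?case using 1 2 by linarith
    qed
  qed
  finally show ?thesis .
qed

text \<open>The function \<open>G\<close> is independent of \<open>e\<close>: it collects the time-integrable norms of \<open>u\<close>. Given \<open>e\<close>, fix the constant
\<open>C\<close> of the dissipativity inequality first. Afterwards choose \<open>\<omega>\<close> so small that the remaining errors are below \<open>e\<close>, and
\<open>\<delta>\<close> by uniform continuity, so that \<open>u\<close> varies by less than \<open>\<omega> / 2\<close> on \<open>[s, t]\<close>.\<close>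

lemma energy_increment_le:
  fixes u :: "real \<Rightarrow> 'a::euclidean_space L2"
  assumes S: "open S" "bounded S" and p: "p \<ge> 2"
    and f: "continuous_on UNIV f" "\<And>r. \<bar>f r\<bar> \<le> A * (1 + \<bar>r\<bar> powr p)"
    and H: "AE x in lebesgue_on S. \<bar>L2_rep h x\<bar> \<le> H"
    and dissipative: "\<And>\<epsilon>. \<epsilon> > 0 \<Longrightarrow> \<exists>C\<ge>0. \<forall>r s k. \<bar>k\<bar> \<le> H \<longrightarrow>
      (f r + k) * \<beta> s \<le> - c * \<Phi> s + \<epsilon> * (1 + \<bar>r\<bar> powr p) + C * (r - s)\<^sup>2"
    and a: "\<And>s. s \<ge> 0 \<Longrightarrow> 0 \<le> a s" "\<And>s. s \<ge> 0 \<Longrightarrow> a s \<le> M\<^sub>1 + M\<^sub>2 * s" "M\<^sub>1 \<ge> 0" "M\<^sub>2 \<ge> 0"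
    and u: "regular_solution S a f h p u" "continuous_on {0..} u"
    and st: "0 < s\<^sub>0" "s\<^sub>0 < t\<^sub>0"
  shows "\<exists>G. integrable (lebesgue_on {s\<^sub>0..t\<^sub>0}) G \<and>
    (\<forall>e>0. \<exists>\<delta>>0. \<forall>s t. s\<^sub>0 \<le> s \<and> s < t \<and> t \<le> t\<^sub>0 \<and> t - s < \<delta> \<longrightarrow>
      energy (u t) - energy (u s) \<le> - c * (t - s) * energy (u t) + e * (LINT \<tau>|lebesgue_on {s..t}. G \<tau>))"
proof -
  have weak: "weak_solution S a f h p u" using u(1) by (simp add: regular_solution_def)
  let ?I = "{s\<^sub>0..t\<^sub>0}"
  have sub: "?I \<subseteq> {0<..<t\<^sub>0 + 1}" "?I \<subseteq> {s\<^sub>0 / 2<..<t\<^sub>0 + 1}" using st by auto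
  have T: "t\<^sub>0 + 1 > 0" "s\<^sub>0 / 2 > 0" "s\<^sub>0 / 2 < t\<^sub>0 + 1" using st by auto
  have B1: "u \<in> Bochner_Lp p {0<..<t\<^sub>0 + 1} (Lp_on p S) (Lp_norm p S)"
    using weak T unfolding weak_solution_def by blast
  have B2: "u \<in> Bochner_Linf {s\<^sub>0 / 2<..<t\<^sub>0 + 1} (H10 S) (H10_norm S)"
    "u \<in> Bochner_Lp 2 {s\<^sub>0 / 2<..<t\<^sub>0 + 1} (dom_A S) (dom_A_norm S)"
    using u(1) T unfolding regular_solution_def by blast+
  have P: "integrable (lebesgue_on ?I) (\<lambda>\<tau>. Lp_norm p S (u \<tau>) powr p)"
    using B1 by (intro integrable_lebesgue_on_subset[OF _ sub(1)]) (auto simp: Bochner_Lp_def)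
  have Q: "integrable (lebesgue_on ?I) (\<lambda>\<tau>. dom_A_norm S (u \<tau>) powr 2)"
    using B2 by (intro integrable_lebesgue_on_subset[OF _ sub(2)]) (auto simp: Bochner_Lp_def)
  have aeP: "AE \<tau> in lebesgue_on ?I. u \<tau> \<in> Lp_on p S"
    using B1 by (intro AE_lebesgue_on_subset[OF _ sub(1)]) (auto simp: Bochner_Lp_def strongly_measurable_on_def)
  have aeQ: "AE \<tau> in lebesgue_on ?I. u \<tau> \<in> dom_A S"
    using B2 by (intro AE_lebesgue_on_subset[OF _ sub(2)]) (auto simp: Bochner_Lp_def strongly_measurable_on_def)
  obtain C\<^sub>0 where "AE \<tau> in lebesgue_on {s\<^sub>0 / 2<..<t\<^sub>0 + 1}. H10_norm S (u \<tau>) \<le> C\<^sub>0"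
    using B2(1) unfolding Bochner_Linf_def by blast
  then have aeH: "AE \<tau> in lebesgue_on ?I. H10_norm S (u \<tau>) \<le> C\<^sub>0"
    by (rule AE_lebesgue_on_subset[OF _ sub(2)]) auto
  define A\<^sub>0 where "A\<^sub>0 = M\<^sub>1 + M\<^sub>2 * C\<^sub>0\<^sup>2"
  have A\<^sub>0: "A\<^sub>0 \<ge> 0" using a by (simp add: A\<^sub>0_def)
  have good: "AE \<tau> in lebesgue_on ?I. u \<tau> \<in> Lp_on p S \<and> u \<tau> \<in> dom_A S \<and>
      0 \<le> a ((H10_norm S (u \<tau>))\<^sup>2) \<and> a ((H10_norm S (u \<tau>))\<^sup>2) \<le> A\<^sub>0"
    using aeP aeQ aeH
  proof eventually_elim
    case (elim \<tau>)
    have "0 \<le> H10_norm S (u \<tau>)" by (simp add: H10_norm_def grad_inner_def sum_nonneg)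
    then have "(H10_norm S (u \<tau>))\<^sup>2 \<le> C\<^sub>0\<^sup>2" using elim by (intro power_mono)
    then have "M\<^sub>2 * (H10_norm S (u \<tau>))\<^sup>2 \<le> M\<^sub>2 * C\<^sub>0\<^sup>2" using a(4) by (rule mult_left_mono)
    then show ?case using elim a(1)[of "(H10_norm S (u \<tau>))\<^sup>2"] a(2)[of "(H10_norm S (u \<tau>))\<^sup>2"]
      by (simp add: A\<^sub>0_def)
  qed
  define \<mu> where "\<mu> = measure lebesgue S"
  define G where "G \<tau> = (\<mu> + Lp_norm p S (u \<tau>) powr p) + 1 + (1 + dom_A_norm S (u \<tau>) powr 2)" for \<tau>
  have i1: "integrable (lebesgue_on {s..t}) (\<lambda>x. r :: real)" for r s t :: real
    by (rule finite_measure.integrable_const[OF finite_measure_lebesgue_on]) simp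
  have iG: "integrable (lebesgue_on ?I) G"
    unfolding G_def by (intro Bochner_Integration.integrable_add i1 P Q)
  have uc: "uniformly_continuous_on ?I u"
    by (rule compact_uniformly_continuous) (use st in \<open>auto intro!: continuous_on_subset[OF u(2)]\<close>)
  show ?thesis
  proof (intro exI[of _ G] conjI allI impI iG)
    fix e :: real assume e: "e > 0"
    obtain C where C: "C \<ge> 0" "\<And>r s k. \<bar>k\<bar> \<le> H \<Longrightarrow>
        (f r + k) * \<beta> s \<le> - c * \<Phi> s + e * (1 + \<bar>r\<bar> powr p) + C * (r - s)\<^sup>2"
      using dissipative[OF e] by blast
    define \<omega> where "\<omega> = min 1 (e / (2 * (C + A\<^sub>0 * L + 1)))"
    have K: "C + A\<^sub>0 * L + 1 > 0" using C(1) A\<^sub>0 L_nonneg by (simp add: add_nonneg_pos)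
    have \<omega>: "0 < \<omega>" "\<omega> \<le> 1" "(2 * \<omega>) * (C + A\<^sub>0 * L + 1) \<le> e"
    proof -
      show "0 < \<omega>" "\<omega> \<le> 1" using e K by (auto simp: \<omega>_def)
      have "\<omega> \<le> e / (2 * (C + A\<^sub>0 * L + 1))" by (simp add: \<omega>_def)
      then show "(2 * \<omega>) * (C + A\<^sub>0 * L + 1) \<le> e" using K by (simp add: field_simps)
    qed
    define \<rho> where "\<rho> = \<omega> / 2"
    have \<rho>: "0 < \<rho>" "2 * \<rho> = \<omega>" using \<omega> by (auto simp: \<rho>_def)
    have AL: "0 \<le> A\<^sub>0 * L" using A\<^sub>0 L_nonneg by simp
    have small: "C * \<omega>\<^sup>2 \<le> e" "A\<^sub>0 * L * \<omega> \<le> e"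
    proof -
      have "\<omega>\<^sup>2 \<le> \<omega>" using \<omega> by (simp add: power2_eq_square mult_left_le)
      then have "C * \<omega>\<^sup>2 \<le> C * \<omega>" using C(1) by (rule mult_left_mono)
      moreover have "0 \<le> C * \<omega>" "0 \<le> A\<^sub>0 * L * \<omega>" using C AL \<omega> by auto
      moreover have "2 * (C * \<omega>) + 2 * (A\<^sub>0 * L * \<omega>) + 2 * \<omega> \<le> e" using \<omega>(3) by (simp add: algebra_simps)
      ultimately show "C * \<omega>\<^sup>2 \<le> e" "A\<^sub>0 * L * \<omega> \<le> e" using \<omega>(1) by linarith+
    qed
    obtain \<delta> where \<delta>: "\<delta> > 0" "\<And>s t. s \<in> ?I \<Longrightarrow> t \<in> ?I \<Longrightarrow> dist s t < \<delta> \<Longrightarrow> dist (u s) (u t) < \<rho>"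
      using uc \<rho>(1) unfolding uniformly_continuous_on_def by metis
    show "\<exists>\<delta>>0. \<forall>s t. s\<^sub>0 \<le> s \<and> s < t \<and> t \<le> t\<^sub>0 \<and> t - s < \<delta> \<longrightarrow>
      energy (u t) - energy (u s) \<le> - c * (t - s) * energy (u t) + e * (LINT \<tau>|lebesgue_on {s..t}. G \<tau>)"
    proof (intro exI[of _ \<delta>] conjI allI impI \<delta>(1))
      fix s t assume "s\<^sub>0 \<le> s \<and> s < t \<and> t \<le> t\<^sub>0 \<and> t - s < \<delta>"
      then have *: "s\<^sub>0 \<le> s" "s < t" "t \<le> t\<^sub>0" "t - s < \<delta>" by auto
      have s: "0 < s" and t: "0 < t" using * st by auto
      have sI: "{s..t} \<subseteq> ?I" using * by auto
      have iP: "integrable (lebesgue_on {s..t}) (\<lambda>\<tau>. Lp_norm p S (u \<tau>) powr p)"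
        by (rule integrable_lebesgue_on_subset[OF P sI]) auto
      have iQ: "integrable (lebesgue_on {s..t}) (\<lambda>\<tau>. dom_A_norm S (u \<tau>) powr 2)"
        by (rule integrable_lebesgue_on_subset[OF Q sI]) auto
      have iGs: "integrable (lebesgue_on {s..t}) G"
        by (rule integrable_lebesgue_on_subset[OF iG sI]) auto
      have goods: "AE \<tau> in lebesgue_on {s..t}. u \<tau> \<in> Lp_on p S \<and> u \<tau> \<in> dom_A S \<and>
          0 \<le> a ((H10_norm S (u \<tau>))\<^sup>2) \<and> a ((H10_norm S (u \<tau>))\<^sup>2) \<le> A\<^sub>0"
        by (rule AE_lebesgue_on_subset[OF good sI]) auto
      have step: "inner (u t - u s) (nemytskii (L2_class \<phi>)) \<le> - c * (t - s) * energy (L2_class \<phi>)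
          + e * (LINT \<tau>|lebesgue_on {s..t}. G \<tau>)"
        if \<phi>: "\<phi> \<in> test_functions S" "norm (u t - L2_class \<phi>) < \<rho>" for \<phi>
      proof -
        have near: "norm (u \<tau> - L2_class \<phi>) \<le> \<omega>" if "\<tau> \<in> {s..t}" for \<tau>
        proof -
          have "dist (u \<tau>) (u t) < \<rho>" using that * by (intro \<delta>(2)) (auto simp: dist_real_def)
          then show ?thesis
            using \<phi>(2) \<rho>(2) norm_triangle_ineq[of "u \<tau> - u t" "u t - L2_class \<phi>"] by (simp add: dist_norm)
        qed
        have "inner (u t - u s) (nemytskii (L2_class \<phi>)) \<le>
          (LINT \<tau>|lebesgue_on {s..t}. - c * energy (L2_class \<phi>)
            + e * (measure lebesgue S + Lp_norm p S (u \<tau>) powr p) + C * \<omega>\<^sup>2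
            + A\<^sub>0 * L * \<omega> * (1 + dom_A_norm S (u \<tau>) powr 2))"
          by (rule test_increment_le[OF S \<phi>(1) p f H C(2,1) weak u(2) s *(2) goods iP iQ near])
        also have "\<dots> \<le> (LINT \<tau>|lebesgue_on {s..t}. - c * energy (L2_class \<phi>) + e * G \<tau>)"
        proof (rule integral_mono)
          show "integrable (lebesgue_on {s..t}) (\<lambda>\<tau>. - c * energy (L2_class \<phi>)
            + e * (measure lebesgue S + Lp_norm p S (u \<tau>) powr p) + C * \<omega>\<^sup>2
            + A\<^sub>0 * L * \<omega> * (1 + dom_A_norm S (u \<tau>) powr 2))"
            by (intro Bochner_Integration.integrable_add integrable_mult_right i1 iP iQ)
          show "integrable (lebesgue_on {s..t}) (\<lambda>\<tau>. - c * energy (L2_class \<phi>) + e * G \<tau>)"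
            by (intro Bochner_Integration.integrable_add integrable_mult_right i1 iGs)
          fix \<tau>
          have "A\<^sub>0 * L * \<omega> * (1 + dom_A_norm S (u \<tau>) powr 2) \<le> e * (1 + dom_A_norm S (u \<tau>) powr 2)"
            by (intro mult_right_mono small) simp
          with small(1) show "- c * energy (L2_class \<phi>)
            + e * (measure lebesgue S + Lp_norm p S (u \<tau>) powr p) + C * \<omega>\<^sup>2
            + A\<^sub>0 * L * \<omega> * (1 + dom_A_norm S (u \<tau>) powr 2) \<le> - c * energy (L2_class \<phi>) + e * G \<tau>"
            unfolding G_def \<mu>_def by (simp add: distrib_left)
        qed
        also have "\<dots> = (LINT \<tau>|lebesgue_on {s..t}. - c * energy (L2_class \<phi>)) + e * (LINT \<tau>|lebesgue_on {s..t}. G \<tau>)"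
          by (subst Bochner_Integration.integral_add[OF i1 integrable_mult_right[OF iGs]]) simp
        also have "(LINT \<tau>|lebesgue_on {s..t}. - c * energy (L2_class \<phi>)) = - c * (t - s) * energy (L2_class \<phi>)"
          using *(2) by (simp add: measure_restrict_space space_restrict_space)
        finally show ?thesis .
      qed
      have "\<exists>\<phi>. \<phi> \<in> test_functions S \<and> norm (u t - L2_class \<phi>) < \<rho> * inverse (real (Suc n))" for n
        using regular_solution_near_test[OF S(1) u t, of "\<rho> * inverse (real (Suc n))"] \<rho>(1)
        by (metis inverse_positive_iff_positive mult_pos_pos of_nat_0_less_iff zero_less_Suc)
      then obtain \<phi> where \<phi>: "\<And>n. \<phi> n \<in> test_functions S"
        "\<And>n. norm (u t - L2_class (\<phi> n)) < \<rho> * inverse (real (Suc n))" by metis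
      have lim: "(\<lambda>n. L2_class (\<phi> n)) \<longlonglongrightarrow> u t"
      proof -
        have "(\<lambda>n. \<rho> * inverse (real (Suc n))) \<longlonglongrightarrow> \<rho> * 0"
          by (intro tendsto_intros LIMSEQ_inverse_real_of_nat)
        then have "(\<lambda>n. \<rho> * inverse (real (Suc n))) \<longlonglongrightarrow> 0" by simp
        moreover have "\<forall>\<^sub>F n in sequentially. norm (L2_class (\<phi> n) - u t) \<le> \<rho> * inverse (real (Suc n))"
          using \<phi>(2) by (intro always_eventually allI) (simp add: norm_minus_commute less_imp_le)
        ultimately have "(\<lambda>n. L2_class (\<phi> n) - u t) \<longlonglongrightarrow> 0"
          by (rule Lim_null_comparison[rotated])
        then show ?thesis by (simp add: LIM_zero_iff)
      qed
      have energy_lim: "(\<lambda>n. energy (L2_class (\<phi> n))) \<longlonglongrightarrow> energy (u t)"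
        using continuous_on_energy[of UNIV] lim
        by (auto simp: continuous_on_eq_continuous_at intro: isCont_tendsto_compose)
      have "energy (u t) - energy (u s) \<le> inner (nemytskii (u t)) (u t - u s)" by (rule energy_convex)
      also have "\<dots> = inner (u t - u s) (nemytskii (u t))" by (rule inner_commute)
      also have "\<dots> \<le> - c * (t - s) * energy (u t) + e * (LINT \<tau>|lebesgue_on {s..t}. G \<tau>)"
      proof (rule LIMSEQ_le)
        show "(\<lambda>n. inner (u t - u s) (nemytskii (L2_class (\<phi> n)))) \<longlonglongrightarrow> inner (u t - u s) (nemytskii (u t))"
          by (intro tendsto_intros nemytskii_tendsto lim)
        show "(\<lambda>n. - c * (t - s) * energy (L2_class (\<phi> n)) + e * (LINT \<tau>|lebesgue_on {s..t}. G \<tau>))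
            \<longlonglongrightarrow> - c * (t - s) * energy (u t) + e * (LINT \<tau>|lebesgue_on {s..t}. G \<tau>)"
          by (intro tendsto_intros energy_lim)
        show "\<exists>N. \<forall>n\<ge>N. inner (u t - u s) (nemytskii (L2_class (\<phi> n)))
            \<le> - c * (t - s) * energy (L2_class (\<phi> n)) + e * (LINT \<tau>|lebesgue_on {s..t}. G \<tau>)"
        proof (intro exI allI impI step \<phi>(1))
          fix n
          have "\<rho> * inverse (real (Suc n)) \<le> \<rho> * 1"
            using \<rho>(1) by (intro mult_left_mono) (auto simp: inverse_le_1_iff)
          then show "norm (u t - L2_class (\<phi> n)) < \<rho>" using \<phi>(2)[of n] by simp
        qed
      qed
      finally show "energy (u t) - energy (u s) \<le> - c * (t - s) * energy (u t) + e * (LINT \<tau>|lebesgue_on {s..t}. G \<tau>)" .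
    qed
  qed
qed

text \<open>A maximiser of the energy over the invariant set is of the form \<open>T 1 w\<close>. If its energy were positive, the energy
along the trajectory of \<open>w\<close> would stay above half of it near time \<open>1\<close> and therefore strictly decrease up to time \<open>1\<close>,
although none of its earlier values exceeds the last one.\<close>

lemma invariant_set_energy_zero:
  fixes K :: "'a::euclidean_space L2 set"
  assumes K: "compact K" and inv: "\<And>t. t \<ge> 0 \<Longrightarrow> T t ` K = K" and c: "c > 0"
    and cont: "\<And>w. w \<in> K \<Longrightarrow> continuous_on {0..} (\<lambda>t. T t w)"
    and decay: "\<And>w s\<^sub>0 t\<^sub>0. w \<in> K \<Longrightarrow> 0 < s\<^sub>0 \<Longrightarrow> s\<^sub>0 < t\<^sub>0 \<Longrightarrow>
      \<exists>G. integrable (lebesgue_on {s\<^sub>0..t\<^sub>0}) G \<and>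
        (\<forall>e>0. \<exists>\<delta>>0. \<forall>s t. s\<^sub>0 \<le> s \<and> s < t \<and> t \<le> t\<^sub>0 \<and> t - s < \<delta> \<longrightarrow>
          energy (T t w) - energy (T s w) \<le> - c * (t - s) * energy (T t w) + e * (LINT \<tau>|lebesgue_on {s..t}. G \<tau>))"
    and v: "v \<in> K"
  shows "energy v = 0"
proof -
  have "K \<noteq> {}" using v by blast
  from continuous_attains_sup[OF K this continuous_on_energy]
  obtain v\<^sub>1 where v\<^sub>1: "v\<^sub>1 \<in> K" "\<And>y. y \<in> K \<Longrightarrow> energy y \<le> energy v\<^sub>1" by blast
  have "v\<^sub>1 \<in> T 1 ` K" using inv[of 1] v\<^sub>1(1) by simp
  then obtain w where w: "w \<in> K" "v\<^sub>1 = T 1 w" by blast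
  define E where "E t = energy (T t w)" for t
  have E_le: "E t \<le> E 1" if "t \<ge> 0" for t
  proof -
    have "T t w \<in> K" using inv[OF that] w(1) by blast
    then show ?thesis unfolding E_def using v\<^sub>1(2) w(2) by simp
  qed
  have "\<not> E 1 > 0"
  proof
    assume pos: "E 1 > 0"
    have contE: "continuous_on {0..} E"
      unfolding E_def by (rule continuous_on_compose2[OF continuous_on_energy cont[OF w(1)]]) auto
    then have "isCont E 1" using continuous_on_interior[of "{0..}" E 1] by simp
    moreover have "E 1 / 2 > 0" using pos by simp
    ultimately obtain d where d: "d > 0" "\<And>t. dist t 1 < d \<Longrightarrow> dist (E t) (E 1) < E 1 / 2"
      unfolding continuous_at_eps_delta by metis
    define s\<^sub>0 where "s\<^sub>0 = max (1 / 2) (1 - d / 2)"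
    have s\<^sub>0: "0 < s\<^sub>0" "s\<^sub>0 < 1" using d(1) by (auto simp: s\<^sub>0_def)
    have E_ge: "E 1 / 2 \<le> E t" if "s\<^sub>0 \<le> t" "t \<le> 1" for t
    proof -
      have "dist t 1 < d" using that d(1) by (auto simp: s\<^sub>0_def dist_real_def max_def split: if_splits)
      from d(2)[OF this] show ?thesis unfolding dist_real_def by linarith
    qed
    obtain G where G: "integrable (lebesgue_on {s\<^sub>0..1}) G"
      and step: "\<And>e. e > 0 \<Longrightarrow> \<exists>\<delta>>0. \<forall>s t. s\<^sub>0 \<le> s \<and> s < t \<and> t \<le> 1 \<and> t - s < \<delta> \<longrightarrow>
          E t - E s \<le> - c * (t - s) * E t + e * (LINT \<tau>|lebesgue_on {s..t}. G \<tau>)"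
      using decay[OF w(1) s\<^sub>0] unfolding E_def by blast
    have Gi: "(LINT \<tau>|lebesgue_on {s..t}. G \<tau>) = integral {s..t} G" if "s\<^sub>0 \<le> s" "t \<le> 1" for s t
      by (rule lebesgue_integral_eq_integral[OF integrable_lebesgue_on_subset[OF G]]) (use that in auto)
    have Gon: "G integrable_on {s\<^sub>0..1}"
      using G by (rule integrable_on_lebesgue_on) simp
    define J where "J = integral {s\<^sub>0..1} G"
    have main: "c * (E 1 / 2) * (1 - s\<^sub>0) \<le> e * J" if e: "e > 0" for e
    proof -
      obtain \<delta> where \<delta>: "\<delta> > 0" "\<And>s t. s\<^sub>0 \<le> s \<Longrightarrow> s < t \<Longrightarrow> t \<le> 1 \<Longrightarrow> t - s < \<delta> \<Longrightarrow>
          E t - E s \<le> - c * (t - s) * E t + e * (LINT \<tau>|lebesgue_on {s..t}. G \<tau>)"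
        using step[OF e] by blast
      \<comment> \<open>The lower bound \<open>E 1 / 2\<close> replaces the energy in the decay term, which makes the drift linear.\<close>
      define Z where "Z t = E t + c * (E 1 / 2) * t - e * integral {s\<^sub>0..t} G" for t
      have "Z 1 \<le> Z s\<^sub>0"
      proof (rule nonincreasing_if_locally[OF \<delta>(1) s\<^sub>0(2)])
        fix s t assume st: "s\<^sub>0 \<le> s" "s < t" "t \<le> 1" "t - s < \<delta>"
        have comb: "integral {s\<^sub>0..s} G + integral {s..t} G = integral {s\<^sub>0..t} G"
          by (rule Henstock_Kurzweil_Integration.integral_combine)
            (use st in \<open>auto intro: integrable_subinterval_real[OF Gon]\<close>)
        have "e * integral {s\<^sub>0..t} G = e * integral {s\<^sub>0..s} G + e * integral {s..t} G"
          unfolding comb[symmetric] by (rule distrib_left)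
        moreover have "c * (t - s) * (E 1 / 2) \<le> c * (t - s) * E t"
          using c st E_ge[of t] by (intro mult_left_mono) auto
        moreover have "E t - E s \<le> - c * (t - s) * E t + e * integral {s..t} G"
          using \<delta>(2)[OF st] Gi[of s t] st by simp
        ultimately show "Z t \<le> Z s"
          unfolding Z_def by (simp add: algebra_simps)
      qed
      then show ?thesis using E_le[of s\<^sub>0] s\<^sub>0(1) by (simp add: Z_def J_def algebra_simps)
    qed
    have X: "c * (E 1 / 2) * (1 - s\<^sub>0) > 0" (is "?X > 0") using c pos s\<^sub>0 by simp
    \<comment> \<open>Small enough that \<open>e J\<close> is at most half of the gain \<open>c (E 1 / 2) (1 - s\<^sub>0)\<close>.\<close>
    define e where "e = ?X / (2 * (\<bar>J\<bar> + 1))"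
    have e: "e > 0" using X by (auto simp: e_def intro!: divide_pos_pos)
    have "?X \<le> e * J" by (rule main[OF e])
    also have "\<dots> \<le> e * (\<bar>J\<bar> + 1)" using e by (intro mult_left_mono) auto
    also have "\<dots> = ?X / 2"
    proof -
      have "\<bar>J\<bar> + 1 \<noteq> 0" by simp
      then show ?thesis unfolding e_def by (simp add: field_simps)
    qed
    finally show False using X by simp
  qed
  then show ?thesis using v\<^sub>1(2)[OF v] w(2) energy_nonneg[of v] by (simp add: E_def)
qed

end

section \<open>Boundedness of the attractor\<close>

context truncation_pair
begin

lemma attractor_truncated:
  fixes K :: "'a::euclidean_space L2 set"
  assumes S: "open S" "bounded S" and p: "p \<ge> 2" and c: "c > 0"
    and f: "continuous_on UNIV f" "\<And>r. \<bar>f r\<bar> \<le> A * (1 + \<bar>r\<bar> powr p)"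
    and H: "AE x in lebesgue_on S. \<bar>L2_rep h x\<bar> \<le> H"
    and dissipative: "\<And>\<epsilon>. \<epsilon> > 0 \<Longrightarrow> \<exists>C\<ge>0. \<forall>r s k. \<bar>k\<bar> \<le> H \<longrightarrow>
      (f r + k) * \<beta> s \<le> - c * \<Phi> s + \<epsilon> * (1 + \<bar>r\<bar> powr p) + C * (r - s)\<^sup>2"
    and a: "\<And>s. s \<ge> 0 \<Longrightarrow> 0 \<le> a s" "\<And>s. s \<ge> 0 \<Longrightarrow> a s \<le> M\<^sub>1 + M\<^sub>2 * s" "M\<^sub>1 \<ge> 0" "M\<^sub>2 \<ge> 0"
    and T: "regular_solution_map S a f h p T" and K: "global_attractor (L2_on S) T K"
    and v: "v \<in> K"
  shows "AE x in lebesgue. \<Phi> (L2_rep v x) = 0"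
proof (rule energy_eq_0D, rule invariant_set_energy_zero[OF _ _ c _ _ v])
  show "compact K" using K by (simp add: global_attractor_def)
  show "T t ` K = K" if "t \<ge> 0" for t using K that by (simp add: global_attractor_def)
  have KS: "w \<in> L2_on S" if "w \<in> K" for w using K that by (auto simp: global_attractor_def)
  show cont: "continuous_on {0..} (\<lambda>t. T t w)" if "w \<in> K" for w
    using T KS[OF that] by (simp add: regular_solution_map_def)
  have reg: "regular_solution S a f h p (\<lambda>t. T t w)" if "w \<in> K" for w
    using T KS[OF that] by (simp add: regular_solution_map_def)
  show "\<exists>G. integrable (lebesgue_on {s\<^sub>0..t\<^sub>0}) G \<and>
      (\<forall>e>0. \<exists>\<delta>>0. \<forall>s t. s\<^sub>0 \<le> s \<and> s < t \<and> t \<le> t\<^sub>0 \<and> t - s < \<delta> \<longrightarrow>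
        energy (T t w) - energy (T s w) \<le> - c * (t - s) * energy (T t w) + e * (LINT \<tau>|lebesgue_on {s..t}. G \<tau>))"
    if "w \<in> K" "0 < s\<^sub>0" "s\<^sub>0 < t\<^sub>0" for w s\<^sub>0 t\<^sub>0
    by (rule energy_increment_le[OF S p f H dissipative a reg cont]) (use that in auto)
qed

end

lemma growth_abs_le:
  fixes f :: "real \<Rightarrow> real"
  assumes cont: "continuous_on UNIV f"
    and growth: "\<And>s. - \<kappa> - \<alpha>\<^sub>2 * \<bar>s\<bar> powr p \<le> f s * s" "\<And>s. f s * s \<le> \<kappa> - \<alpha>\<^sub>1 * \<bar>s\<bar> powr p"
    and pos: "\<alpha>\<^sub>1 > 0" "\<alpha>\<^sub>2 > 0" "\<kappa> \<ge> 0"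
  shows "\<exists>A. \<forall>r. \<bar>f r\<bar> \<le> A * (1 + \<bar>r\<bar> powr p)"
proof -
  have "bounded (f ` {-1..1})"
    by (intro compact_imp_bounded compact_continuous_image continuous_on_subset[OF cont]) auto
  then obtain B where B: "\<forall>r\<in>{-1..1}. \<bar>f r\<bar> \<le> B" unfolding bounded_real by auto
  have "\<bar>f r\<bar> \<le> (\<bar>B\<bar> + \<kappa> + \<alpha>\<^sub>2) * (1 + \<bar>r\<bar> powr p)" for r
  proof -
    have nonneg: "0 \<le> \<alpha>\<^sub>1 * \<bar>r\<bar> powr p" "0 \<le> \<alpha>\<^sub>2 * \<bar>r\<bar> powr p" "0 \<le> \<kappa> * \<bar>r\<bar> powr p" "0 \<le> \<bar>B\<bar> * \<bar>r\<bar> powr p"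
      using pos by simp_all
    have expand: "(\<bar>B\<bar> + \<kappa> + \<alpha>\<^sub>2) * (1 + \<bar>r\<bar> powr p)
        = \<bar>B\<bar> + \<kappa> + \<alpha>\<^sub>2 + \<bar>B\<bar> * \<bar>r\<bar> powr p + \<kappa> * \<bar>r\<bar> powr p + \<alpha>\<^sub>2 * \<bar>r\<bar> powr p"
      by (simp add: algebra_simps)
    show ?thesis
    proof (cases "\<bar>r\<bar> \<le> 1")
      case True
      then have "r \<in> {-1..1}" by auto
      then have "\<bar>f r\<bar> \<le> B" using B by blast
      then have "\<bar>f r\<bar> \<le> \<bar>B\<bar>" by simp
      then show ?thesis using nonneg pos unfolding expand by linarith
    next
      case False
      have "\<bar>f r\<bar> * 1 \<le> \<bar>f r\<bar> * \<bar>r\<bar>" using False by (intro mult_left_mono) auto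
      moreover have "\<bar>f r * r\<bar> \<le> \<kappa> + \<alpha>\<^sub>2 * \<bar>r\<bar> powr p" using growth[of r] nonneg by linarith
      ultimately show ?thesis using nonneg pos unfolding expand abs_mult by linarith
    qed
  qed
  then show ?thesis by blast
qed

theorem theorem17:
  fixes \<Omega> :: "(real ^ 'n) set"
    and a f :: "real \<Rightarrow> real"
    and h :: "(real ^ 'n) L2"
    and \<eta> \<kappa> \<alpha>\<^sub>1 \<alpha>\<^sub>2 p m M\<^sub>1 M\<^sub>2 :: real
    and T\<^sub>r :: "real \<Rightarrow> (real ^ 'n) L2 \<Rightarrow> (real ^ 'n) L2"
    and \<A>\<^sub>r :: "(real ^ 'n) L2 set"
  assumes "open \<Omega>" and "bounded \<Omega>" and "smooth_boundary \<Omega>"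
    and "h \<in> L2_on \<Omega>"
    and "f C1_differentiable_on UNIV"
    and "\<forall>s. deriv f s \<le> \<eta>"
    and "\<alpha>\<^sub>1 > 0" and "\<alpha>\<^sub>2 > 0" and "\<kappa> \<ge> 0" and "p \<ge> 2"
    and "\<forall>s. - \<kappa> - \<alpha>\<^sub>2 * \<bar>s\<bar> powr p \<le> f s * s \<and> f s * s \<le> \<kappa> - \<alpha>\<^sub>1 * \<bar>s\<bar> powr p"
    and "continuous_on {0..} a" and "a ` {0..} \<subseteq> {0..}"
    and "m > 0" and "M\<^sub>1 \<ge> 0" and "M\<^sub>2 \<ge> 0"
    and "\<forall>s\<ge>0. m \<le> a s \<and> a s \<le> M\<^sub>1 + M\<^sub>2 * s"
    and "mono_on {0..} (\<lambda>s. a (s\<^sup>2) * s)"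
    and "regular_solution_map \<Omega> a f h p T\<^sub>r"
    and "global_attractor (L2_on \<Omega>) T\<^sub>r \<A>\<^sub>r"
    and "h \<in> Linf_on \<Omega>"
  shows "\<A>\<^sub>r \<subseteq> Linf_on \<Omega> \<and> (\<exists>C. \<forall>v\<in>\<A>\<^sub>r. Linf_norm \<Omega> v \<le> C)"
proof -
  have pos: "\<alpha>\<^sub>1 > 0" "\<alpha>\<^sub>2 > 0" "\<kappa> \<ge> 0" "p \<ge> 2" by fact+
  have growth: "- \<kappa> - \<alpha>\<^sub>2 * \<bar>s\<bar> powr p \<le> f s * s" "f s * s \<le> \<kappa> - \<alpha>\<^sub>1 * \<bar>s\<bar> powr p" for s
    using assms(11) by auto
  have cont: "continuous_on UNIV f"
    using \<open>f C1_differentiable_on UNIV\<close> by (rule C1_differentiable_imp_continuous_on)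
  obtain A where A: "\<And>r. \<bar>f r\<bar> \<le> A * (1 + \<bar>r\<bar> powr p)"
    using growth_abs_le[OF cont growth pos(1-3)] by blast
  obtain H\<^sub>0 where H\<^sub>0: "AE x in lebesgue_on \<Omega>. \<bar>L2_rep h x\<bar> \<le> H\<^sub>0"
    using \<open>h \<in> Linf_on \<Omega>\<close> by (auto simp: Linf_on_def)
  define H where "H = max H\<^sub>0 0"
  have H: "AE x in lebesgue_on \<Omega>. \<bar>L2_rep h x\<bar> \<le> H" "H \<ge> 0"
    using H\<^sub>0 by (auto simp: H_def le_max_iff_disj elim!: eventually_mono)
  \<comment> \<open>\<open>M \<ge> 1\<close> allows \<open>r\<^sup>2 \<le> r\<^sup>p\<close> above \<open>M\<close>; the second bound makes \<open>\<kappa> + H - \<alpha>\<^sub>1 r\<close> at most \<open>- \<alpha>\<^sub>1 (r - M)\<close> there.\<close>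
  define M where "M = max 1 ((\<kappa> + H) / \<alpha>\<^sub>1)"
  have M: "M \<ge> 1" "\<alpha>\<^sub>1 * M \<ge> \<kappa> + H"
  proof -
    show "M \<ge> 1" by (simp add: M_def)
    have "(\<kappa> + H) / \<alpha>\<^sub>1 \<le> M" by (simp add: M_def)
    then show "\<alpha>\<^sub>1 * M \<ge> \<kappa> + H" using pos(1) by (simp add: field_simps)
  qed
  interpret up: truncation_pair "trunc M" "trunc' M" 27
    by (rule truncation_pair_trunc) (use M in simp)
  interpret down: truncation_pair "\<lambda>s. trunc M (- s)" "\<lambda>s. - trunc' M (- s)" 27
    by (rule up.truncation_pair_reflect)
  have dissipative_up: "\<exists>C\<ge>0. \<forall>r s k. \<bar>k\<bar> \<le> H \<longrightarrow>
      (f r + k) * trunc' M s \<le> - \<alpha>\<^sub>1 * trunc M s + \<epsilon> * (1 + \<bar>r\<bar> powr p) + C * (r - s)\<^sup>2"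
    if "\<epsilon> > 0" for \<epsilon>
    by (rule reaction_dissipation[OF cont growth pos H(2) that M])
  have dissipative_down: "\<exists>C\<ge>0. \<forall>r s k. \<bar>k\<bar> \<le> H \<longrightarrow>
      (f r + k) * (- trunc' M (- s)) \<le> - \<alpha>\<^sub>1 * trunc M (- s) + \<epsilon> * (1 + \<bar>r\<bar> powr p) + C * (r - s)\<^sup>2"
    if \<epsilon>: "\<epsilon> > 0" for \<epsilon>
  proof -
    \<comment> \<open>The function \<open>- u\<close> solves the problem with reaction \<open>- f(- r)\<close>, which satisfies the same growth bounds, and source \<open>- h\<close>.\<close>
    have cont': "continuous_on UNIV (\<lambda>r. - f (- r))"
      by (intro continuous_intros continuous_on_compose2[OF cont]) auto
    have growth': "- \<kappa> - \<alpha>\<^sub>2 * \<bar>s\<bar> powr p \<le> - f (- s) * s" "- f (- s) * s \<le> \<kappa> - \<alpha>\<^sub>1 * \<bar>s\<bar> powr p" for s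
      using growth[of "- s"] by simp_all
    obtain C where C: "C \<ge> 0" "\<And>r s k. \<bar>k\<bar> \<le> H \<Longrightarrow>
        (- f (- r) + k) * trunc' M s \<le> - \<alpha>\<^sub>1 * trunc M s + \<epsilon> * (1 + \<bar>r\<bar> powr p) + C * (r - s)\<^sup>2"
      using reaction_dissipation[OF cont' growth' pos H(2) \<epsilon> M] by blast
    have "(f r + k) * (- trunc' M (- s)) \<le> - \<alpha>\<^sub>1 * trunc M (- s) + \<epsilon> * (1 + \<bar>r\<bar> powr p) + C * (r - s)\<^sup>2"
      if "\<bar>k\<bar> \<le> H" for r s k
    proof -
      have "(- f (- (- r)) + (- k)) * trunc' M (- s)
          \<le> - \<alpha>\<^sub>1 * trunc M (- s) + \<epsilon> * (1 + \<bar>- r\<bar> powr p) + C * ((- r) - (- s))\<^sup>2"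
        by (rule C(2)) (use that in simp)
      moreover have "((- r) - (- s))\<^sup>2 = (r - s)\<^sup>2" by (simp add: power2_commute)
      moreover have "(- f (- (- r)) + (- k)) * trunc' M (- s) = (f r + k) * (- trunc' M (- s))"
        by (simp add: algebra_simps)
      ultimately show ?thesis by simp
    qed
    with C(1) show ?thesis by blast
  qed
  have a: "0 \<le> a s" "a s \<le> M\<^sub>1 + M\<^sub>2 * s" if "s \<ge> 0" for s
  proof -
    have "m \<le> a s \<and> a s \<le> M\<^sub>1 + M\<^sub>2 * s" using assms(17) that by blast
    then show "0 \<le> a s" "a s \<le> M\<^sub>1 + M\<^sub>2 * s" using \<open>m > 0\<close> by auto
  qed
  have mS: "\<Omega> \<in> sets lebesgue" using \<open>open \<Omega>\<close> by auto
  have bound: "AE x in lebesgue_on \<Omega>. \<bar>L2_rep v x\<bar> \<le> M" if v: "v \<in> \<A>\<^sub>r" for v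
  proof (rule AE_lebesgue_onI[OF _ mS])
    have "AE x in lebesgue. trunc M (L2_rep v x) = 0"
      by (rule up.attractor_truncated[OF assms(1,2) pos(4,1) cont A H(1) dissipative_up a assms(15,16,19,20) v])
    moreover have "AE x in lebesgue. trunc M (- L2_rep v x) = 0"
      by (rule down.attractor_truncated[OF assms(1,2) pos(4,1) cont A H(1) dissipative_down a assms(15,16,19,20) v])
    ultimately show "AE x in lebesgue. \<bar>L2_rep v x\<bar> \<le> M"
      by eventually_elim (auto simp: trunc_eq_0_iff)
  qed
  show ?thesis
  proof (intro conjI subsetI exI[of _ M] ballI)
    fix v assume v: "v \<in> \<A>\<^sub>r"
    then have "v \<in> L2_on \<Omega>" using assms(20) by (auto simp: global_attractor_def)
    then show "v \<in> Linf_on \<Omega>" using bound[OF v] by (auto simp: Linf_on_def)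
    show "Linf_norm \<Omega> v \<le> M"
      unfolding Linf_norm_def
      by (rule cInf_lower) (use bound[OF v] M in \<open>auto intro!: bdd_belowI[of _ 0]\<close>)
  qed
qed

end
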